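(* Let $V$ be a separable Banach space, $\alpha,\beta\in(0,1)$ with $\alpha(1+\beta)>1$, $x\in V$, and consider the Itô map $C^\alpha_tC^{1+\beta}_V\to C^\alpha_tV$, $A\mapsto\Phi^A_{0\to\cdot}(x)$. Then this map is Fréchet differentiable, and for any $A,B\in C^\alpha_tC^{1+\beta}_V$, setting $X^x_t:=\Phi^A_{0\to t}(x)$, the Gateaux derivative \[ D_A\Phi^A_{0\to\cdot}(x)(B)=\lim_{\varepsilon\to0}\tfrac1\varepsilon\big(\Phi^{A+\varepsilon B}_{0\to\cdot}(x)-\Phi^A_{0\to\cdot}(x)\big)\in C^\alpha_tV \] satisfies the affine YDE \[ Y^x_t=\int_0^tDA(\mathrm{d} s,X^x_s)(Y^x_s)+\int_0^tB(\mathrm{d} s,X^x_s)\quad\forall t\in[0,T], \] and is given explicitly by \[ D_A\Phi^A_{0\to t}(x)(B)=J^x_{0\to t}\int_0^t(J^x_{0\to s})^{-1}B(\mathrm{d} s,X^x_s)\quad\forall t\in[0,T], \] where $J^x_{0\to\cdot}\in C^\alpha_t\mathcal L(V;V)$ is the unique solution to $J^x_{0\to t}=I+\int_0^tDA(\mathrm{d} r,X^x_r)\circ J^x_{0\to r}$, $t\in[0,T]$, and $(J^x_{0\to s})^{-1}$ denotes its inverse in $\mathcal L(V;V)$.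
   Context: Fix $T>0$. For a path $f:[0,T]\to E$, $f_{s,t}=f_t-f_s$, $\|f\|_\gamma=\sup_t\|f_t\|_E+\sup_{s<t}\|f_{s,t}\|_E/|t-s|^\gamma$, $C^\gamma_tE$ the paths with finite norm. For $g:V\to W$, $\|g\|_\beta=\sup_{x\ne y}\|g(x)-g(y)\|_W/\|x-y\|_V^\beta+\sup\|g\|_W$. Fields $A:[0,T]\times V\to V$ satisfy $A(0,\cdot)=0$, $A_{s,t}(x)=A(t,x)-A(s,x)$; $\|A\|_{\alpha,\beta}=\sup_{s<t}\|A_{s,t}\|_\beta/|t-s|^\alpha$; $A\in C^\alpha_tC^{1+\beta}_V$ means $\|A\|_{\alpha,\beta}<\infty$, $A(t,\cdot)$ Fréchet differentiable with $DA$ ($\mathcal L(V;V)$-valued) satisfying $\|DA\|_{\alpha,\beta}<\infty$; this is a Banach space with norm $\|A\|_{\alpha,\beta}+\|DA\|_{\alpha,\beta}$. For $A\in C^\alpha_tC^{1+\beta}_V$ and $x\in V$, $\Phi^A_{0\to\cdot}(x)$ denotes the unique solution $y\in C^\alpha_tV$ of $y_t=x+\int_0^tA(\mathrm{d} s,y_s)$. Integrals are sewing limits over partitions $\Pi=\{t_i\}$ of $[0,t]$: $\int_0^tA(\mathrm{d} s,y_s)=\lim_{|\Pi|\to0}\sum_iA_{t_i,t_{i+1}}(y_{t_i})$; $\int_0^tDA(\mathrm{d} s,X_s)(Y_s)=\lim\sum_iDA_{t_i,t_{i+1}}(X_{t_i})(Y_{t_i})$; $\int_0^tDA(\mathrm{d}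 r,X_r)\circ J_r=\lim\sum_iDA_{t_i,t_{i+1}}(X_{t_i})\circ J_{t_i}$; $\int_0^tN_sB(\mathrm{d} s,X_s)=\lim\sum_iN_{t_i}B_{t_i,t_{i+1}}(X_{t_i})$. *)

theory Defs
  imports "HOL-Analysis.Analysis"
begin

(* Supremum of a set of nonnegative reals (0 is added so that the empty set gives 0). *)
definition hsup :: "real set \<Rightarrow> real" where
  "hsup S = Sup (insert 0 S)"

definition incr_pairs :: "real \<Rightarrow> (real \<times> real) set" where
  "incr_pairs T = {(s,t). 0 \<le> s \<and> s < t \<and> t \<le> T}"

definition path_norm :: "real \<Rightarrow> real \<Rightarrow> (real \<Rightarrow> 'e::real_normed_vector) \<Rightarrow> real" where
  "path_norm T \<gamma> f =
     hsup ((\<lambda>t. norm (f t)) ` {0..T})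
   + hsup ((\<lambda>(s,t). norm (f t - f s) / (t - s) powr \<gamma>) ` incr_pairs T)"

definition holder_path :: "real \<Rightarrow> real \<Rightarrow> (real \<Rightarrow> 'e::real_normed_vector) \<Rightarrow> bool" where
  "holder_path T \<gamma> f \<longleftrightarrow>
     bdd_above ((\<lambda>t. norm (f t)) ` {0..T})
   \<and> bdd_above ((\<lambda>(s,t). norm (f t - f s) / (t - s) powr \<gamma>) ` incr_pairs T)"

definition fn_norm :: "real \<Rightarrow> ('v::real_normed_vector \<Rightarrow> 'w::real_normed_vector) \<Rightarrow> real" where
  "fn_norm \<beta> g =
     hsup ((\<lambda>(x,y). norm (g x - g y) / norm (x - y) powr \<beta>) ` {(x,y). x \<noteq> y})
   + hsup (range (\<lambda>x. norm (g x)))"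

definition fn_bdd :: "real \<Rightarrow> ('v::real_normed_vector \<Rightarrow> 'w::real_normed_vector) \<Rightarrow> bool" where
  "fn_bdd \<beta> g \<longleftrightarrow>
     bdd_above ((\<lambda>(x,y). norm (g x - g y) / norm (x - y) powr \<beta>) ` {(x,y). x \<noteq> y})
   \<and> bdd_above (range (\<lambda>x. norm (g x)))"

definition field_norm :: "real \<Rightarrow> real \<Rightarrow> real \<Rightarrow> (real \<Rightarrow> 'v::real_normed_vector \<Rightarrow> 'w::real_normed_vector) \<Rightarrow> real" where
  "field_norm T \<alpha> \<beta> A =
     hsup ((\<lambda>(s,t). fn_norm \<beta> (\<lambda>x. A t x - A s x) / (t - s) powr \<alpha>) ` incr_pairs T)"

definition field_bdd :: "real \<Rightarrow> real \<Rightarrow> real \<Rightarrow> (real \<Rightarrow> 'v::real_normed_vector \<Rightarrow> 'w::real_normed_vector) \<Rightarrow> bool" where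
  "field_bdd T \<alpha> \<beta> A \<longleftrightarrow>
     (\<forall>(s,t)\<in>incr_pairs T. fn_bdd \<beta> (\<lambda>x. A t x - A s x))
   \<and> bdd_above ((\<lambda>(s,t). fn_norm \<beta> (\<lambda>x. A t x - A s x) / (t - s) powr \<alpha>) ` incr_pairs T)"

definition fderivx :: "(real \<Rightarrow> 'v::real_normed_vector \<Rightarrow> 'w::real_normed_vector) \<Rightarrow> real \<Rightarrow> 'v \<Rightarrow> ('v \<Rightarrow>\<^sub>L 'w)" where
  "fderivx A t x = (SOME D. (A t has_derivative blinfun_apply D) (at x))"

definition field_space :: "real \<Rightarrow> real \<Rightarrow> real \<Rightarrow> (real \<Rightarrow> 'v::real_normed_vector \<Rightarrow> 'v) \<Rightarrow> bool" where
  "field_space T \<alpha> \<beta> A \<longleftrightarrow>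
     (\<forall>x. A 0 x = 0)
   \<and> field_bdd T \<alpha> \<beta> A
   \<and> (\<forall>t\<in>{0..T}. \<forall>x. A t differentiable (at x))
   \<and> field_bdd T \<alpha> \<beta> (fderivx A)"

definition field_space_norm :: "real \<Rightarrow> real \<Rightarrow> real \<Rightarrow> (real \<Rightarrow> 'v::real_normed_vector \<Rightarrow> 'v) \<Rightarrow> real" where
  "field_space_norm T \<alpha> \<beta> A = field_norm T \<alpha> \<beta> A + field_norm T \<alpha> \<beta> (fderivx A)"

definition has_sewing :: "(real \<Rightarrow> real \<Rightarrow> 'e::real_normed_vector) \<Rightarrow> real \<Rightarrow> real \<Rightarrow> 'e \<Rightarrow> bool" where
  "has_sewing \<Xi> a b I \<longleftrightarrow>
     (\<forall>\<epsilon>>0. \<exists>\<delta>>0. \<forall>(n::nat) (p::nat \<Rightarrow> real).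
        p 0 = a \<and> p n = b \<and> (\<forall>i<n. p i < p (Suc i)) \<and> (\<forall>i<n. p (Suc i) - p i < \<delta>)
        \<longrightarrow> norm ((\<Sum>i<n. \<Xi> (p i) (p (Suc i))) - I) < \<epsilon>)"

definition is_ito_sol :: "real \<Rightarrow> real \<Rightarrow> (real \<Rightarrow> 'v::real_normed_vector \<Rightarrow> 'v) \<Rightarrow> 'v \<Rightarrow> (real \<Rightarrow> 'v) \<Rightarrow> bool" where
  "is_ito_sol T \<alpha> A x y \<longleftrightarrow>
     holder_path T \<alpha> y
   \<and> (\<forall>t\<in>{0..T}. has_sewing (\<lambda>s u. A u (y s) - A s (y s)) 0 t (y t - x))"

definition ito :: "real \<Rightarrow> real \<Rightarrow> (real \<Rightarrow> 'v::real_normed_vector \<Rightarrow> 'v) \<Rightarrow> 'v \<Rightarrow> (real \<Rightarrow> 'v)" where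
  "ito T \<alpha> A x = (THE y. is_ito_sol T \<alpha> A x y \<and> (\<forall>t. t \<notin> {0..T} \<longrightarrow> y t = 0))"

(* Frechet differentiability at A of F : S -> {paths with P}, S a linear space of fields with
   norm N1, target normed by N2; L is the derivative. *)
definition frechet_at ::
  "((real \<Rightarrow> 'v::real_normed_vector \<Rightarrow> 'v) \<Rightarrow> bool) \<Rightarrow> ((real \<Rightarrow> 'v \<Rightarrow> 'v) \<Rightarrow> real)
   \<Rightarrow> ((real \<Rightarrow> 'e::real_normed_vector) \<Rightarrow> bool) \<Rightarrow> ((real \<Rightarrow> 'e) \<Rightarrow> real)
   \<Rightarrow> ((real \<Rightarrow> 'v \<Rightarrow> 'v) \<Rightarrow> (real \<Rightarrow> 'e)) \<Rightarrow> (real \<Rightarrow> 'v \<Rightarrow> 'v)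
   \<Rightarrow> ((real \<Rightarrow> 'v \<Rightarrow> 'v) \<Rightarrow> (real \<Rightarrow> 'e)) \<Rightarrow> bool" where
  "frechet_at S N1 P N2 F A L \<longleftrightarrow>
     (\<forall>H. S H \<longrightarrow> P (L H))
   \<and> (\<forall>H1 H2. S H1 \<longrightarrow> S H2 \<longrightarrow> L (\<lambda>t v. H1 t v + H2 t v) = (\<lambda>t. L H1 t + L H2 t))
   \<and> (\<forall>c H. S H \<longrightarrow> L (\<lambda>t v. c *\<^sub>R H t v) = (\<lambda>t. c *\<^sub>R L H t))
   \<and> (\<exists>K. \<forall>H. S H \<longrightarrow> N2 (L H) \<le> K * N1 H)
   \<and> (\<forall>\<epsilon>>0. \<exists>\<delta>>0. \<forall>H. S H \<longrightarrow> N1 H < \<delta> \<longrightarrow>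
        N2 (\<lambda>t. F (\<lambda>s v. A s v + H s v) t - F A t - L H t) \<le> \<epsilon> * N1 H)"

definition is_jac_sol :: "real \<Rightarrow> real \<Rightarrow> (real \<Rightarrow> 'v::real_normed_vector \<Rightarrow> 'v) \<Rightarrow> (real \<Rightarrow> 'v)
    \<Rightarrow> (real \<Rightarrow> ('v \<Rightarrow>\<^sub>L 'v)) \<Rightarrow> bool" where
  "is_jac_sol T \<alpha> A X J \<longleftrightarrow>
     holder_path T \<alpha> J
   \<and> (\<forall>t\<in>{0..T}. has_sewing (\<lambda>r u. (fderivx A u (X r) - fderivx A r (X r)) o\<^sub>L J r) 0 t
                    (J t - id_blinfun))"

definition blinv :: "('v::real_normed_vector \<Rightarrow>\<^sub>L 'v) \<Rightarrow> ('v \<Rightarrow>\<^sub>L 'v)" where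
  "blinv M = (THE K. K o\<^sub>L M = id_blinfun \<and> M o\<^sub>L K = id_blinfun)"

end

theory Submission
  imports Defs
begin

text \<open>Every equation is read in Davie's form: \<open>y\<close> solves it iff \<open>y\<^sub>t - y\<^sub>s\<close> agrees with the local germ up to
  \<open>M (t - s)\<^sup>\<mu>\<close> with \<open>\<mu> > 1\<close>. By the sewing estimate this is equivalent to convergence of the Riemann sums.
  If the germ of a difference \<open>Z\<close> of two solutions is bounded, together with its defect, by \<open>Z\<close> and a
  perturbation \<open>\<eta>\<close>, then the same contraction, in an exponentially weighted Hoelder norm on short steps, gives
  Picard iteration, uniqueness and the bound \<open>C (\<parallel>Z\<^sub>0\<parallel> + \<eta>)\<close>. Applied to
  \<open>\<Phi>(A + H) - \<Phi>(A)\<close> minus the solution of the affine equation, \<open>\<eta>\<close> is superlinear in the norm of \<open>H\<close>: half of the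
  Hoelder regularity of \<open>DA\<close> in excess of \<open>1/\<alpha> - 1\<close> suffices for sewing, the other half is turned into a power
  of \<open>H\<close>. The explicit formula is variation of constants, with \<open>J\<inverse>\<close> constructed as the solution of
  \<open>dK = - K DA(dr, X\<^sub>r)\<close>.\<close>

section \<open>Sewing\<close>

text \<open>The exponent is split because moving the base point of the Taylor remainder from
  \<open>X s\<close> to \<open>X u\<close> costs a factor of order
  \<open>norm Z powr (1 + \<beta> - b) * norm (X u - X s) powr b\<close>: sewing with the full
  exponent \<open>b = \<beta>\<close> would leave a term merely linear in \<open>Z\<close>, hence no
  differentiability, while \<open>b\<close> must still satisfy \<alpha>(1 + b) > 1. The nonlinear
  germ is dominated with a constant that depends on the Hoelder seminorm of one of the two paths
  compared. This forces Picard iteration to stay in a ball, and uniformity in \<open>H\<close>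
  requires one a priori bound for all small perturbations. Since \<open>V\<close> may be infinite
  dimensional, a left inverse of \<open>J\<close> need not be a right inverse; the second identity
  is obtained from uniqueness for a linear equation. The derivative is defined as the solution of
  the affine equation, not by the explicit formula. Linearity in \<open>B\<close> and independence
  of the choice of \<open>J\<close> are then consequences of uniqueness. As the derivative must be
  linear as a map into functions on all of the real line, paths are normalised to vanish outside
  \<open>[0,T]\<close>.\<close>

definition sew_const :: "real \<Rightarrow> real" where
  "sew_const \<mu> = 2 / (1 - 2 powr (1 - \<mu>))"

lemma sew_const_pos: "1 < \<mu> \<Longrightarrow> 0 < sew_const \<mu>"
  unfolding sew_const_def by (auto intro!: divide_pos_pos simp: powr_less_one)

text \<open>The fixed point equation of the bisection in \<open>discrete_sewing\<close>: two pieces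
  of at most half the length, each with constant \<open>sew_const \<mu>\<close>, plus two defects
  reproduce the same constant.\<close>

lemma sew_const_eq: "1 < \<mu> \<Longrightarrow> 2 * sew_const \<mu> * (1/2) powr \<mu> + 2 = sew_const \<mu>"
proof -
  assume m: "1 < \<mu>"
  define q where "q = (2::real) powr (1 - \<mu>)"
  have q: "q < 1" unfolding q_def using m by (simp add: powr_less_one)
  have "(1/2::real) powr \<mu> = q / 2"
    unfolding q_def by (simp add: powr_divide powr_diff)
  then show ?thesis unfolding sew_const_def q_def[symmetric] using q
    by (simp add: field_simps)
qed

lemma norm_four: "norm (a + b - c - d) \<le> norm a + norm b + norm c + norm (d :: 'e::real_normed_vector)"
  using norm_triangle_ineq4[of "a + b - c" d] norm_triangle_ineq4[of "a + b" c] norm_triangle_ineq[of a b]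
  by linarith

text \<open>Induction on the number of intervals. The interval containing the midpoint of
  \<open>[p i, p j]\<close> is split off, so the pieces on either side have at most half the length;
  joining the three costs two defects. The bound does not see the mesh. Repeated partition points
  are allowed, which is why the germ must vanish on the diagonal.\<close>

lemma discrete_sewing:
  fixes \<Xi> :: "real \<Rightarrow> real \<Rightarrow> 'e::real_normed_vector"
  assumes \<mu>: "1 < \<mu>" and c: "0 \<le> c" and p: "mono p" "\<And>i. p i \<in> {a..b}"
    and diag: "\<And>s. a \<le> s \<Longrightarrow> s \<le> b \<Longrightarrow> \<Xi> s s = 0"
    and delta: "\<And>s u t. a \<le> s \<Longrightarrow> s \<le> u \<Longrightarrow> u \<le> t \<Longrightarrow> t \<le> b \<Longrightarrow>
      norm (\<Xi> s t - \<Xi> s u - \<Xi> u t) \<le> c * (t - s) powr \<mu>"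
  shows "i \<le> j \<Longrightarrow> norm ((\<Sum>k=i..<j. \<Xi> (p k) (p (Suc k))) - \<Xi> (p i) (p j))
    \<le> sew_const \<mu> * c * (p j - p i) powr \<mu>"
proof (induction "j - i" arbitrary: i j rule: less_induct)
  case less
  let ?S = "\<lambda>i j. \<Sum>k=i..<j. \<Xi> (p k) (p (Suc k))"
  show ?case
  proof (cases "i = j")
    case True
    then show ?thesis using diag[of "p j"] p(2)[of j] by simp
  next
    case False
    then have ij: "i < j" using less.prems by simp
    define L where "L = p j - p i"
    have pij: "p i \<le> p j" using p(1) ij by (simp add: monoD)
    have L0: "0 \<le> L" using pij L_def by simp
    define mid where "mid = (p i + p j) / 2"
    \<comment> \<open>The first index after \<open>i\<close> at or beyond the midpoint; its
      predecessor \<open>k\<close> is the left end of the interval that straddles the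
      midpoint.\<close>
    define n0 where "n0 = (LEAST n. i < n \<and> mid \<le> p n)"
    have "i < j \<and> mid \<le> p j" using ij pij by (simp add: mid_def)
    then have n0: "i < n0" "mid \<le> p n0" "n0 \<le> j"
      unfolding n0_def by (metis (mono_tags, lifting) LeastI, metis (mono_tags, lifting) LeastI, simp add: Least_le)
    obtain k where k: "n0 = Suc k" using n0(1) by (metis less_imp_Suc_add)
    have ik: "i \<le> k" "k < j" using n0 k by auto
    have pk: "p k \<le> mid"
    proof (cases "k = i")
      case True then show ?thesis using pij by (simp add: mid_def)
    next
      case False
      then have "i < k" using ik by simp
      moreover have "k < n0" using k by simp
      ultimately show ?thesis unfolding n0_def using not_less_Least by fastforce
    qed
    have pk': "mid \<le> p (Suc k)" using n0 k by simp
    have m: "p i \<le> p k" "p k \<le> p (Suc k)" "p (Suc k) \<le> p j"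
      using ik by (simp_all add: monoD[OF p(1)])
    have d1: "norm (\<Xi> (p i) (p j) - \<Xi> (p i) (p k) - \<Xi> (p k) (p j)) \<le> c * L powr \<mu>"
      unfolding L_def using m p(2)[of i] p(2)[of j] by (intro delta) auto
    have "norm (\<Xi> (p k) (p j) - \<Xi> (p k) (p (Suc k)) - \<Xi> (p (Suc k)) (p j)) \<le> c * (p j - p k) powr \<mu>"
      using m p(2)[of k] p(2)[of j] by (intro delta) auto
    also have "\<dots> \<le> c * L powr \<mu>" unfolding L_def using m c \<mu> by (intro mult_left_mono powr_mono2) auto
    finally have d2: "norm (\<Xi> (p k) (p j) - \<Xi> (p k) (p (Suc k)) - \<Xi> (p (Suc k)) (p j)) \<le> c * L powr \<mu>" .
    have K0: "0 \<le> sew_const \<mu> * c" using sew_const_pos[OF \<mu>] c by simp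
    have "norm (?S i k - \<Xi> (p i) (p k)) \<le> sew_const \<mu> * c * (p k - p i) powr \<mu>"
      using ik by (intro less.hyps) auto
    also have "\<dots> \<le> sew_const \<mu> * c * (L / 2) powr \<mu>"
      unfolding L_def using m pk K0 \<mu> by (intro mult_left_mono powr_mono2) (auto simp: mid_def field_simps)
    finally have h1: "norm (?S i k - \<Xi> (p i) (p k)) \<le> sew_const \<mu> * c * (L / 2) powr \<mu>" .
    have "norm (?S (Suc k) j - \<Xi> (p (Suc k)) (p j)) \<le> sew_const \<mu> * c * (p j - p (Suc k)) powr \<mu>"
      using ik by (intro less.hyps) auto
    also have "\<dots> \<le> sew_const \<mu> * c * (L / 2) powr \<mu>"
      unfolding L_def using m pk' K0 \<mu> by (intro mult_left_mono powr_mono2) (auto simp: mid_def field_simps)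
    finally have h2: "norm (?S (Suc k) j - \<Xi> (p (Suc k)) (p j)) \<le> sew_const \<mu> * c * (L / 2) powr \<mu>" .
    have S: "?S i j = ?S i k + (\<Xi> (p k) (p (Suc k)) + ?S (Suc k) j)"
      using ik sum.atLeastLessThan_concat[of i k j "\<lambda>k. \<Xi> (p k) (p (Suc k))"]
      by (simp add: sum.atLeast_Suc_lessThan[of k j])
    have eq: "?S i j - \<Xi> (p i) (p j) = (?S i k - \<Xi> (p i) (p k)) + (?S (Suc k) j - \<Xi> (p (Suc k)) (p j))
       - (\<Xi> (p i) (p j) - \<Xi> (p i) (p k) - \<Xi> (p k) (p j))
       - (\<Xi> (p k) (p j) - \<Xi> (p k) (p (Suc k)) - \<Xi> (p (Suc k)) (p j))"
      unfolding S by simp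
    have "norm (?S i j - \<Xi> (p i) (p j)) \<le> 2 * (sew_const \<mu> * c * (L / 2) powr \<mu>) + 2 * (c * L powr \<mu>)"
      unfolding eq using h1 h2 d1 d2
      by (intro order_trans[OF norm_four]) linarith
    also have "\<dots> = (2 * sew_const \<mu> * (1/2) powr \<mu> + 2) * c * L powr \<mu>"
      using L0 by (simp add: powr_divide field_simps)
    finally show ?thesis unfolding sew_const_eq[OF \<mu>] L_def .
  qed
qed

lemma sum_powr_le:
  fixes p :: "nat \<Rightarrow> real"
  assumes "1 < \<mu>" "\<And>k. k < n \<Longrightarrow> p k \<le> p (Suc k)" "\<And>k. k < n \<Longrightarrow> p (Suc k) - p k \<le> d"
  shows "(\<Sum>k<n. (p (Suc k) - p k) powr \<mu>) \<le> d powr (\<mu> - 1) * (p n - p 0)"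
proof -
  have "(p (Suc k) - p k) powr \<mu> \<le> d powr (\<mu> - 1) * (p (Suc k) - p k)" if "k < n" for k
  proof -
    have "(p (Suc k) - p k) powr \<mu> = (p (Suc k) - p k) powr (\<mu> - 1) * (p (Suc k) - p k)"
      using assms(2)[OF that] by (cases "p (Suc k) = p k") (auto simp: powr_diff)
    also have "\<dots> \<le> d powr (\<mu> - 1) * (p (Suc k) - p k)"
      using assms(1) assms(2,3)[OF that] by (intro mult_right_mono powr_mono2) auto
    finally show ?thesis .
  qed
  then have "(\<Sum>k<n. (p (Suc k) - p k) powr \<mu>) \<le> (\<Sum>k<n. d powr (\<mu> - 1) * (p (Suc k) - p k))"
    by (intro sum_mono) auto
  also have "\<dots> = d powr (\<mu> - 1) * (p n - p 0)"
    by (simp add: sum_distrib_left[symmetric] sum_lessThan_telescope)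
  finally show ?thesis .
qed

text \<open>The constant stays existential: quantitative bounds are recovered afterwards from the
  defect of the germ by \<open>sewing_bound\<close>, and sums, multiples and products then need no
  bookkeeping.\<close>

definition sews :: "real \<Rightarrow> real \<Rightarrow> (real \<Rightarrow> real \<Rightarrow> 'e::real_normed_vector) \<Rightarrow> (real \<Rightarrow> 'e) \<Rightarrow> bool" where
  "sews T \<mu> \<Xi> y \<longleftrightarrow> (\<exists>M. \<forall>s t. 0 \<le> s \<longrightarrow> s \<le> t \<longrightarrow> t \<le> T \<longrightarrow>
      norm (y t - y s - \<Xi> s t) \<le> M * (t - s) powr \<mu>)"

lemma sewsI:
  assumes "\<And>s t. 0 \<le> s \<Longrightarrow> s \<le> t \<Longrightarrow> t \<le> T \<Longrightarrow> norm (y t - y s - \<Xi> s t) \<le> M * (t - s) powr \<mu>"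
  shows "sews T \<mu> \<Xi> y"
  using assms unfolding sews_def by blast

lemma sewsE:
  assumes "sews T \<mu> \<Xi> y"
  obtains M where "0 \<le> M" "\<And>s t. 0 \<le> s \<Longrightarrow> s \<le> t \<Longrightarrow> t \<le> T \<Longrightarrow>
    norm (y t - y s - \<Xi> s t) \<le> M * (t - s) powr \<mu>"
proof -
  obtain M where M: "\<And>s t. 0 \<le> s \<Longrightarrow> s \<le> t \<Longrightarrow> t \<le> T \<Longrightarrow>
      norm (y t - y s - \<Xi> s t) \<le> M * (t - s) powr \<mu>"
    using assms unfolding sews_def by blast
  have "norm (y t - y s - \<Xi> s t) \<le> \<bar>M\<bar> * (t - s) powr \<mu>" if "0 \<le> s" "s \<le> t" "t \<le> T" for s t
    by (rule order_trans[OF M[OF that]]) (simp add: mult_right_mono)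
  then show ?thesis using that[of "\<bar>M\<bar>"] by simp
qed

lemma sews_cong:
  assumes "sews T \<mu> \<Xi> y"
    and "\<And>s t. 0 \<le> s \<Longrightarrow> s \<le> t \<Longrightarrow> t \<le> T \<Longrightarrow> \<Xi>' s t = \<Xi> s t"
    and "\<And>t. 0 \<le> t \<Longrightarrow> t \<le> T \<Longrightarrow> y' t = y t"
  shows "sews T \<mu> \<Xi>' y'"
  using assms(1) unfolding sews_def
  by (smt (verit) assms(2,3))

lemma sews_add:
  assumes "sews T \<mu> \<Xi> y" "sews T \<mu> \<Xi>' y'"
  shows "sews T \<mu> (\<lambda>s t. \<Xi> s t + \<Xi>' s t) (\<lambda>t. y t + y' t)"
proof -
  obtain M where M: "\<And>s t. 0 \<le> s \<Longrightarrow> s \<le> t \<Longrightarrow> t \<le> T \<Longrightarrow> norm (y t - y s - \<Xi> s t) \<le> M * (t - s) powr \<mu>"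
    using assms(1) by (rule sewsE) blast
  obtain M' where M': "\<And>s t. 0 \<le> s \<Longrightarrow> s \<le> t \<Longrightarrow> t \<le> T \<Longrightarrow> norm (y' t - y' s - \<Xi>' s t) \<le> M' * (t - s) powr \<mu>"
    using assms(2) by (rule sewsE) blast
  show ?thesis
  proof (rule sewsI)
    fix s t :: real assume a: "0 \<le> s" "s \<le> t" "t \<le> T"
    have "norm (y t + y' t - (y s + y' s) - (\<Xi> s t + \<Xi>' s t))
        = norm ((y t - y s - \<Xi> s t) + (y' t - y' s - \<Xi>' s t))" by (simp add: algebra_simps)
    also have "\<dots> \<le> M * (t - s) powr \<mu> + M' * (t - s) powr \<mu>"
      using M[OF a] M'[OF a] by (rule norm_triangle_mono)
    finally show "norm (y t + y' t - (y s + y' s) - (\<Xi> s t + \<Xi>' s t)) \<le> (M + M') * (t - s) powr \<mu>"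
      by (simp add: algebra_simps)
  qed
qed

lemma sews_scaleR:
  assumes "sews T \<mu> \<Xi> y"
  shows "sews T \<mu> (\<lambda>s t. c *\<^sub>R \<Xi> s t) (\<lambda>t. c *\<^sub>R y t)"
proof -
  obtain M where M: "\<And>s t. 0 \<le> s \<Longrightarrow> s \<le> t \<Longrightarrow> t \<le> T \<Longrightarrow> norm (y t - y s - \<Xi> s t) \<le> M * (t - s) powr \<mu>"
    using assms(1) by (rule sewsE) blast
  show ?thesis
  proof (rule sewsI)
    fix s t :: real assume a: "0 \<le> s" "s \<le> t" "t \<le> T"
    have "norm (c *\<^sub>R y t - c *\<^sub>R y s - c *\<^sub>R \<Xi> s t) = \<bar>c\<bar> * norm (y t - y s - \<Xi> s t)"
      by (simp flip: scaleR_diff_right)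
    also have "\<dots> \<le> \<bar>c\<bar> * M * (t - s) powr \<mu>" using mult_left_mono[OF M[OF a], of "\<bar>c\<bar>"] by simp
    finally show "norm (c *\<^sub>R y t - c *\<^sub>R y s - c *\<^sub>R \<Xi> s t) \<le> \<bar>c\<bar> * M * (t - s) powr \<mu>" .
  qed
qed

lemma sews_diff:
  assumes "sews T \<mu> \<Xi> y" "sews T \<mu> \<Xi>' y'"
  shows "sews T \<mu> (\<lambda>s t. \<Xi> s t - \<Xi>' s t) (\<lambda>t. y t - y' t)"
  using sews_add[OF assms(1) sews_scaleR[OF assms(2), of "-1"]] by simp

lemma sews_has_sewing:
  assumes "sews T \<mu> \<Xi> y" "1 < \<mu>" "t \<le> T"
  shows "has_sewing \<Xi> 0 t (y t - y 0)"
  unfolding has_sewing_def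
proof (intro allI impI)
  fix e :: real assume e: "0 < e"
  obtain M where M0: "0 \<le> M" and M: "\<And>s t. 0 \<le> s \<Longrightarrow> s \<le> t \<Longrightarrow> t \<le> T \<Longrightarrow>
      norm (y t - y s - \<Xi> s t) \<le> M * (t - s) powr \<mu>"
    using assms(1) by (rule sewsE) blast
  \<comment> \<open>The total error is at most \<open>M * d powr (\<mu> - 1) * t\<close>, and
    \<open>d\<close> solves \<open>d powr (\<mu> - 1) = r\<close>. The summand 1 avoids division by
    zero; the absolute value is there because the sign of \<open>t\<close> is known only once a
    partition is given.\<close>
  define r where "r = e / (M * \<bar>t\<bar> + 1)"
  define d where "d = r powr (1 / (\<mu> - 1))"
  have M1: "0 < M * \<bar>t\<bar> + 1" using M0 by (simp add: add_nonneg_pos)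
  have r: "0 < r" using e M1 by (simp add: r_def)
  have d: "0 < d" "d powr (\<mu> - 1) = r" using r assms(2) by (auto simp: d_def powr_powr)
  show "\<exists>\<delta>>0. \<forall>n p. p 0 = 0 \<and> p n = t \<and> (\<forall>i<n. p i < p (Suc i)) \<and> (\<forall>i<n. p (Suc i) - p i < \<delta>) \<longrightarrow>
      norm ((\<Sum>i<n. \<Xi> (p i) (p (Suc i))) - (y t - y 0)) < e"
  proof (intro exI[of _ d] conjI allI impI)
    fix n and p :: "nat \<Rightarrow> real"
    assume "p 0 = 0 \<and> p n = t \<and> (\<forall>i<n. p i < p (Suc i)) \<and> (\<forall>i<n. p (Suc i) - p i < d)"
    then have p: "p 0 = 0" "p n = t" "\<And>i. i < n \<Longrightarrow> p i < p (Suc i)" "\<And>i. i < n \<Longrightarrow> p (Suc i) - p i < d"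
      by auto
    have pm: "p i \<le> p j" if "i \<le> j" "j \<le> n" for i j
      using that
    proof (induction j rule: dec_induct)
      case (step k) then show ?case using p(3)[of k] by simp
    qed simp
    have t0: "0 \<le> t" using pm[of 0 n] p by simp
    have tel: "y t - y 0 = (\<Sum>i<n. y (p (Suc i)) - y (p i))"
      using sum_lessThan_telescope[of "\<lambda>i. y (p i)" n] p by simp
    have "norm ((\<Sum>i<n. \<Xi> (p i) (p (Suc i))) - (y t - y 0))
        = norm (\<Sum>i<n. y (p (Suc i)) - y (p i) - \<Xi> (p i) (p (Suc i)))"
      unfolding tel by (simp add: sum_subtractf norm_minus_commute)
    also have "\<dots> \<le> (\<Sum>i<n. M * (p (Suc i) - p i) powr \<mu>)"
    proof (intro sum_norm_le M)
      fix i assume i: "i \<in> {..<n}"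
      show "0 \<le> p i" using pm[of 0 i] p i by simp
      show "p i \<le> p (Suc i)" using p(3)[of i] i by simp
      show "p (Suc i) \<le> T" using pm[of "Suc i" n] p i assms(3) by simp
    qed
    also have "\<dots> \<le> M * (d powr (\<mu> - 1) * (p n - p 0))"
      unfolding sum_distrib_left[symmetric]
      using p M0 assms(2) by (intro mult_left_mono sum_powr_le) (auto intro: less_imp_le)
    also have "\<dots> = r * (M * \<bar>t\<bar>)" using p d t0 by simp
    also have "\<dots> < r * (M * \<bar>t\<bar> + 1)" using r by simp
    also have "\<dots> = e" using M1 by (simp add: r_def)
    finally show "norm ((\<Sum>i<n. \<Xi> (p i) (p (Suc i))) - (y t - y 0)) < e" .
  qed (use d in auto)
qed

text \<open>Both limits are tested on one uniform partition finer than both thresholds. For negative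
  \<open>t\<close> there is no partition from 0 to \<open>t\<close> and \<open>has_sewing\<close> is
  vacuous, so the sign of \<open>t\<close> matters.\<close>

lemma has_sewing_unique:
  assumes "has_sewing \<Xi> 0 t I" "has_sewing \<Xi> 0 t I'" "0 \<le> t"
  shows "I = I'"
proof (rule ccontr)
  assume "I \<noteq> I'"
  define e where "e = norm (I - I') / 2"
  have e: "0 < e" using \<open>I \<noteq> I'\<close> by (simp add: e_def)
  obtain d1 where d1: "0 < d1" "\<And>n p. p 0 = 0 \<and> p n = t \<and> (\<forall>i<n. p i < p (Suc i)) \<and> (\<forall>i<n. p (Suc i) - p i < d1) \<Longrightarrow>
      norm ((\<Sum>i<n. \<Xi> (p i) (p (Suc i))) - I) < e"
    using assms(1) e unfolding has_sewing_def by blast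
  obtain d2 where d2: "0 < d2" "\<And>n p. p 0 = 0 \<and> p n = t \<and> (\<forall>i<n. p i < p (Suc i)) \<and> (\<forall>i<n. p (Suc i) - p i < d2) \<Longrightarrow>
      norm ((\<Sum>i<n. \<Xi> (p i) (p (Suc i))) - I') < e"
    using assms(2) e unfolding has_sewing_def by blast
  define d where "d = min d1 d2"
  have d: "0 < d" using d1 d2 by (simp add: d_def)
  have "\<exists>n p. p 0 = 0 \<and> p n = t \<and> (\<forall>i<n. p i < p (Suc i)) \<and> (\<forall>i<n. p (Suc i) - p i < d)"
  proof (cases "t = 0")
    case True then show ?thesis by (intro exI[of _ 0] exI[of _ "\<lambda>_. 0"]) auto
  next
    case False
    obtain n :: nat where n: "t / d < real n" using reals_Archimedean2 by blast
    have "0 < t / d" using False assms(3) d by simp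
    then have n0: "0 < real n" using n by linarith
    then have "t / real n < d" using n d by (simp add: field_simps)
    then show ?thesis using n0 False assms(3)
      by (intro exI[of _ n] exI[of _ "\<lambda>i. real i * (t / real n)"]) (auto simp: field_simps)
  qed
  then obtain n and p :: "nat \<Rightarrow> real" where p: "p 0 = 0 \<and> p n = t \<and> (\<forall>i<n. p i < p (Suc i))" "\<forall>i<n. p (Suc i) - p i < d" by blast
  have "norm ((\<Sum>i<n. \<Xi> (p i) (p (Suc i))) - I) < e" "norm ((\<Sum>i<n. \<Xi> (p i) (p (Suc i))) - I') < e"
    using p by (auto intro!: d1 d2 simp: d_def)
  then have "norm (I - I') < 2 * e"
    by (smt (verit) norm_minus_commute norm_triangle_ineq diff_add_cancel add_diff_eq)
  then show False by (simp add: e_def)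
qed

text \<open>Any path sewing the germ inherits the sewing estimate on \<open>[s,t]\<close> from the defect there,
  whatever constant it was originally known to sew with.\<close>

lemma sewing_bound:
  fixes \<Xi> :: "real \<Rightarrow> real \<Rightarrow> 'e::real_normed_vector"
  assumes "1 < \<mu>" "0 \<le> c" "s \<le> t"
    and diag: "\<And>r. s \<le> r \<Longrightarrow> r \<le> t \<Longrightarrow> \<Xi> r r = 0"
    and delta: "\<And>r u v. s \<le> r \<Longrightarrow> r \<le> u \<Longrightarrow> u \<le> v \<Longrightarrow> v \<le> t \<Longrightarrow>
      norm (\<Xi> r v - \<Xi> r u - \<Xi> u v) \<le> c * (v - r) powr \<mu>"
    and y: "\<And>r v. s \<le> r \<Longrightarrow> r \<le> v \<Longrightarrow> v \<le> t \<Longrightarrow> norm (y v - y r - \<Xi> r v) \<le> M * (v - r) powr \<mu>"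
  shows "norm (y t - y s - \<Xi> s t) \<le> sew_const \<mu> * c * (t - s) powr \<mu>"
proof -
  \<comment> \<open>Along the uniform partition into \<open>n\<close> steps the original constant
    \<open>M\<close> only multiplies a term that vanishes as \<open>n\<close> grows.\<close>
  have "norm (y t - y s - \<Xi> s t) \<le> sew_const \<mu> * c * (t - s) powr \<mu>
      + \<bar>M\<bar> * (((t - s) / real n) powr (\<mu> - 1) * (t - s))" if n: "0 < n" for n :: nat
  proof -
    define d where "d = (t - s) / real n"
    have d0: "0 \<le> d" using assms(3) by (simp add: d_def)
    \<comment> \<open>The minimum freezes the partition at \<open>t\<close> after \<open>n\<close>
      steps, since \<open>discrete_sewing\<close> wants a monotone sequence on all naturals.\<close>
    define p where "p = (\<lambda>k. s + real (min k n) * d)"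
    have nd: "real n * d = t - s" using n by (simp add: d_def)
    have p: "mono p" "p 0 = s" "p n = t"
      using d0 nd by (auto simp: p_def mono_def intro!: mult_right_mono)
    have pin: "p i \<in> {s..t}" for i
      using d0 nd mult_right_mono[of "real (min i n)" "real n" d] by (auto simp: p_def)
    have step: "p (Suc k) - p k \<le> d" "p k \<le> p (Suc k)" if "k < n" for k
      using that monoD[OF p(1), of k "Suc k"] by (auto simp: p_def algebra_simps)
    have 1: "norm ((\<Sum>k<n. \<Xi> (p k) (p (Suc k))) - \<Xi> s t) \<le> sew_const \<mu> * c * (t - s) powr \<mu>"
      using discrete_sewing[OF assms(1,2) p(1) pin diag delta, of 0 n] p
      by (simp add: atLeast0LessThan)
    have tel: "y t - y s = (\<Sum>i<n. y (p (Suc i)) - y (p i))"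
      using sum_lessThan_telescope[of "\<lambda>i. y (p i)" n] p by simp
    have "norm (y t - y s - (\<Sum>k<n. \<Xi> (p k) (p (Suc k)))) \<le> (\<Sum>i<n. \<bar>M\<bar> * (p (Suc i) - p i) powr \<mu>)"
      unfolding tel sum_subtractf[symmetric]
    proof (intro sum_norm_le)
      fix i assume "i \<in> {..<n}"
      have "norm (y (p (Suc i)) - y (p i) - \<Xi> (p i) (p (Suc i))) \<le> M * (p (Suc i) - p i) powr \<mu>"
        using pin[of i] pin[of "Suc i"] p(1) by (intro y) (auto simp: monoD)
      also have "\<dots> \<le> \<bar>M\<bar> * (p (Suc i) - p i) powr \<mu>" by (intro mult_right_mono) auto
      finally show "norm (y (p (Suc i)) - y (p i) - \<Xi> (p i) (p (Suc i))) \<le> \<bar>M\<bar> * (p (Suc i) - p i) powr \<mu>" .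
    qed
    also have "\<dots> \<le> \<bar>M\<bar> * (d powr (\<mu> - 1) * (p n - p 0))"
      unfolding sum_distrib_left[symmetric]
      using step assms(1) by (intro mult_left_mono sum_powr_le) auto
    finally have 2: "norm (y t - y s - (\<Sum>k<n. \<Xi> (p k) (p (Suc k)))) \<le> \<bar>M\<bar> * (d powr (\<mu> - 1) * (t - s))"
      using p by simp
    show ?thesis using norm_triangle_mono[OF 2 1] by (simp add: d_def algebra_simps)
  qed
  moreover have "(\<lambda>n. sew_const \<mu> * c * (t - s) powr \<mu>
      + \<bar>M\<bar> * (((t - s) / real n) powr (\<mu> - 1) * (t - s))) \<longlonglongrightarrow> sew_const \<mu> * c * (t - s) powr \<mu> + \<bar>M\<bar> * (0 powr (\<mu> - 1) * (t - s))"
    using assms(1,3)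
    by (intro tendsto_intros tendsto_powr' lim_const_over_n) auto
  ultimately show ?thesis
    by (intro LIMSEQ_le_const[where X = "\<lambda>n. sew_const \<mu> * c * (t - s) powr \<mu>
      + \<bar>M\<bar> * (((t - s) / real n) powr (\<mu> - 1) * (t - s))"]) (auto intro!: exI[of _ 1])
qed

text \<open>Riemann sums over the dyadic grids of \<open>[0,T]\<close> form a Cauchy sequence. One
  grid serves every subinterval by clipping its points to \<open>[s,t]\<close>, which makes the sums
  additive in the interval up to an error vanishing with the mesh; the estimate on
  \<open>[s,t]\<close> then passes to the limit.\<close>

lemma sewing_exists:
  fixes \<Xi> :: "real \<Rightarrow> real \<Rightarrow> 'e::banach"
  assumes \<mu>: "1 < \<mu>" and c: "0 \<le> c" and T: "0 < T"
    and diag: "\<And>r. 0 \<le> r \<Longrightarrow> r \<le> T \<Longrightarrow> \<Xi> r r = 0"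
    and delta: "\<And>r u v. 0 \<le> r \<Longrightarrow> r \<le> u \<Longrightarrow> u \<le> v \<Longrightarrow> v \<le> T \<Longrightarrow>
      norm (\<Xi> r v - \<Xi> r u - \<Xi> u v) \<le> c * (v - r) powr \<mu>"
  shows "\<exists>I. I 0 = 0 \<and> sews T \<mu> \<Xi> I"
proof -
  define h where "h n = T / 2 ^ n" for n :: nat
  \<comment> \<open>The \<open>k\<close>-th dyadic point of level \<open>n\<close>, clipped to
    \<open>[s,t]\<close>; clipped intervals degenerate to points, where the germ is zero.\<close>
  define q where "q n s t k = max s (min (real k * h n) t)" for n :: nat and s t k
  define S where "S n s t = (\<Sum>k<2^n. \<Xi> (q n s t k) (q n s t (Suc k)))" for n s t
  let ?K = "sew_const \<mu> * c"
  have K: "0 \<le> ?K" using sew_const_pos[OF \<mu>] c by simp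
  have h0: "0 < h n" for n using T by (simp add: h_def)
  have qm: "mono (q n s t)" for n s t
    unfolding q_def mono_def using h0[of n]
    by (intro allI impI max.mono min.mono order_refl mult_right_mono) (auto intro: less_imp_le)
  have qend: "q n s t 0 = s" "q n s t (2^n) = t" if "0 \<le> s" "s \<le> t" "t \<le> T" for n s t
    using that by (auto simp: q_def h_def)
  have qin: "q n s t k \<in> {s..t}" if "s \<le> t" for n s t k
    using that by (auto simp: q_def)
  have qinT: "q n s t k \<in> {0..T}" if "0 \<le> s" "s \<le> t" "t \<le> T" for n s t k
    using qin[OF that(2), of n k] that by simp
  have qstep: "q n s t k \<le> q n s t (Suc k)" for n s t k
    using monoD[OF qm, of k "Suc k"] by simp
  have qlen: "q n s t (Suc k) - q n s t k \<le> h n" for n s t k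
    using h0[of n] by (auto simp: q_def algebra_simps max_def min_def)
  have hlim: "(\<lambda>n. h n powr (\<mu> - 1) * C) \<longlonglongrightarrow> 0" for C
  proof -
    have "(\<lambda>n. T * (1/2) ^ n) \<longlonglongrightarrow> T * 0" by (intro tendsto_intros LIMSEQ_power_zero) auto
    then have "h \<longlonglongrightarrow> 0" by (simp add: h_def[abs_def] power_divide field_simps)
    then have "(\<lambda>n. h n powr (\<mu> - 1) * C) \<longlonglongrightarrow> 0 powr (\<mu> - 1) * C"
      using \<mu> h0 by (intro tendsto_intros tendsto_powr') (auto intro!: always_eventually less_imp_le)
    then show ?thesis by simp
  qed
  have near: "norm (S n s t - \<Xi> s t) \<le> ?K * (t - s) powr \<mu>" if st: "0 \<le> s" "s \<le> t" "t \<le> T" for n s t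
  proof -
    have "norm ((\<Sum>k=0..<2^n. \<Xi> (q n s t k) (q n s t (Suc k))) - \<Xi> (q n s t 0) (q n s t (2^n)))
      \<le> ?K * (q n s t (2^n) - q n s t 0) powr \<mu>"
      by (rule discrete_sewing[OF \<mu> c qm qinT[OF st] diag delta]) auto
    then show ?thesis by (simp add: S_def qend[OF st] atLeast0LessThan)
  qed
  \<comment> \<open>Each coarse interval is the union of \<open>2 ^ m\<close> fine ones, so
    \<open>discrete_sewing\<close> applies interval by interval.\<close>
  have refine: "norm (S (n + m) 0 t - S n 0 t) \<le> h n powr (\<mu> - 1) * (?K * t)" if t: "0 \<le> t" "t \<le> T" for n m t
  proof -
    have hm: "h n = 2 ^ m * h (n + m)" by (simp add: h_def power_add)
    have qq: "q n 0 t k = q (n + m) 0 t (k * 2 ^ m)" for k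
      by (simp add: q_def hm)
    have "S (n + m) 0 t = (\<Sum>k<2^n. \<Sum>j=k * 2^m..<Suc k * 2^m. \<Xi> (q (n+m) 0 t j) (q (n+m) 0 t (Suc j)))"
      using sum.nat_group[of "\<lambda>j. \<Xi> (q (n+m) 0 t j) (q (n+m) 0 t (Suc j))" "2^m" "2^n"]
      by (simp add: S_def power_add add.commute mult.commute[of "2^m" "2^n"])
    then have "norm (S (n + m) 0 t - S n 0 t) = norm (\<Sum>k<2^n. (\<Sum>j=k * 2^m..<Suc k * 2^m. \<Xi> (q (n+m) 0 t j) (q (n+m) 0 t (Suc j)))
        - \<Xi> (q (n+m) 0 t (k * 2^m)) (q (n+m) 0 t (Suc k * 2^m)))"
      by (simp only: S_def[of n] sum_subtractf qq)
    also have "\<dots> \<le> (\<Sum>k<2^n. ?K * (q n 0 t (Suc k) - q n 0 t k) powr \<mu>)"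
    proof (rule sum_norm_le)
      fix k :: nat
      show "norm ((\<Sum>j=k * 2^m..<Suc k * 2^m. \<Xi> (q (n+m) 0 t j) (q (n+m) 0 t (Suc j)))
        - \<Xi> (q (n+m) 0 t (k * 2^m)) (q (n+m) 0 t (Suc k * 2^m))) \<le> ?K * (q n 0 t (Suc k) - q n 0 t k) powr \<mu>"
        unfolding qq by (rule discrete_sewing[OF \<mu> c qm qinT[OF order_refl t] diag delta]) auto
    qed
    also have "\<dots> \<le> ?K * (h n powr (\<mu> - 1) * (q n 0 t (2^n) - q n 0 t 0))"
      unfolding sum_distrib_left[symmetric] using K \<mu> qstep qlen
      by (intro mult_left_mono sum_powr_le) auto
    finally show ?thesis using qend[of 0 t n] t by (simp add: algebra_simps)
  qed
  define I where "I t = lim (\<lambda>n. S n 0 t)" for t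
  have lim: "(\<lambda>n. S n 0 t) \<longlonglongrightarrow> I t" if t: "0 \<le> t" "t \<le> T" for t
  proof -
    have "Cauchy (\<lambda>n. S n 0 t)"
    proof (rule CauchyI')
      fix e :: real assume "0 < e"
      then have "eventually (\<lambda>n. h n powr (\<mu> - 1) * (?K * t) < e) sequentially"
        using hlim[of "?K * t"] by (simp add: order_tendsto_iff)
      then obtain N where N: "\<And>n. N \<le> n \<Longrightarrow> h n powr (\<mu> - 1) * (?K * t) < e"
        by (auto simp: eventually_sequentially)
      show "\<exists>M. \<forall>m\<ge>M. \<forall>n>m. dist (S m 0 t) (S n 0 t) < e"
      proof (intro exI[of _ N] allI impI)
        fix m n assume "N \<le> m" "m < n"
        then show "dist (S m 0 t) (S n 0 t) < e"
          using refine[OF t, of m "n - m"] N[of m] by (simp add: dist_norm norm_minus_commute)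
      qed
    qed
    then show ?thesis unfolding I_def by (simp add: Cauchy_convergent_iff convergent_LIMSEQ_iff)
  qed
  \<comment> \<open>Cutting at \<open>s\<close> changes only grid intervals having \<open>s\<close>
    in their interior, by one defect; all others contribute zero. Summing the defect bound over the
    whole grid is crude but still vanishes with the mesh.\<close>
  have split: "norm (S n 0 t - S n 0 s - S n s t) \<le> h n powr (\<mu> - 1) * (c * t)"
    if st: "0 \<le> s" "s \<le> t" "t \<le> T" for n s t
  proof -
    have "norm (S n 0 t - S n 0 s - S n s t) \<le> (\<Sum>k<2^n. c * (q n 0 t (Suc k) - q n 0 t k) powr \<mu>)"
      unfolding S_def sum_subtractf[symmetric]
    proof (rule sum_norm_le)
      fix k :: nat
      define a where "a = q n 0 t k"
      define a' where "a' = q n 0 t (Suc k)"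
      have a: "0 \<le> a" "a \<le> a'" "a' \<le> t"
        using qin[of 0 t n k] qin[of 0 t n "Suc k"] qstep[of n 0 t k] st by (auto simp: a_def a'_def)
      have e: "q n 0 s k = min a s" "q n 0 s (Suc k) = min a' s" "q n s t k = max a s" "q n s t (Suc k) = max a' s"
        using st h0[of n] by (auto simp: a_def a'_def q_def min_def max_def)
      have "norm (\<Xi> a a' - \<Xi> (min a s) (min a' s) - \<Xi> (max a s) (max a' s)) \<le> c * (a' - a) powr \<mu>"
      proof -
        consider "s \<le> a" | "a' \<le> s" | "a \<le> s" "s \<le> a'" by linarith
        then show ?thesis
        proof cases
          case 1 then show ?thesis using a st diag[of s] c by (simp add: min_def max_def)
        next
          case 2 then show ?thesis using a st diag[of s] c by (simp add: min_def max_def)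
        next
          case 3 then show ?thesis using delta[of a s a'] a st by (simp add: min_absorb2 min_absorb1 max_absorb1 max_absorb2 max.absorb2 min.absorb1)
        qed
      qed
      then show "norm (\<Xi> (q n 0 t k) (q n 0 t (Suc k)) - \<Xi> (q n 0 s k) (q n 0 s (Suc k)) - \<Xi> (q n s t k) (q n s t (Suc k)))
        \<le> c * (q n 0 t (Suc k) - q n 0 t k) powr \<mu>"
        unfolding e a_def[symmetric] a'_def[symmetric] .
    qed
    also have "\<dots> \<le> c * (h n powr (\<mu> - 1) * (q n 0 t (2^n) - q n 0 t 0))"
      unfolding sum_distrib_left[symmetric] using c \<mu> qstep qlen
      by (intro mult_left_mono sum_powr_le) auto
    finally show ?thesis using qend[of 0 t n] st by (simp add: algebra_simps)
  qed
  have "norm (I t - I s - \<Xi> s t) \<le> ?K * (t - s) powr \<mu>" if st: "0 \<le> s" "s \<le> t" "t \<le> T" for s t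
  proof -
    have "norm (S n 0 t - S n 0 s - \<Xi> s t) \<le> ?K * (t - s) powr \<mu> + h n powr (\<mu> - 1) * (c * t)" for n
      using norm_triangle_mono[OF split[OF st, of n] near[OF st, of n]] by (simp add: algebra_simps)
    moreover have "(\<lambda>n. norm (S n 0 t - S n 0 s - \<Xi> s t)) \<longlonglongrightarrow> norm (I t - I s - \<Xi> s t)"
      using st by (intro tendsto_intros lim) auto
    moreover have "(\<lambda>n. ?K * (t - s) powr \<mu> + h n powr (\<mu> - 1) * (c * t)) \<longlonglongrightarrow> ?K * (t - s) powr \<mu> + 0"
      by (intro tendsto_intros hlim)
    ultimately show ?thesis
      by (intro LIMSEQ_le[where X = "\<lambda>n. norm (S n 0 t - S n 0 s - \<Xi> s t)"]) auto
  qed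
  then have "sews T \<mu> \<Xi> I" by (rule sewsI)
  moreover have "I 0 = 0"
  proof -
    have "S n 0 0 = 0" for n using diag[of 0] T h0[of n] by (simp add: S_def q_def)
    then show ?thesis using lim[of 0] T LIMSEQ_unique[OF _ tendsto_const] by fastforce
  qed
  ultimately show ?thesis by blast
qed

text \<open>Convergence of Riemann sums speaks only of intervals starting at 0 and gives no rate.
  The path built by \<open>sewing_exists\<close> has the rate on every \<open>[s,t]\<close>, and
  uniqueness of the limit identifies it with \<open>y - x\<close>.\<close>

lemma has_sewing_sews:
  fixes \<Xi> :: "real \<Rightarrow> real \<Rightarrow> 'e::banach"
  assumes \<mu>: "1 < \<mu>" and c: "0 \<le> c" and T: "0 < T"
    and diag: "\<And>r. 0 \<le> r \<Longrightarrow> r \<le> T \<Longrightarrow> \<Xi> r r = 0"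
    and delta: "\<And>r u v. 0 \<le> r \<Longrightarrow> r \<le> u \<Longrightarrow> u \<le> v \<Longrightarrow> v \<le> T \<Longrightarrow>
      norm (\<Xi> r v - \<Xi> r u - \<Xi> u v) \<le> c * (v - r) powr \<mu>"
    and y: "\<And>t. 0 \<le> t \<Longrightarrow> t \<le> T \<Longrightarrow> has_sewing \<Xi> 0 t (y t - x)"
  shows "sews T \<mu> \<Xi> y \<and> y 0 = x"
proof -
  obtain I where I: "I 0 = 0" "sews T \<mu> \<Xi> I"
    using sewing_exists[OF \<mu> c T diag delta] by blast
  have e: "y t = x + I t" if "0 \<le> t" "t \<le> T" for t
    using has_sewing_unique[OF sews_has_sewing[OF I(2) \<mu> that(2)] y[OF that]] that I(1)
    by (simp add: algebra_simps)
  obtain M where M: "\<And>s t. 0 \<le> s \<Longrightarrow> s \<le> t \<Longrightarrow> t \<le> T \<Longrightarrow> norm (I t - I s - \<Xi> s t) \<le> M * (t - s) powr \<mu>"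
    using I(2) by (rule sewsE) blast
  have "sews T \<mu> \<Xi> y"
  proof (rule sewsI)
    fix s t :: real assume a: "0 \<le> s" "s \<le> t" "t \<le> T"
    then show "norm (y t - y s - \<Xi> s t) \<le> M * (t - s) powr \<mu>"
      using M[OF a] e[of s] e[of t] by simp
  qed
  then show ?thesis using e[of 0] I T by simp
qed

section \<open>Young equations\<close>

lemma blinfun_compose_assoc: "(A o\<^sub>L B) o\<^sub>L C = A o\<^sub>L (B o\<^sub>L C)"
  by (rule blinfun_eqI) simp

lemma blinfun_compose_id [simp]: "id_blinfun o\<^sub>L A = A" "A o\<^sub>L id_blinfun = A"
  by (rule blinfun_eqI; simp)+

lemma blinv_eq:
  assumes "K o\<^sub>L J = id_blinfun" "J o\<^sub>L K = id_blinfun" shows "blinv J = K"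
  unfolding blinv_def
proof (rule the_equality)
  fix K' assume "K' o\<^sub>L J = id_blinfun \<and> J o\<^sub>L K' = id_blinfun"
  then have "K' = K' o\<^sub>L (J o\<^sub>L K)" "(K' o\<^sub>L J) o\<^sub>L K = K" using assms by auto
  then show "K' = K" by (simp add: blinfun_compose_assoc)
qed (use assms in auto)

lemma hsup_le: "(\<And>x. x \<in> S \<Longrightarrow> x \<le> B) \<Longrightarrow> 0 \<le> B \<Longrightarrow> hsup S \<le> B"
  unfolding hsup_def by (intro cSup_least) auto

text \<open>\<open>b\<close> is a working exponent for the spatial Hoelder regularity, chosen below
  \<beta> only in the final theorem. From \<open>b < 1\<close> follows \<mu> <= 2\<alpha>, so a
  product of two \<alpha>-Hoelder increments is already a sewable error.\<close>

locale young =
  fixes T \<alpha> b \<mu> :: real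
  assumes T: "0 < T" and \<alpha>: "0 < \<alpha>" "\<alpha> < 1" and b: "0 < b" "b < 1"
    and \<mu>_def: "\<mu> = \<alpha> + \<alpha> * b" and \<mu>: "1 < \<mu>"
begin

lemma \<mu>_bounds: "\<alpha> < \<mu>" "\<mu> \<le> 2 * \<alpha>"
  using \<alpha> b mult_left_mono[of b 1 \<alpha>] by (auto simp: \<mu>_def)

section \<open>Hoelder seminorms on \<open>[0,T]\<close> and uniqueness of sewn paths\<close>

definition hol :: "real \<Rightarrow> (real \<Rightarrow> 'e::real_normed_vector) \<Rightarrow> bool" where
  "hol N y \<longleftrightarrow> (\<forall>s t. 0 \<le> s \<longrightarrow> s \<le> t \<longrightarrow> t \<le> T \<longrightarrow> norm (y t - y s) \<le> N * (t - s) powr \<alpha>)"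

lemma holI:
  "(\<And>s t. 0 \<le> s \<Longrightarrow> s \<le> t \<Longrightarrow> t \<le> T \<Longrightarrow> norm (y t - y s) \<le> N * (t - s) powr \<alpha>) \<Longrightarrow> hol N y"
  by (simp add: hol_def)

lemma holD:
  "hol N y \<Longrightarrow> 0 \<le> s \<Longrightarrow> s \<le> t \<Longrightarrow> t \<le> T \<Longrightarrow> norm (y t - y s) \<le> N * (t - s) powr \<alpha>"
  by (simp add: hol_def)

lemma hol_nonneg:
  assumes "hol N y" shows "0 \<le> N"
proof -
  have "0 \<le> N * T powr \<alpha>" using order_trans[OF norm_ge_zero holD[OF assms, of 0 T]] T by simp
  then show ?thesis using T by (simp add: zero_le_mult_iff)
qed

lemma hol_mono: "hol N y \<Longrightarrow> N \<le> N' \<Longrightarrow> hol N' y"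
  unfolding hol_def by (meson mult_right_mono order_trans powr_ge_zero)

lemma hol_const: "hol 0 (\<lambda>_. x)"
  by (simp add: hol_def)

lemma hol_add:
  assumes "hol N y" "hol N' z" shows "hol (N + N') (\<lambda>t. y t + z t)"
proof (rule holI)
  fix s t assume a: "0 \<le> s" "s \<le> t" "t \<le> T"
  have "norm (y t + z t - (y s + z s)) = norm ((y t - y s) + (z t - z s))" by (simp add: algebra_simps)
  also have "\<dots> \<le> N * (t - s) powr \<alpha> + N' * (t - s) powr \<alpha>"
    by (rule norm_triangle_mono[OF holD[OF assms(1) a] holD[OF assms(2) a]])
  finally show "norm (y t + z t - (y s + z s)) \<le> (N + N') * (t - s) powr \<alpha>" by (simp add: algebra_simps)
qed

lemma hol_scaleR:
  assumes "hol N y" shows "hol (\<bar>c\<bar> * N) (\<lambda>t. c *\<^sub>R y t)"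
proof (rule holI)
  fix s t assume a: "0 \<le> s" "s \<le> t" "t \<le> T"
  show "norm (c *\<^sub>R y t - c *\<^sub>R y s) \<le> \<bar>c\<bar> * N * (t - s) powr \<alpha>"
    using mult_left_mono[OF holD[OF assms a], of "\<bar>c\<bar>"] by (simp flip: scaleR_diff_right)
qed

lemma hol_diff:
  assumes "hol N y" "hol N' z" shows "hol (N + N') (\<lambda>t. y t - z t)"
  using hol_add[OF assms(1) hol_scaleR[OF assms(2), of "-1"]] by simp

lemma hol_cong:
  assumes "hol N y" "\<And>t. 0 \<le> t \<Longrightarrow> t \<le> T \<Longrightarrow> z t = y t" shows "hol N z"
  using assms by (auto simp: hol_def)

lemma hol_bounded:
  assumes "hol N y" "0 \<le> t" "t \<le> T" shows "norm (y t) \<le> norm (y 0) + N * T powr \<alpha>"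
proof -
  have "norm (y t - y 0) \<le> N * t powr \<alpha>" using holD[OF assms(1), of 0 t] assms by simp
  also have "\<dots> \<le> N * T powr \<alpha>" using hol_nonneg[OF assms(1)] assms \<alpha> by (intro mult_left_mono powr_mono2) auto
  finally show ?thesis using norm_triangle_ineq2[of "y t" "y 0"] by linarith
qed

lemma powr_le_T:
  assumes "0 \<le> r" "r \<le> T" "p \<le> q" shows "r powr q \<le> T powr (q - p) * r powr p"
proof -
  have "r powr q = r powr (q - p) * r powr p" by (simp add: powr_add[symmetric])
  also have "\<dots> \<le> T powr (q - p) * r powr p" using assms by (intro mult_right_mono powr_mono2) auto
  finally show ?thesis .
qed

lemma sews_hol:
  assumes "sews T \<mu> \<Xi> y" "\<And>s t. 0 \<le> s \<Longrightarrow> s \<le> t \<Longrightarrow> t \<le> T \<Longrightarrow> norm (\<Xi> s t) \<le> m * (t - s) powr \<alpha>"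
  shows "\<exists>N. hol N y"
proof -
  obtain M where M: "0 \<le> M" "\<And>s t. 0 \<le> s \<Longrightarrow> s \<le> t \<Longrightarrow> t \<le> T \<Longrightarrow> norm (y t - y s - \<Xi> s t) \<le> M * (t - s) powr \<mu>"
    using assms(1) by (rule sewsE) blast
  have "hol (m + M * T powr (\<mu> - \<alpha>)) y"
  proof (rule holI)
    fix s t assume a: "0 \<le> s" "s \<le> t" "t \<le> T"
    have "norm (y t - y s) \<le> m * (t - s) powr \<alpha> + M * (t - s) powr \<mu>"
      using norm_triangle_sub[of "y t - y s" "\<Xi> s t"] M(2)[OF a] assms(2)[OF a] by linarith
    also have "M * (t - s) powr \<mu> \<le> M * (T powr (\<mu> - \<alpha>) * (t - s) powr \<alpha>)"
      using M(1) a \<mu>_bounds by (intro mult_left_mono powr_le_T) auto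
    finally show "norm (y t - y s) \<le> (m + M * T powr (\<mu> - \<alpha>)) * (t - s) powr \<alpha>"
      by (simp add: algebra_simps)
  qed
  then show ?thesis by blast
qed

lemma sews_unique:
  assumes "sews T \<mu> \<Xi> y" "sews T \<mu> \<Xi> z" "y 0 = z 0" "0 \<le> t" "t \<le> T"
  shows "y t = z t"
  using has_sewing_unique[OF sews_has_sewing[OF assms(1) \<mu> assms(5)] sews_has_sewing[OF assms(2) \<mu> assms(5)]] assms(3,4)
  by simp

text \<open>\<open>dominated a \<eta> \<Gamma> Z\<close> is what the germs of all equations below satisfy: for \<open>\<eta> = 0\<close> it holds
  when \<open>Z\<close> is a difference of two paths and \<open>\<Gamma>\<close> the difference of their germs, while \<open>\<eta>\<close> measures a
  perturbation of the equation.\<close>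

definition dominated :: "real \<Rightarrow> real \<Rightarrow> (real \<Rightarrow> real \<Rightarrow> 'e::real_normed_vector) \<Rightarrow> (real \<Rightarrow> 'f::real_normed_vector) \<Rightarrow> bool" where
  "dominated a \<eta> \<Gamma> Z \<longleftrightarrow>
    (\<forall>s t. 0 \<le> s \<longrightarrow> s \<le> t \<longrightarrow> t \<le> T \<longrightarrow> norm (\<Gamma> s t) \<le> (a * norm (Z s) + \<eta>) * (t - s) powr \<alpha>) \<and>
    (\<forall>s u t. 0 \<le> s \<longrightarrow> s \<le> u \<longrightarrow> u \<le> t \<longrightarrow> t \<le> T \<longrightarrow> norm (\<Gamma> s t - \<Gamma> s u - \<Gamma> u t)
       \<le> a * (t - s) powr \<alpha> * norm (Z u - Z s) + (a * norm (Z s) + \<eta>) * (t - s) powr \<mu>)"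

lemma dominatedI:
  assumes "\<And>s t. 0 \<le> s \<Longrightarrow> s \<le> t \<Longrightarrow> t \<le> T \<Longrightarrow> norm (\<Gamma> s t) \<le> (a * norm (Z s) + \<eta>) * (t - s) powr \<alpha>"
    and "\<And>s u t. 0 \<le> s \<Longrightarrow> s \<le> u \<Longrightarrow> u \<le> t \<Longrightarrow> t \<le> T \<Longrightarrow> norm (\<Gamma> s t - \<Gamma> s u - \<Gamma> u t)
       \<le> a * (t - s) powr \<alpha> * norm (Z u - Z s) + (a * norm (Z s) + \<eta>) * (t - s) powr \<mu>"
  shows "dominated a \<eta> \<Gamma> Z"
  using assms by (simp add: dominated_def)

lemma dominatedD:
  assumes "dominated a \<eta> \<Gamma> Z"
  shows "0 \<le> s \<Longrightarrow> s \<le> t \<Longrightarrow> t \<le> T \<Longrightarrow> norm (\<Gamma> s t) \<le> (a * norm (Z s) + \<eta>) * (t - s) powr \<alpha>"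
    and "0 \<le> s \<Longrightarrow> s \<le> u \<Longrightarrow> u \<le> t \<Longrightarrow> t \<le> T \<Longrightarrow> norm (\<Gamma> s t - \<Gamma> s u - \<Gamma> u t)
       \<le> a * (t - s) powr \<alpha> * norm (Z u - Z s) + (a * norm (Z s) + \<eta>) * (t - s) powr \<mu>"
  using assms by (simp_all add: dominated_def)

lemma dominated_diag: "dominated a \<eta> \<Gamma> Z \<Longrightarrow> 0 \<le> s \<Longrightarrow> s \<le> T \<Longrightarrow> \<Gamma> s s = 0"
  using dominatedD(1)[of a \<eta> \<Gamma> Z s s] by simp

lemma dominated_add:
  assumes "dominated a \<eta> \<Gamma> Z" "dominated a' \<eta>' \<Gamma>' Z"
  shows "dominated (a + a') (\<eta> + \<eta>') (\<lambda>s t. \<Gamma> s t + \<Gamma>' s t) Z"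
proof (rule dominatedI)
  fix s t assume st: "0 \<le> s" "s \<le> t" "t \<le> T"
  show "norm (\<Gamma> s t + \<Gamma>' s t) \<le> ((a + a') * norm (Z s) + (\<eta> + \<eta>')) * (t - s) powr \<alpha>"
    using norm_triangle_mono[OF dominatedD(1)[OF assms(1) st] dominatedD(1)[OF assms(2) st]]
    by (simp add: algebra_simps)
next
  fix s u t assume st: "0 \<le> s" "s \<le> u" "u \<le> t" "t \<le> T"
  have "\<Gamma> s t + \<Gamma>' s t - (\<Gamma> s u + \<Gamma>' s u) - (\<Gamma> u t + \<Gamma>' u t)
     = (\<Gamma> s t - \<Gamma> s u - \<Gamma> u t) + (\<Gamma>' s t - \<Gamma>' s u - \<Gamma>' u t)" by simp
  then show "norm (\<Gamma> s t + \<Gamma>' s t - (\<Gamma> s u + \<Gamma>' s u) - (\<Gamma> u t + \<Gamma>' u t))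
    \<le> (a + a') * (t - s) powr \<alpha> * norm (Z u - Z s) + ((a + a') * norm (Z s) + (\<eta> + \<eta>')) * (t - s) powr \<mu>"
    using norm_triangle_mono[OF dominatedD(2)[OF assms(1) st] dominatedD(2)[OF assms(2) st]]
    by (simp add: algebra_simps)
qed

text \<open>Once \<open>Z\<close> is known to be Hoelder, its increment in the defect yields (t - s)
  to the power 2\<alpha>, hence \<mu>, and everything that depends on \<open>Z\<close> is absorbed
  into one number. The form \<open>dominated 0 c\<close> over the zero path is the plain notion of a
  sewable germ with constant \<open>c\<close>.\<close>

lemma dominated_germ_const:
  assumes dom: "dominated a \<eta> \<Gamma> Z" and hol: "hol N Z" and a: "0 \<le> a" and \<eta>: "0 \<le> \<eta>"
  shows "dominated 0 (a * N * T powr (2 * \<alpha> - \<mu>) + (a * (norm (Z 0) + N * T powr \<alpha>) + \<eta>)) \<Gamma> (\<lambda>_. 0::real)"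
proof -
  have N: "0 \<le> N" by (rule hol_nonneg[OF hol])
  define d where "d = a * (norm (Z 0) + N * T powr \<alpha>) + \<eta>"
  define c where "c = a * N * T powr (2 * \<alpha> - \<mu>) + d"
  have d: "0 \<le> d" "d \<le> c" using N a \<eta> by (simp_all add: c_def d_def)
  have Zd: "a * norm (Z s) + \<eta> \<le> d" if "0 \<le> s" "s \<le> T" for s
    unfolding d_def using hol_bounded[OF hol that] a by (intro add_right_mono mult_left_mono)
  have "dominated 0 c \<Gamma> (\<lambda>_. 0::real)"
  proof (rule dominatedI)
    fix s t assume st: "0 \<le> s" "s \<le> t" "t \<le> T"
    have "norm (\<Gamma> s t) \<le> (a * norm (Z s) + \<eta>) * (t - s) powr \<alpha>" by (rule dominatedD(1)[OF dom st])
    also have "\<dots> \<le> c * (t - s) powr \<alpha>" using Zd[of s] d st by (intro mult_right_mono) auto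
    finally show "norm (\<Gamma> s t) \<le> (0 * norm (0::real) + c) * (t - s) powr \<alpha>" by simp
  next
    fix s u t assume st: "0 \<le> s" "s \<le> u" "u \<le> t" "t \<le> T"
    have "norm (Z u - Z s) \<le> N * (u - s) powr \<alpha>" using st by (intro holD[OF hol]) auto
    also have "\<dots> \<le> N * (t - s) powr \<alpha>" using st N \<alpha> by (intro mult_left_mono powr_mono2) auto
    finally have "a * (t - s) powr \<alpha> * norm (Z u - Z s) \<le> a * (t - s) powr \<alpha> * (N * (t - s) powr \<alpha>)"
      using a by (intro mult_left_mono) auto
    also have "\<dots> = a * N * (t - s) powr (2 * \<alpha>)" by (simp add: powr_add[symmetric])
    also have "\<dots> \<le> a * N * (T powr (2 * \<alpha> - \<mu>) * (t - s) powr \<mu>)"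
      using N a st \<mu>_bounds by (intro mult_left_mono powr_le_T) auto
    finally have 1: "a * (t - s) powr \<alpha> * norm (Z u - Z s) \<le> a * N * T powr (2 * \<alpha> - \<mu>) * (t - s) powr \<mu>" by simp
    have "(a * norm (Z s) + \<eta>) * (t - s) powr \<mu> \<le> d * (t - s) powr \<mu>"
      using Zd[of s] st by (intro mult_right_mono) auto
    then show "norm (\<Gamma> s t - \<Gamma> s u - \<Gamma> u t)
      \<le> 0 * (t - s) powr \<alpha> * norm (0 - 0 :: real) + (0 * norm (0::real) + c) * (t - s) powr \<mu>"
      using 1 dominatedD(2)[OF dom st] by (simp add: c_def algebra_simps)
  qed
  then show ?thesis by (simp only: c_def d_def)
qed

lemma dominated_germ:
  assumes "dominated a \<eta> \<Gamma> Z" "hol N Z" "0 \<le> a" "0 \<le> \<eta>"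
  obtains c where "0 \<le> c" "dominated 0 c \<Gamma> (\<lambda>_. 0::real)"
  using dominated_germ_const[OF assms] assms hol_nonneg[OF assms(2)] by (intro that) auto

lemma dominated_sewing:
  fixes \<Gamma> :: "real \<Rightarrow> real \<Rightarrow> 'e::banach"
  assumes "dominated a \<eta> \<Gamma> Z" "hol N Z" "0 \<le> a" "0 \<le> \<eta>"
  shows "\<exists>I. I 0 = 0 \<and> sews T \<mu> \<Gamma> I"
proof -
  obtain c where c: "0 \<le> c" "dominated 0 c \<Gamma> (\<lambda>_. 0::real)" by (rule dominated_germ[OF assms])
  show ?thesis
    using dominatedD(2)[OF c(2)] by (intro sewing_exists[OF \<mu> c(1) T dominated_diag[OF c(2)]]) auto
qed

lemma has_sewing_dominated:
  fixes \<Gamma> :: "real \<Rightarrow> real \<Rightarrow> 'e::banach"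
  assumes "dominated a \<eta> \<Gamma> Z" "hol N Z" "0 \<le> a" "0 \<le> \<eta>"
    and y: "\<And>t. 0 \<le> t \<Longrightarrow> t \<le> T \<Longrightarrow> has_sewing \<Gamma> 0 t (y t - x)"
  shows "sews T \<mu> \<Gamma> y" "y 0 = x"
proof -
  obtain c where c: "0 \<le> c" "dominated 0 c \<Gamma> (\<lambda>_. 0::real)" by (rule dominated_germ[OF assms(1-4)])
  have "sews T \<mu> \<Gamma> y \<and> y 0 = x"
    using dominatedD(2)[OF c(2)] by (intro has_sewing_sews[OF \<mu> c(1) T dominated_diag[OF c(2)]] y) auto
  then show "sews T \<mu> \<Gamma> y" "y 0 = x" by auto
qed

text \<open>The exponential weight makes the estimates on short steps \<open>t - s \<le> h\<close> global in time.\<close>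

definition weighted :: "real \<Rightarrow> real \<Rightarrow> real \<Rightarrow> (real \<Rightarrow> 'e::real_normed_vector) \<Rightarrow> bool" where
  "weighted a h Q Z \<longleftrightarrow>
    (\<forall>t. 0 \<le> t \<longrightarrow> t \<le> T \<longrightarrow> 8 * a * norm (Z t) \<le> Q * exp (t / h)) \<and>
    (\<forall>s t. 0 \<le> s \<longrightarrow> s \<le> t \<longrightarrow> t \<le> T \<longrightarrow> t - s \<le> h \<longrightarrow> norm (Z t - Z s) \<le> Q * exp (t / h) * (t - s) powr \<alpha>)"

lemma weightedD:
  assumes "weighted a h Q Z"
  shows "0 \<le> t \<Longrightarrow> t \<le> T \<Longrightarrow> 8 * a * norm (Z t) \<le> Q * exp (t / h)"
    and "0 \<le> s \<Longrightarrow> s \<le> t \<Longrightarrow> t \<le> T \<Longrightarrow> t - s \<le> h \<Longrightarrow> norm (Z t - Z s) \<le> Q * exp (t / h) * (t - s) powr \<alpha>"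
  using assms by (simp_all add: weighted_def)

lemma weighted_add:
  assumes "weighted a h Q Z" "weighted a h Q' Z'" "0 \<le> a"
  shows "weighted a h (Q + Q') (\<lambda>t. Z t + Z' t)"
  unfolding weighted_def
proof (intro conjI allI impI)
  fix t assume t: "0 \<le> t" "t \<le> T"
  have "8 * a * norm (Z t + Z' t) \<le> 8 * a * norm (Z t) + 8 * a * norm (Z' t)"
    using mult_left_mono[OF norm_triangle_ineq, of "8 * a" "Z t" "Z' t"] assms(3) by (simp add: algebra_simps)
  then show "8 * a * norm (Z t + Z' t) \<le> (Q + Q') * exp (t / h)"
    using weightedD(1)[OF assms(1) t] weightedD(1)[OF assms(2) t] by (simp add: algebra_simps)
next
  fix s t assume t: "0 \<le> s" "s \<le> t" "t \<le> T" "t - s \<le> h"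
  have "Z t + Z' t - (Z s + Z' s) = (Z t - Z s) + (Z' t - Z' s)" by simp
  then show "norm (Z t + Z' t - (Z s + Z' s)) \<le> (Q + Q') * exp (t / h) * (t - s) powr \<alpha>"
    using norm_triangle_mono[OF weightedD(2)[OF assms(1) t] weightedD(2)[OF assms(2) t]]
    by (simp add: algebra_simps)
qed

lemma weighted_limit:
  assumes "\<And>n. weighted a h (q n) (Z n)" "q \<longlonglongrightarrow> Q" "\<And>t. 0 \<le> t \<Longrightarrow> t \<le> T \<Longrightarrow> (\<lambda>n. Z n t) \<longlonglongrightarrow> z t"
  shows "weighted a h Q z"
  unfolding weighted_def
proof (intro conjI allI impI)
  fix t assume t: "0 \<le> t" "t \<le> T"
  show "8 * a * norm (z t) \<le> Q * exp (t / h)"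
  proof (rule LIMSEQ_le)
    show "(\<lambda>n. 8 * a * norm (Z n t)) \<longlonglongrightarrow> 8 * a * norm (z t)" by (intro tendsto_intros assms t)
    show "(\<lambda>n. q n * exp (t / h)) \<longlonglongrightarrow> Q * exp (t / h)" by (intro tendsto_intros assms)
  qed (use weightedD(1)[OF assms(1) t] in auto)
next
  fix s t assume t: "0 \<le> s" "s \<le> t" "t \<le> T" "t - s \<le> h"
  show "norm (z t - z s) \<le> Q * exp (t / h) * (t - s) powr \<alpha>"
  proof (rule LIMSEQ_le)
    show "(\<lambda>n. norm (Z n t - Z n s)) \<longlonglongrightarrow> norm (z t - z s)" using t by (intro tendsto_intros assms) auto
    show "(\<lambda>n. q n * exp (t / h) * (t - s) powr \<alpha>) \<longlonglongrightarrow> Q * exp (t / h) * (t - s) powr \<alpha>" by (intro tendsto_intros assms)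
  qed (use weightedD(2)[OF assms(1) t] in auto)
qed

section \<open>Contraction on short steps, stability and Picard iteration\<close>

definition step_ok :: "real \<Rightarrow> real \<Rightarrow> bool" where
  "step_ok a h \<longleftrightarrow> 0 < h \<and> sew_const \<mu> * h powr (\<mu> - \<alpha>) \<le> 1 \<and> sew_const \<mu> * a * h powr \<alpha> \<le> 1/8 \<and> 16 * a * h powr \<alpha> \<le> 1"

lemma ex_step_ok: "\<exists>h. step_ok a h"
proof -
  have small: "eventually (\<lambda>h. C * h powr p < e) (at_right 0)" if "0 < p" "0 < e" for C p e :: real
  proof -
    have "((\<lambda>h. C * h powr p) \<longlongrightarrow> C * 0 powr p) (at_right 0)"
      using that by (intro tendsto_intros tendsto_powr') (auto simp: eventually_at_filter)
    then show ?thesis using that by (auto simp: order_tendsto_iff)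
  qed
  have "eventually (\<lambda>h. 0 < h \<and> sew_const \<mu> * h powr (\<mu> - \<alpha>) < 1 \<and> sew_const \<mu> * a * h powr \<alpha> < 1/8 \<and> 16 * a * h powr \<alpha> < 1)
      (at_right 0)"
    using \<mu>_bounds \<alpha> by (intro eventually_conj small eventually_at_right_less) auto
  then have "eventually (\<lambda>h. step_ok a h) (at_right 0)"
    by (rule eventually_mono) (auto simp: step_ok_def)
  then show ?thesis using eventually_happens'[of "at_right (0::real)"] by simp
qed

text \<open>The factor 8 in \<open>weighted\<close> turns \<open>a * norm (Z s)\<close> into at most
  1/8 of \<open>Q\<close> times the weight. The germ therefore contributes \<open>Q / 8\<close>, and
  sewing it contributes \<open>Q / 8\<close> from the size of \<open>Z\<close> and, by the choice of
  \<open>h\<close>, another \<open>Q / 8\<close> from its increments: 3/8 in total, below the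
  claimed 1/2. \<open>Z\<close> and \<open>Z'\<close> are kept apart so that the estimate serves
  Picard iteration, where they are successive differences, as well as stability, where they
  coincide.\<close>

lemma one_step:
  fixes Z Z' :: "real \<Rightarrow> 'e::real_normed_vector"
  assumes a: "0 < a" and h: "step_ok a h" and Q: "0 \<le> Q" and \<eta>: "0 \<le> \<eta>"
    and Z: "weighted a h Q Z" and dom: "dominated a \<eta> \<Gamma> Z" and sew: "sews T \<mu> \<Gamma> Z'"
  shows "weighted a h (Q / 2 + (2 * \<eta> + 16 * a * norm (Z' 0))) Z'"
proof -
  let ?K = "sew_const \<mu>"
  have K: "0 < ?K" by (rule sew_const_pos[OF \<mu>])
  have h0: "0 < h" and hK: "?K * h powr (\<mu> - \<alpha>) \<le> 1" and hKa: "?K * a * h powr \<alpha> \<le> 1/8" and h16: "16 * a * h powr \<alpha> \<le> 1"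
    using h by (auto simp: step_ok_def)
  obtain M where M: "\<And>s t. 0 \<le> s \<Longrightarrow> s \<le> t \<Longrightarrow> t \<le> T \<Longrightarrow> norm (Z' t - Z' s - \<Gamma> s t) \<le> M * (t - s) powr \<mu>"
    using sew by (rule sewsE) blast
  define N where "N = 3/8 * Q + 2 * \<eta>"
  have N0: "0 \<le> N" using Q \<eta> by (simp add: N_def)
  have incr: "norm (Z' t - Z' s) \<le> N * exp (t / h) * (t - s) powr \<alpha>"
    if st: "0 \<le> s" "s \<le> t" "t \<le> T" "t - s \<le> h" for s t
  proof -
    define E where "E = exp (t / h)"
    have E: "1 \<le> E" using st h0 by (simp add: E_def)
    have EZ: "a * norm (Z r) + \<eta> \<le> Q * E / 8 + \<eta>" "exp (r / h) \<le> E" if "0 \<le> r" "r \<le> t" for r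
    proof -
      show e: "exp (r / h) \<le> E" using that h0 by (simp add: E_def divide_right_mono)
      have "8 * a * norm (Z r) \<le> Q * exp (r / h)" using that st by (intro weightedD(1)[OF Z]) auto
      also have "\<dots> \<le> Q * E" using Q e by (intro mult_left_mono)
      finally show "a * norm (Z r) + \<eta> \<le> Q * E / 8 + \<eta>" by simp
    qed
    \<comment> \<open>The defect constant on steps of length at most \<open>h\<close>. Multiplied by
      \<open>?K * h powr (\<mu> - \<alpha>)\<close>, its first summand becomes
      \<open>?K * a * h powr \<alpha> * (Q * E)\<close>, which \<open>step_ok\<close> bounds by
      \<open>Q * E / 8\<close>.\<close>
    define c where "c = a * Q * E * h powr (2 * \<alpha> - \<mu>) + (Q * E / 8 + \<eta>)"
    have c0: "0 \<le> c" using a Q E \<eta> by (simp add: c_def)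
    have d: "norm (\<Gamma> r v - \<Gamma> r u - \<Gamma> u v) \<le> c * (v - r) powr \<mu>"
      if r: "s \<le> r" "r \<le> u" "u \<le> v" "v \<le> t" for r u v
    proof -
      have "norm (Z u - Z r) \<le> Q * exp (u / h) * (u - r) powr \<alpha>"
        using r st by (intro weightedD(2)[OF Z]) auto
      also have "\<dots> \<le> Q * E * (v - r) powr \<alpha>"
        using r st Q E \<alpha> EZ(2)[of u] by (intro mult_mono powr_mono2) auto
      finally have "a * (v - r) powr \<alpha> * norm (Z u - Z r) \<le> a * (v - r) powr \<alpha> * (Q * E * (v - r) powr \<alpha>)"
        using a by (intro mult_left_mono) auto
      also have "\<dots> = a * Q * E * ((v - r) powr (2 * \<alpha> - \<mu>) * (v - r) powr \<mu>)"
        by (simp add: powr_add[symmetric])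
      also have "\<dots> \<le> a * Q * E * (h powr (2 * \<alpha> - \<mu>) * (v - r) powr \<mu>)"
        using a Q E r st \<mu>_bounds by (intro mult_left_mono mult_right_mono powr_mono2) auto
      finally have 1: "a * (v - r) powr \<alpha> * norm (Z u - Z r) \<le> a * Q * E * h powr (2 * \<alpha> - \<mu>) * (v - r) powr \<mu>" by simp
      have "(a * norm (Z r) + \<eta>) * (v - r) powr \<mu> \<le> (Q * E / 8 + \<eta>) * (v - r) powr \<mu>"
        using EZ(1)[of r] r st by (intro mult_right_mono) auto
      moreover have "norm (\<Gamma> r v - \<Gamma> r u - \<Gamma> u v) \<le> a * (v - r) powr \<alpha> * norm (Z u - Z r) + (a * norm (Z r) + \<eta>) * (v - r) powr \<mu>"
        using r st by (intro dominatedD(2)[OF dom]) auto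
      ultimately show ?thesis using 1 by (simp add: c_def algebra_simps)
    qed
    have "norm (Z' t - Z' s - \<Gamma> s t) \<le> ?K * c * (t - s) powr \<mu>"
      using st by (intro sewing_bound[OF \<mu> c0 _ _ d M] dominated_diag[OF dom]) auto
    also have "\<dots> = ?K * c * ((t - s) powr (\<mu> - \<alpha>) * (t - s) powr \<alpha>)" by (simp add: powr_add[symmetric])
    also have "\<dots> \<le> ?K * c * (h powr (\<mu> - \<alpha>) * (t - s) powr \<alpha>)"
      using K c0 st \<mu>_bounds by (intro mult_left_mono mult_right_mono powr_mono2) auto
    also have "\<dots> = (?K * h powr (\<mu> - \<alpha>) * c) * (t - s) powr \<alpha>" by simp
    also have "\<dots> \<le> (Q * E / 8 + (Q * E / 8 + \<eta>)) * (t - s) powr \<alpha>"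
    proof (intro mult_right_mono)
      have "?K * h powr (\<mu> - \<alpha>) * (a * Q * E * h powr (2 * \<alpha> - \<mu>)) = ?K * a * h powr \<alpha> * (Q * E)"
        using powr_add[of h "\<mu> - \<alpha>" "2 * \<alpha> - \<mu>"] by (simp add: algebra_simps)
      also have "\<dots> \<le> 1/8 * (Q * E)" using hKa Q E by (intro mult_right_mono) auto
      finally have "?K * h powr (\<mu> - \<alpha>) * (a * Q * E * h powr (2 * \<alpha> - \<mu>)) \<le> Q * E / 8" by simp
      moreover have "?K * h powr (\<mu> - \<alpha>) * (Q * E / 8 + \<eta>) \<le> 1 * (Q * E / 8 + \<eta>)"
        using hK Q E \<eta> by (intro mult_right_mono) auto
      ultimately show "?K * h powr (\<mu> - \<alpha>) * c \<le> Q * E / 8 + (Q * E / 8 + \<eta>)"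
        unfolding c_def by (simp add: algebra_simps)
    qed auto
    finally have 1: "norm (Z' t - Z' s - \<Gamma> s t) \<le> (Q * E / 8 + (Q * E / 8 + \<eta>)) * (t - s) powr \<alpha>" .
    have "norm (\<Gamma> s t) \<le> (a * norm (Z s) + \<eta>) * (t - s) powr \<alpha>" using st by (intro dominatedD(1)[OF dom])
    also have "\<dots> \<le> (Q * E / 8 + \<eta>) * (t - s) powr \<alpha>" using EZ(1)[of s] st by (intro mult_right_mono) auto
    finally have "norm (Z' t - Z' s) \<le> (3/8 * Q * E + 2 * \<eta>) * (t - s) powr \<alpha>"
      using 1 norm_triangle_sub[of "Z' t - Z' s" "\<Gamma> s t"] by (simp add: algebra_simps)
    also have "\<dots> \<le> N * E * (t - s) powr \<alpha>"
      using mult_left_mono[OF E, of "2 * \<eta>"] \<eta>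
      by (intro mult_right_mono) (auto simp: N_def algebra_simps)
    finally show ?thesis by (simp add: E_def)
  qed
  define R where "R = 2 * norm (Z' 0) + 2 * h powr \<alpha> * N"
  have R: "0 \<le> R" using N0 by (simp add: R_def)
  \<comment> \<open>Going back by one step \<open>h\<close> divides the weight by e > 2, so the
    bound at \<open>s\<close> is at most half of the bound at \<open>t\<close>; the other half pays
    for the increment. Hence the two factors 2 in \<open>R\<close>.\<close>
  have sup: "norm (Z' t) \<le> R * exp (t / h)" if "0 \<le> t" "t \<le> T" "t \<le> real n * h" for n t
    using that
  proof (induction n arbitrary: t)
    case 0
    then have "t = 0" by simp
    then show ?case using N0 by (simp add: R_def)
  next
    case (Suc n)
    define s where "s = max 0 (t - h)"
    have s: "0 \<le> s" "s \<le> t" "t - s \<le> h" using Suc.prems h0 by (auto simp: s_def)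
    have "norm (Z' t - Z' s) \<le> N * exp (t / h) * (t - s) powr \<alpha>" using s Suc.prems by (intro incr) auto
    also have "\<dots> \<le> N * exp (t / h) * h powr \<alpha>" using s N0 \<alpha> by (intro mult_left_mono powr_mono2) auto
    finally have 1: "norm (Z' t - Z' s) \<le> h powr \<alpha> * N * exp (t / h)" by (simp add: algebra_simps)
    have "norm (Z' s) \<le> (norm (Z' 0) + h powr \<alpha> * N) * exp (t / h)"
    proof (cases "t \<le> h")
      case True
      then have "s = 0" by (simp add: s_def)
      moreover have "norm (Z' 0) * 1 \<le> (norm (Z' 0) + h powr \<alpha> * N) * exp (t / h)"
        using N0 Suc.prems h0 by (intro mult_mono) auto
      ultimately show ?thesis by simp
    next
      case False
      then have s': "s = t - h" by (simp add: s_def)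
      have e: "exp (s / h) \<le> exp (t / h) / 2"
      proof -
        have "exp (s / h) = exp (t / h) / exp 1" using h0 unfolding s' by (simp add: diff_divide_distrib exp_diff)
        also have "\<dots> \<le> exp (t / h) / 2" using exp_ge_add_one_self[of 1] by (intro divide_left_mono) auto
        finally show ?thesis .
      qed
      have "norm (Z' s) \<le> R * exp (s / h)" using Suc.prems s s' by (intro Suc.IH) (auto simp: algebra_simps)
      also have "\<dots> \<le> R * (exp (t / h) / 2)" using R e by (intro mult_left_mono)
      finally show ?thesis by (simp add: R_def algebra_simps)
    qed
    moreover define A where "A = norm (Z' 0) * exp (t / h)"
    moreover define B where "B = h powr \<alpha> * N * exp (t / h)"
    ultimately have "norm (Z' s) \<le> A + B" "norm (Z' t - Z' s) \<le> B" "0 \<le> A" "R * exp (t / h) = 2 * A + 2 * B"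
      using 1 by (simp_all add: R_def algebra_simps)
    then show ?case using norm_triangle_sub[of "Z' t" "Z' s"] by linarith
  qed
  have NQ: "N \<le> Q / 2 + (2 * \<eta> + 16 * a * norm (Z' 0))" using Q a by (simp add: N_def)
  show ?thesis
    unfolding weighted_def
  proof (intro conjI allI impI)
    fix t assume t: "0 \<le> t" "t \<le> T"
    obtain n where "t / h < real n" using reals_Archimedean2 by blast
    then have "t \<le> real n * h" using h0 by (simp add: field_simps)
    then have "8 * a * norm (Z' t) \<le> 8 * a * (R * exp (t / h))" using sup[OF t] a by (intro mult_left_mono) auto
    also have "\<dots> = (16 * a * norm (Z' 0) + 16 * a * h powr \<alpha> * N) * exp (t / h)" by (simp add: R_def algebra_simps)
    also have "\<dots> \<le> (16 * a * norm (Z' 0) + 1 * N) * exp (t / h)"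
      using h16 N0 by (intro mult_right_mono add_left_mono) auto
    also have "\<dots> \<le> (Q / 2 + (2 * \<eta> + 16 * a * norm (Z' 0))) * exp (t / h)"
      using Q by (intro mult_right_mono) (auto simp: N_def)
    finally show "8 * a * norm (Z' t) \<le> (Q / 2 + (2 * \<eta> + 16 * a * norm (Z' 0))) * exp (t / h)" .
  next
    fix s t assume st: "0 \<le> s" "s \<le> t" "t \<le> T" "t - s \<le> h"
    show "norm (Z' t - Z' s) \<le> (Q / 2 + (2 * \<eta> + 16 * a * norm (Z' 0))) * exp (t / h) * (t - s) powr \<alpha>"
      by (rule order_trans[OF incr[OF st]]) (intro mult_right_mono NQ; simp)
  qed
qed

lemma hol_weighted:
  assumes "hol N Z" "0 < a" "0 < h"
  shows "\<exists>Q\<ge>0. weighted a h Q Z"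
proof -
  have N: "0 \<le> N" by (rule hol_nonneg[OF assms(1)])
  define Q where "Q = 8 * a * (norm (Z 0) + N * T powr \<alpha>) + N"
  have Q: "0 \<le> Q" "8 * a * (norm (Z 0) + N * T powr \<alpha>) \<le> Q" "N \<le> Q" using assms N by (auto simp: Q_def)
  have QE: "Q * 1 \<le> Q * exp (t / h)" if "0 \<le> t" for t using Q that assms by (intro mult_left_mono) auto
  have "weighted a h Q Z"
    unfolding weighted_def
  proof (intro conjI allI impI)
    fix t assume t: "0 \<le> t" "t \<le> T"
    have "8 * a * norm (Z t) \<le> 8 * a * (norm (Z 0) + N * T powr \<alpha>)"
      using hol_bounded[OF assms(1) t] assms by (intro mult_left_mono) auto
    then show "8 * a * norm (Z t) \<le> Q * exp (t / h)" using QE[OF t(1)] Q by linarith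
  next
    fix s t assume st: "0 \<le> s" "s \<le> t" "t \<le> T"
    have "norm (Z t - Z s) \<le> N * (t - s) powr \<alpha>" by (rule holD[OF assms(1) st])
    also have "\<dots> \<le> Q * exp (t / h) * (t - s) powr \<alpha>" using QE[of t] Q st by (intro mult_right_mono) auto
    finally show "norm (Z t - Z s) \<le> Q * exp (t / h) * (t - s) powr \<alpha>" .
  qed
  then show ?thesis using Q by blast
qed

text \<open>Increments over more than \<open>h\<close> are estimated by twice the supremum, at the
  price of dividing by \<open>h powr \<alpha>\<close>; this is the origin of
  \<open>1 / (4 * a * h powr \<alpha>)\<close>.\<close>

lemma weighted_bounds:
  assumes "weighted a h Q Z" "0 < a" "0 < h" "0 \<le> Q"
  shows "0 \<le> t \<Longrightarrow> t \<le> T \<Longrightarrow> norm (Z t) \<le> Q * (exp (T / h) / (8 * a))"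
    and "hol (Q * (exp (T / h) * (1 + 1 / (4 * a * h powr \<alpha>)))) Z"
proof -
  have E: "exp (t / h) \<le> exp (T / h)" if "t \<le> T" for t using that assms by (simp add: divide_right_mono)
  show B: "norm (Z t) \<le> Q * (exp (T / h) / (8 * a))" if t: "0 \<le> t" "t \<le> T" for t
  proof -
    have "8 * a * norm (Z t) \<le> Q * exp (t / h)" by (rule weightedD(1)[OF assms(1) t])
    also have "\<dots> \<le> Q * exp (T / h)" using E t assms by (intro mult_left_mono) auto
    finally show ?thesis using assms by (simp add: field_simps)
  qed
  show "hol (Q * (exp (T / h) * (1 + 1 / (4 * a * h powr \<alpha>)))) Z"
  proof (rule holI)
    fix s t assume st: "0 \<le> s" "s \<le> t" "t \<le> T"
    have ha: "0 < h powr \<alpha>" using assms by simp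
    show "norm (Z t - Z s) \<le> Q * (exp (T / h) * (1 + 1 / (4 * a * h powr \<alpha>))) * (t - s) powr \<alpha>"
    proof (cases "t - s \<le> h")
      case True
      have "norm (Z t - Z s) \<le> Q * exp (t / h) * (t - s) powr \<alpha>" by (rule weightedD(2)[OF assms(1) st True])
      also have "\<dots> \<le> Q * (exp (T / h) * (1 + 1 / (4 * a * h powr \<alpha>))) * (t - s) powr \<alpha>"
      proof (intro mult_right_mono mult_left_mono)
        have "exp (T / h) * 1 \<le> exp (T / h) * (1 + 1 / (4 * a * h powr \<alpha>))" using assms ha by (intro mult_left_mono) auto
        then show "exp (t / h) \<le> exp (T / h) * (1 + 1 / (4 * a * h powr \<alpha>))" using E[of t] st by linarith
      qed (use assms in auto)
      finally show ?thesis .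
    next
      case False
      have "norm (Z t - Z s) \<le> norm (Z t) + norm (Z s)" by (rule norm_triangle_ineq4)
      also have "\<dots> \<le> 2 * (Q * (exp (T / h) / (8 * a)))" using B[of s] B[of t] st by simp
      also have "\<dots> = Q * (exp (T / h) / (4 * a * h powr \<alpha>)) * h powr \<alpha>" using ha assms by simp
      also have "\<dots> \<le> Q * (exp (T / h) / (4 * a * h powr \<alpha>)) * (t - s) powr \<alpha>"
        using False assms \<alpha> by (intro mult_left_mono powr_mono2) auto
      also have "\<dots> \<le> Q * (exp (T / h) * (1 + 1 / (4 * a * h powr \<alpha>))) * (t - s) powr \<alpha>"
        using assms by (intro mult_right_mono mult_left_mono) (auto simp: algebra_simps)
      finally show ?thesis .
    qed
  qed
qed

text \<open>A solution is its own next iterate, so \<open>one_step\<close> with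
  \<open>Z' = Z\<close> improves any weighted bound \<open>q\<close> to \<open>q / 2 + c\<close>. In
  the limit the initial bound, known only to be finite, disappears and \<open>2 * c\<close> remains.
  \<open>C\<close> is fixed by \<open>a\<close> before \<open>Z\<close>, the germ and the
  perturbation are given.\<close>

lemma stability:
  assumes a: "0 < a"
  obtains C where "0 \<le> C"
    "\<And>(Z :: real \<Rightarrow> 'e::real_normed_vector) \<Gamma> \<eta> N. 0 \<le> \<eta> \<Longrightarrow> hol N Z \<Longrightarrow> dominated a \<eta> \<Gamma> Z \<Longrightarrow> sews T \<mu> \<Gamma> Z \<Longrightarrow>
      hol (C * (norm (Z 0) + \<eta>)) Z \<and> (\<forall>t. 0 \<le> t \<longrightarrow> t \<le> T \<longrightarrow> norm (Z t) \<le> C * (norm (Z 0) + \<eta>))"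
proof -
  obtain h where h: "step_ok a h" using ex_step_ok by blast
  then have h0: "0 < h" by (simp add: step_ok_def)
  define p where "p = exp (T / h) / (8 * a)"
  define r where "r = exp (T / h) * (1 + 1 / (4 * a * h powr \<alpha>))"
  have pr: "0 \<le> p" "0 \<le> r" using a by (auto simp: p_def r_def)
  define C where "C = (4 + 32 * a) * (p + r)"
  have C0: "0 \<le> C" using a pr by (simp add: C_def)
  show ?thesis
  proof (rule that[OF C0])
    fix Z :: "real \<Rightarrow> 'e" and \<Gamma> \<eta> N
    assume \<eta>: "0 \<le> \<eta>" and Z: "hol N Z" and dom: "dominated a \<eta> \<Gamma> Z" and sew: "sews T \<mu> \<Gamma> Z"
    obtain Q0 where Q0: "0 \<le> Q0" "weighted a h Q0 Z" using hol_weighted[OF Z a h0] by blast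
    define c where "c = 2 * \<eta> + 16 * a * norm (Z 0)"
    have c: "0 \<le> c" using \<eta> a by (simp add: c_def)
    \<comment> \<open>The explicit solution of \<open>q (Suc n) = q n / 2 + c\<close> started at
      \<open>Q0\<close>.\<close>
    define q where "q n = 2 * c + (Q0 - 2 * c) * (1/2) ^ n" for n :: nat
    have "0 \<le> q n \<and> weighted a h (q n) Z" for n
    proof (induction n)
      case 0 then show ?case using Q0 by (simp add: q_def)
    next
      case (Suc n)
      have e: "q (Suc n) = q n / 2 + c" by (simp add: q_def field_simps)
      then show ?case using Suc.IH c one_step[OF a h _ \<eta> _ dom sew, of "q n"] by (simp add: c_def)
    qed
    moreover have "q \<longlonglongrightarrow> 2 * c + (Q0 - 2 * c) * 0"
      unfolding q_def by (intro tendsto_intros LIMSEQ_power_zero) auto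
    ultimately have W: "weighted a h (2 * c) Z"
      by - (rule weighted_limit[where q = q and Z = "\<lambda>_. Z"], auto)
    define D where "D = norm (Z 0) + \<eta>"
    have D: "0 \<le> D" using \<eta> by (simp add: D_def)
    have "c * 2 \<le> (4 + 32 * a) * D" using a \<eta> by (simp add: c_def D_def algebra_simps)
    then have le: "2 * c * x \<le> (4 + 32 * a) * D * x" if "0 \<le> x" for x
      using that by (intro mult_right_mono) auto
    note wb = weighted_bounds[OF W a h0, folded p_def r_def]
    have CD: "C * D = (4 + 32 * a) * D * p + (4 + 32 * a) * D * r" by (simp add: C_def algebra_simps)
    have nonneg: "0 \<le> (4 + 32 * a) * D * p" "0 \<le> (4 + 32 * a) * D * r" using a D pr by auto
    have "2 * c * r \<le> C * D" using le[OF pr(2)] nonneg unfolding CD by linarith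
    then have 1: "hol (C * D) Z" using wb(2) c by (auto intro: hol_mono)
    have "2 * c * p \<le> C * D" using le[OF pr(1)] nonneg unfolding CD by linarith
    then have "norm (Z t) \<le> C * D" if "0 \<le> t" "t \<le> T" for t using wb(1)[OF _ that] c by auto
    then show "hol (C * (norm (Z 0) + \<eta>)) Z \<and> (\<forall>t. 0 \<le> t \<longrightarrow> t \<le> T \<longrightarrow> norm (Z t) \<le> C * (norm (Z 0) + \<eta>))"
      using 1 by (simp add: D_def)
  qed
qed

text \<open>The invariant class \<open>Cl\<close> is a parameter: all Hoelder paths from
  \<open>x\<close> for linear equations, a ball of them for nonlinear ones. In \<open>closed\<close>
  a pointwise limit suffices, because the weighted estimates supply some Hoelder bound of the
  limit.\<close>

lemma picard:
  fixes G :: "(real \<Rightarrow> 'e::banach) \<Rightarrow> real \<Rightarrow> real \<Rightarrow> 'e"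
  assumes a: "0 < a"
    and start: "Cl (\<lambda>_. x)"
    and Cl: "\<And>y. Cl y \<Longrightarrow> y 0 = x" "\<And>y. Cl y \<Longrightarrow> \<exists>N. hol N y"
    and step: "\<And>y. Cl y \<Longrightarrow> \<exists>y'. Cl y' \<and> sews T \<mu> (G y) y'"
    and closed: "\<And>Y y N. (\<And>n. Cl (Y n)) \<Longrightarrow> (\<And>t. 0 \<le> t \<Longrightarrow> t \<le> T \<Longrightarrow> (\<lambda>n. Y n t) \<longlonglongrightarrow> y t) \<Longrightarrow> hol N y \<Longrightarrow> Cl y"
    and dom: "\<And>y z. Cl y \<Longrightarrow> Cl z \<Longrightarrow> dominated a 0 (\<lambda>s t. G y s t - G z s t) (\<lambda>t. y t - z t)"
  shows "\<exists>y. Cl y \<and> sews T \<mu> (G y) y"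
proof -
  obtain h where h: "step_ok a h" using ex_step_ok by blast
  then have h0: "0 < h" by (simp add: step_ok_def)
  \<comment> \<open>A choice is necessary: the sewing relation determines the next iterate on
    \<open>[0,T]\<close> only.\<close>
  define F where "F y = (SOME y'. Cl y' \<and> sews T \<mu> (G y) y')" for y
  have F: "Cl (F y)" "sews T \<mu> (G y) (F y)" if "Cl y" for y
    using someI_ex[OF step[OF that]] by (auto simp: F_def)
  define Y where "Y n = (F ^^ n) (\<lambda>_. x)" for n
  have YS: "Y (Suc n) = F (Y n)" for n by (simp add: Y_def)
  have Y: "Cl (Y n)" for n by (induction n) (auto simp: Y_def start F)
  have contract: "weighted a h (Q / 2) (\<lambda>t. y' t - z' t)"
    if "weighted a h Q (\<lambda>t. y t - z t)" "0 \<le> Q" "Cl y" "Cl z" "Cl y'" "Cl z'" "sews T \<mu> (G y) y'" "sews T \<mu> (G z) z'" for Q y z y' z'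
    using one_step[OF a h that(2) order_refl that(1) dom[OF that(3,4)] sews_diff[OF that(7,8)]] Cl(1)[OF that(5)] Cl(1)[OF that(6)]
    by simp
  obtain Q0 where Q0: "0 \<le> Q0" "weighted a h Q0 (\<lambda>t. Y 1 t - Y 0 t)"
  proof -
    obtain N N' where "hol N (Y 1)" "hol N' (Y 0)" using Cl(2)[OF Y] by meson
    then show ?thesis using hol_weighted[OF hol_diff a h0] that by blast
  qed
  have diff: "weighted a h (Q0 * (1/2) ^ n) (\<lambda>t. Y (Suc n) t - Y n t)" for n
  proof (induction n)
    case 0 then show ?case using Q0 by simp
  next
    case (Suc n)
    then show ?case using contract[OF Suc.IH _ Y[of "Suc n"] Y[of n] Y[of "Suc (Suc n)"] Y[of "Suc n"]]
        F(2)[OF Y[of n]] F(2)[OF Y[of "Suc n"]] Q0(1) by (simp add: YS)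
  qed
  \<comment> \<open>The geometric sum is written as a difference of two tails, so that each
    induction step adds exactly one term.\<close>
  have far: "weighted a h (2 * Q0 * (1/2) ^ n - 2 * Q0 * (1/2) ^ (n + m)) (\<lambda>t. Y (n + m) t - Y n t)" for n m
  proof (induction m)
    case 0 then show ?case by (simp add: weighted_def)
  next
    case (Suc m)
    then show ?case using weighted_add[OF Suc.IH diff[of "n + m"]] a by (simp add: algebra_simps)
  qed
  define y where "y t = lim (\<lambda>n. Y n t)" for t
  have lim: "(\<lambda>n. Y n t) \<longlonglongrightarrow> y t" if t: "0 \<le> t" "t \<le> T" for t
  proof -
    define g where "g n = (Q0 * (exp (T / h) / (8 * a))) * (1/2) ^ n" for n :: nat
    have "norm (Y (Suc n) t - Y n t) \<le> g n" for n
      using weighted_bounds(1)[OF diff a h0 _ t] Q0(1) by (simp add: g_def algebra_simps)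
    moreover have "summable g"
      unfolding g_def by (intro summable_mult summable_geometric) simp
    ultimately have "summable (\<lambda>n. Y (Suc n) t - Y n t)"
      by - (rule summable_comparison_test'[of g 0], auto)
    then have "convergent (\<lambda>n. Y n t - Y 0 t)"
      using sum_lessThan_telescope[of "\<lambda>n. Y n t"] by (simp add: summable_iff_convergent)
    then show ?thesis
      unfolding y_def by (simp add: convergent_LIMSEQ_iff[symmetric] convergent_diff_const_right_iff)
  qed
  have near: "weighted a h (2 * Q0 * (1/2) ^ n) (\<lambda>t. y t - Y n t)" for n
  proof (rule weighted_limit[OF far])
    have "(\<lambda>m. 2 * Q0 * (1/2) ^ n - 2 * Q0 * ((1/2) ^ n * (1/2) ^ m)) \<longlonglongrightarrow> 2 * Q0 * (1/2) ^ n - 2 * Q0 * ((1/2) ^ n * 0)"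
      by (intro tendsto_intros LIMSEQ_power_zero) auto
    then show "(\<lambda>m. 2 * Q0 * (1/2) ^ n - 2 * Q0 * (1/2) ^ (n + m)) \<longlonglongrightarrow> 2 * Q0 * (1/2) ^ n"
      by (simp add: power_add)
    fix t assume t: "0 \<le> t" "t \<le> T"
    show "(\<lambda>m. Y (n + m) t - Y n t) \<longlonglongrightarrow> y t - Y n t"
      using LIMSEQ_ignore_initial_segment[OF lim[OF t], of n] by (intro tendsto_intros) (simp add: add.commute)
  qed
  have "\<exists>N. hol N y"
  proof -
    have "\<exists>N. hol N (\<lambda>t. y t - Y 0 t)" using weighted_bounds(2)[OF near[of 0] a h0] Q0 by auto
    moreover have "(\<lambda>t. y t - Y 0 t + x) = y" by (simp add: Y_def)
    ultimately show ?thesis using hol_add[OF _ hol_const[of x], of _ "\<lambda>t. y t - Y 0 t"] by auto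
  qed
  then have y: "Cl y" using closed[OF Y lim] by blast
  \<comment> \<open>By contraction the iterates \<open>Y (Suc n)\<close> converge to
    \<open>F y\<close> as well as to \<open>y\<close>.\<close>
  have "F y t = y t" if t: "0 \<le> t" "t \<le> T" for t
  proof -
    have "weighted a h (Q0 * (1/2) ^ n) (\<lambda>t. F y t - Y (Suc n) t)" for n
      using contract[OF near _ y Y F(1)[OF y] F(1)[OF Y] F(2)[OF y] F(2)[OF Y]] Q0(1) by (simp add: YS)
    then have "norm (F y t - Y (Suc n) t) \<le> Q0 * (1/2) ^ n * (exp (T / h) / (8 * a))" for n
      using Q0(1) by (intro weighted_bounds(1)[OF _ a h0 _ t]) auto
    moreover have "(\<lambda>n. Q0 * (1/2) ^ n * (exp (T / h) / (8 * a))) \<longlonglongrightarrow> Q0 * 0 * (exp (T / h) / (8 * a))"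
      by (intro tendsto_intros LIMSEQ_power_zero) auto
    ultimately have "(\<lambda>n. F y t - Y (Suc n) t) \<longlonglongrightarrow> 0"
      by (intro Lim_null_comparison[where f = "\<lambda>n. F y t - Y (Suc n) t"]) auto
    moreover have "(\<lambda>n. F y t - Y (Suc n) t) \<longlonglongrightarrow> F y t - y t"
      by (intro tendsto_intros LIMSEQ_Suc lim t)
    ultimately show ?thesis using LIMSEQ_unique by fastforce
  qed
  then have "sews T \<mu> (G y) y" by (intro sews_cong[OF F(2)[OF y]]) auto
  then show ?thesis using y by blast
qed


lemma dominated_mono:
  assumes "dominated a \<eta> \<Gamma> Z" "a \<le> a'" "\<eta> \<le> \<eta>'"
  shows "dominated a' \<eta>' \<Gamma> Z"
proof (rule dominatedI)
  fix s t assume st: "0 \<le> s" "s \<le> t" "t \<le> T"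
  show "norm (\<Gamma> s t) \<le> (a' * norm (Z s) + \<eta>') * (t - s) powr \<alpha>"
    using assms by (intro order_trans[OF dominatedD(1)[OF assms(1) st]] mult_right_mono add_mono) auto
next
  fix s u t assume st: "0 \<le> s" "s \<le> u" "u \<le> t" "t \<le> T"
  show "norm (\<Gamma> s t - \<Gamma> s u - \<Gamma> u t) \<le> a' * (t - s) powr \<alpha> * norm (Z u - Z s) + (a' * norm (Z s) + \<eta>') * (t - s) powr \<mu>"
    using assms by (intro order_trans[OF dominatedD(2)[OF assms(1) st]] mult_right_mono add_mono) auto
qed

text \<open>Stability with zero initial value and zero perturbation; every uniqueness statement
  below reduces to it. Passing to \<open>a + 1\<close> secures the strict positivity that
  \<open>stability\<close> demands.\<close>

lemma dominated_zero:
  assumes "dominated a 0 \<Gamma> Z" "0 \<le> a" "sews T \<mu> \<Gamma> Z" "hol N Z" "Z 0 = 0" "0 \<le> t" "t \<le> T"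
  shows "Z t = 0"
proof -
  obtain C where "\<And>(Z :: real \<Rightarrow> 'a) \<Gamma> \<eta> N. 0 \<le> \<eta> \<Longrightarrow> hol N Z \<Longrightarrow> dominated (a + 1) \<eta> \<Gamma> Z \<Longrightarrow> sews T \<mu> \<Gamma> Z \<Longrightarrow>
      hol (C * (norm (Z 0) + \<eta>)) Z \<and> (\<forall>t. 0 \<le> t \<longrightarrow> t \<le> T \<longrightarrow> norm (Z t) \<le> C * (norm (Z 0) + \<eta>))"
    by (rule stability[of "a + 1"]) (use assms(2) in \<open>auto\<close>)
  from this[OF order_refl assms(4) dominated_mono[OF assms(1)] assms(3)] assms(5-7)
  show ?thesis by fastforce
qed

subsection \<open>Linear equations\<close>

text \<open>A general bilinear product covers composition on the left and on the right, application
  of an operator germ to a path, and of an operator path to a vector germ. The constant is the same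
  for all \<open>J\<close>.\<close>

lemma dominated_prod:
  fixes prod :: "'a::real_normed_vector \<Rightarrow> 'b::real_normed_vector \<Rightarrow> 'c::real_normed_vector"
  assumes prod: "bounded_bilinear prod" and M: "dominated 0 m M (\<lambda>_. 0::real)" and m: "0 \<le> m"
  obtains a where "0 \<le> a" "\<And>J. dominated a 0 (\<lambda>s t. prod (M s t) (J s)) J"
proof -
  interpret bounded_bilinear prod by (rule prod)
  obtain K where K: "0 < K" "\<And>x y. norm (prod x y) \<le> norm x * norm y * K" using pos_bounded by blast
  have "dominated (K * m) 0 (\<lambda>s t. prod (M s t) (J s)) J" for J
  proof (rule dominatedI)
    fix s t assume st: "0 \<le> s" "s \<le> t" "t \<le> T"
    have "norm (prod (M s t) (J s)) \<le> norm (M s t) * norm (J s) * K" by (rule K(2))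
    also have "\<dots> \<le> (m * (t - s) powr \<alpha>) * norm (J s) * K"
      using dominatedD(1)[OF M st] K(1) by (intro mult_right_mono) auto
    finally show "norm (prod (M s t) (J s)) \<le> (K * m * norm (J s) + 0) * (t - s) powr \<alpha>" by (simp add: algebra_simps)
  next
    fix s u t assume st: "0 \<le> s" "s \<le> u" "u \<le> t" "t \<le> T"
    have e: "prod (M s t) (J s) - prod (M s u) (J s) - prod (M u t) (J u)
        = prod (M s t - M s u - M u t) (J s) - prod (M u t) (J u - J s)"
      by (simp add: diff_left diff_right)
    have "norm (M u t) \<le> m * (t - u) powr \<alpha>" using dominatedD(1)[OF M, of u t] st by auto
    also have "\<dots> \<le> m * (t - s) powr \<alpha>" using st \<alpha> m by (intro mult_left_mono powr_mono2) auto
    finally have Mut: "norm (M u t) \<le> m * (t - s) powr \<alpha>" .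
    have "norm (prod (M u t) (J u - J s)) \<le> norm (M u t) * norm (J u - J s) * K" by (rule K(2))
    also have "\<dots> \<le> (m * (t - s) powr \<alpha>) * norm (J u - J s) * K"
      using Mut K(1) by (intro mult_right_mono) auto
    finally have 1: "norm (prod (M u t) (J u - J s)) \<le> K * m * (t - s) powr \<alpha> * norm (J u - J s)" by (simp add: algebra_simps)
    have "norm (prod (M s t - M s u - M u t) (J s)) \<le> norm (M s t - M s u - M u t) * norm (J s) * K" by (rule K(2))
    also have "\<dots> \<le> (m * (t - s) powr \<mu>) * norm (J s) * K"
      using dominatedD(2)[OF M st] K(1) by (intro mult_right_mono) auto
    finally have 2: "norm (prod (M s t - M s u - M u t) (J s)) \<le> (K * m * norm (J s)) * (t - s) powr \<mu>" by (simp add: algebra_simps)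
    show "norm (prod (M s t) (J s) - prod (M s u) (J s) - prod (M u t) (J u))
      \<le> K * m * (t - s) powr \<alpha> * norm (J u - J s) + (K * m * norm (J s) + 0) * (t - s) powr \<mu>"
      unfolding e add_0_right using norm_triangle_ineq4[of "prod (M s t - M s u - M u t) (J s)" "prod (M u t) (J u - J s)"] 1 2
      by linarith
  qed
  then show ?thesis using K m by (intro that[of "K * m"]) auto
qed

text \<open>By linearity the difference of two germs is the germ of the difference, with a constant
  independent of the paths, so Picard iteration runs in the class of all Hoelder paths from
  \<open>x\<close>.\<close>

lemma linear_exists:
  fixes prod :: "'a::real_normed_vector \<Rightarrow> 'e::banach \<Rightarrow> 'e"
  assumes prod: "bounded_bilinear prod" and M: "dominated 0 m M (\<lambda>_. 0::real)" and m: "0 \<le> m"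
  shows "\<exists>J. J 0 = x \<and> (\<exists>N. hol N J) \<and> sews T \<mu> (\<lambda>s t. prod (M s t) (J s)) J"
proof -
  interpret bounded_bilinear prod by (rule prod)
  obtain a where a: "0 \<le> a" "\<And>J. dominated a 0 (\<lambda>s t. prod (M s t) (J s)) J"
    by (rule dominated_prod[OF assms], rule that)
  have a': "dominated (a + 1) 0 (\<lambda>s t. prod (M s t) (J s)) J" for J by (rule dominated_mono[OF a(2)]) auto
  have "\<exists>y. (y 0 = x \<and> (\<exists>N. hol N y)) \<and> sews T \<mu> (\<lambda>s t. prod (M s t) (y s)) y"
  proof (rule picard[where a = "a + 1" and Cl = "\<lambda>y. y 0 = x \<and> (\<exists>N. hol N y)" and G = "\<lambda>y s t. prod (M s t) (y s)" and x = x])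
    show "0 < a + 1" using a by simp
    show "x = x \<and> (\<exists>N. hol N (\<lambda>_. x))" using hol_const by auto
  next
    fix y assume y: "y 0 = x \<and> (\<exists>N. hol N y)"
    then obtain N where N: "hol N y" by blast
    obtain I where I: "I 0 = 0" "sews T \<mu> (\<lambda>s t. prod (M s t) (y s)) I"
      using dominated_sewing[OF a(2) N a(1) order_refl] by blast
    obtain c where c: "0 \<le> c" "dominated 0 c (\<lambda>s t. prod (M s t) (y s)) (\<lambda>_. 0::real)"
      by (rule dominated_germ[OF a(2) N a(1) order_refl])
    obtain N' where N': "hol N' I"
      using sews_hol[OF I(2), of c] dominatedD(1)[OF c(2)] by auto
    have "sews T \<mu> (\<lambda>s t. prod (M s t) (y s)) (\<lambda>t. x + I t)" using I(2) by (simp add: sews_def)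
    then show "\<exists>y'. (y' 0 = x \<and> (\<exists>N. hol N y')) \<and> sews T \<mu> (\<lambda>s t. prod (M s t) (y s)) y'"
      using I(1) hol_add[OF hol_const[of x] N'] by (intro exI[of _ "\<lambda>t. x + I t"]) auto
  next
    fix Y y N
    assume Y: "\<And>n. Y n 0 = x \<and> (\<exists>N. hol N (Y n))"
      and lim: "\<And>t. 0 \<le> t \<Longrightarrow> t \<le> T \<Longrightarrow> (\<lambda>n. Y n t) \<longlonglongrightarrow> y t" and y: "hol N y"
    have "y 0 = x" using LIMSEQ_unique[OF lim[of 0]] Y T by (simp add: LIMSEQ_const_iff)
    then show "y 0 = x \<and> (\<exists>N. hol N y)" using y by blast
  next
    fix y z
    show "dominated (a + 1) 0 (\<lambda>s t. prod (M s t) (y s) - prod (M s t) (z s)) (\<lambda>t. y t - z t)"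
      using a'[of "\<lambda>t. y t - z t"] by (simp add: diff_right)
  qed auto
  then show ?thesis by blast
qed

lemma hol_prod:
  fixes prod :: "'a::real_normed_vector \<Rightarrow> 'b::real_normed_vector \<Rightarrow> 'c::real_normed_vector"
  assumes prod: "bounded_bilinear prod" and "hol N y" "hol N' z"
  shows "\<exists>N. hol N (\<lambda>t. prod (y t) (z t))"
proof -
  interpret bounded_bilinear prod by (rule prod)
  obtain K where K: "0 < K" "\<And>x y. norm (prod x y) \<le> norm x * norm y * K" using pos_bounded by blast
  define B where "B = norm (y 0) + N * T powr \<alpha>"
  define B' where "B' = norm (z 0) + N' * T powr \<alpha>"
  have N: "0 \<le> N" "0 \<le> N'" using assms(2,3) by (auto intro: hol_nonneg)
  then have B0: "0 \<le> B" "0 \<le> B'" by (auto simp: B_def B'_def)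
  have "hol (N * B' * K + B * N' * K) (\<lambda>t. prod (y t) (z t))"
  proof (rule holI)
    fix s t assume st: "0 \<le> s" "s \<le> t" "t \<le> T"
    have e: "prod (y t) (z t) - prod (y s) (z s) = prod (y t - y s) (z t) + prod (y s) (z t - z s)"
      by (simp add: diff_left diff_right)
    have "norm (prod (y t - y s) (z t)) \<le> norm (y t - y s) * norm (z t) * K" by (rule K(2))
    also have "\<dots> \<le> (N * (t - s) powr \<alpha>) * B' * K"
      using holD[OF assms(2) st] hol_bounded[OF assms(3), of t] st N K(1) by (intro mult_right_mono mult_mono) (auto simp: B'_def)
    finally have 1: "norm (prod (y t - y s) (z t)) \<le> N * (t - s) powr \<alpha> * B' * K" .
    have "norm (prod (y s) (z t - z s)) \<le> norm (y s) * norm (z t - z s) * K" by (rule K(2))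
    also have "\<dots> \<le> B * (N' * (t - s) powr \<alpha>) * K"
      using holD[OF assms(3) st] hol_bounded[OF assms(2), of s] st N B0 K(1) by (intro mult_right_mono mult_mono) (auto simp: B_def)
    finally show "norm (prod (y t) (z t) - prod (y s) (z s)) \<le> (N * B' * K + B * N' * K) * (t - s) powr \<alpha>"
      unfolding e using norm_triangle_ineq[of "prod (y t - y s) (z t)" "prod (y s) (z t - z s)"] 1
      by (simp add: algebra_simps)
  qed
  then show ?thesis by blast
qed

text \<open>The Leibniz rule holds without a quadratic correction: the product of the two increments
  has order 2\<alpha> >= \<mu> and is part of the sewing error.\<close>

lemma sews_prod:
  fixes prod :: "'a::real_normed_vector \<Rightarrow> 'b::real_normed_vector \<Rightarrow> 'c::real_normed_vector"
  assumes prod: "bounded_bilinear prod" and y: "hol N y" and z: "hol N' z"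
    and "sews T \<mu> \<Xi> y" "sews T \<mu> \<Theta> z"
  shows "sews T \<mu> (\<lambda>s t. prod (\<Xi> s t) (z s) + prod (y s) (\<Theta> s t)) (\<lambda>t. prod (y t) (z t))"
proof -
  interpret bounded_bilinear prod by (rule prod)
  obtain K where K: "0 < K" "\<And>x y. norm (prod x y) \<le> norm x * norm y * K" using pos_bounded by blast
  obtain M where M: "0 \<le> M" "\<And>s t. 0 \<le> s \<Longrightarrow> s \<le> t \<Longrightarrow> t \<le> T \<Longrightarrow> norm (y t - y s - \<Xi> s t) \<le> M * (t - s) powr \<mu>"
    using assms(4) by (rule sewsE) blast
  obtain M' where M': "0 \<le> M'" "\<And>s t. 0 \<le> s \<Longrightarrow> s \<le> t \<Longrightarrow> t \<le> T \<Longrightarrow> norm (z t - z s - \<Theta> s t) \<le> M' * (t - s) powr \<mu>"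
    using assms(5) by (rule sewsE) blast
  define B where "B = norm (y 0) + N * T powr \<alpha>"
  define B' where "B' = norm (z 0) + N' * T powr \<alpha>"
  have N: "0 \<le> N" "0 \<le> N'" using y z by (auto intro: hol_nonneg)
  then have B0: "0 \<le> B" "0 \<le> B'" by (auto simp: B_def B'_def)
  show ?thesis
  proof (rule sewsI)
    fix s t assume st: "0 \<le> s" "s \<le> t" "t \<le> T"
    have e: "prod (y t) (z t) - prod (y s) (z s) - (prod (\<Xi> s t) (z s) + prod (y s) (\<Theta> s t))
      = prod (y t - y s - \<Xi> s t) (z s) + prod (y s) (z t - z s - \<Theta> s t) + prod (y t - y s) (z t - z s)"
      by (simp add: diff_left diff_right)
    have "norm (prod (y t - y s - \<Xi> s t) (z s)) \<le> norm (y t - y s - \<Xi> s t) * norm (z s) * K" by (rule K(2))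
    also have "\<dots> \<le> (M * (t - s) powr \<mu>) * B' * K"
      using M(2)[OF st] hol_bounded[OF z, of s] st M(1) K(1) by (intro mult_right_mono mult_mono) (auto simp: B'_def)
    finally have 1: "norm (prod (y t - y s - \<Xi> s t) (z s)) \<le> (M * B' * K) * (t - s) powr \<mu>" by (simp add: algebra_simps)
    have "norm (prod (y s) (z t - z s - \<Theta> s t)) \<le> norm (y s) * norm (z t - z s - \<Theta> s t) * K" by (rule K(2))
    also have "\<dots> \<le> B * (M' * (t - s) powr \<mu>) * K"
      using M'(2)[OF st] hol_bounded[OF y, of s] st B0 K(1) by (intro mult_right_mono mult_mono) (auto simp: B_def)
    finally have 2: "norm (prod (y s) (z t - z s - \<Theta> s t)) \<le> (B * M' * K) * (t - s) powr \<mu>" by (simp add: algebra_simps)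
    have "norm (prod (y t - y s) (z t - z s)) \<le> norm (y t - y s) * norm (z t - z s) * K" by (rule K(2))
    also have "\<dots> \<le> (N * (t - s) powr \<alpha>) * (N' * (t - s) powr \<alpha>) * K"
      using holD[OF y st] holD[OF z st] N K(1) by (intro mult_right_mono mult_mono) auto
    also have "\<dots> = N * N' * K * (t - s) powr (2 * \<alpha>)" by (simp add: powr_add[symmetric])
    also have "\<dots> \<le> N * N' * K * (T powr (2 * \<alpha> - \<mu>) * (t - s) powr \<mu>)"
      using N K(1) st \<mu>_bounds by (intro mult_left_mono powr_le_T) auto
    finally have 3: "norm (prod (y t - y s) (z t - z s)) \<le> (N * N' * K * T powr (2 * \<alpha> - \<mu>)) * (t - s) powr \<mu>" by simp
    show "norm (prod (y t) (z t) - prod (y s) (z s) - (prod (\<Xi> s t) (z s) + prod (y s) (\<Theta> s t)))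
      \<le> (M * B' * K + B * M' * K + N * N' * K * T powr (2 * \<alpha> - \<mu>)) * (t - s) powr \<mu>"
      unfolding e distrib_right
      by (intro norm_triangle_mono 1 2 3)
  qed
qed

text \<open>For \<open>K\<close> solving the adjoint equation the germ of
  \<open>K o\<^sub>L J\<close> cancels identically, so this product stays at the identity. In the
  opposite order nothing cancels; instead \<open>Z = (J o\<^sub>L K) - id_blinfun\<close> solves the
  linear equation with germ \<open>M Z - Z M\<close> and zero initial value.\<close>

lemma flow_inverse:
  fixes M :: "real \<Rightarrow> real \<Rightarrow> ('v::banach \<Rightarrow>\<^sub>L 'v)"
  assumes M: "dominated 0 m M (\<lambda>_. 0::real)" and m: "0 \<le> m"
    and J: "J 0 = id_blinfun" "hol N J" "sews T \<mu> (\<lambda>s t. M s t o\<^sub>L J s) J"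
  shows "\<exists>K N'. hol N' K \<and> K 0 = id_blinfun \<and> sews T \<mu> (\<lambda>s t. - (K s o\<^sub>L M s t)) K \<and>
    (\<forall>t. 0 \<le> t \<longrightarrow> t \<le> T \<longrightarrow> K t o\<^sub>L J t = id_blinfun \<and> J t o\<^sub>L K t = id_blinfun)"
proof -
  let ?c = "\<lambda>(x::'v \<Rightarrow>\<^sub>L 'v) (y::'v \<Rightarrow>\<^sub>L 'v). x o\<^sub>L y"
  let ?f = "\<lambda>(x::'v \<Rightarrow>\<^sub>L 'v) (y::'v \<Rightarrow>\<^sub>L 'v). y o\<^sub>L x"
  have bc: "bounded_bilinear ?c" and bf: "bounded_bilinear ?f"
    using bounded_bilinear_blinfun_compose bounded_bilinear.flip[OF bounded_bilinear_blinfun_compose] by auto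
  interpret c: bounded_bilinear ?c by (rule bc)
  interpret f: bounded_bilinear ?f by (rule bf)
  have M': "dominated 0 m (\<lambda>s t. - M s t) (\<lambda>_. 0::real)"
  proof (rule dominatedI)
    fix s u t assume st: "0 \<le> s" "s \<le> u" "u \<le> t" "t \<le> T"
    have "norm (- M s t - - M s u - - M u t) = norm (M s t - M s u - M u t)"
      by (metis (no_types, opaque_lifting) minus_diff_minus norm_minus_cancel)
    then show "norm (- M s t - - M s u - - M u t) \<le> 0 * (t - s) powr \<alpha> * norm (0 - 0 :: real) + (0 * norm (0::real) + m) * (t - s) powr \<mu>"
      using dominatedD(2)[OF M st] by simp
  qed (use dominatedD(1)[OF M] in auto)
  obtain K N' where K: "K 0 = id_blinfun" "hol N' K" "sews T \<mu> (\<lambda>s t. ?f (- M s t) (K s)) K"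
    using linear_exists[OF bf M' m] by blast
  have K': "sews T \<mu> (\<lambda>s t. - (K s o\<^sub>L M s t)) K" using K(3) by (simp add: c.minus_right)
  have sews_id: "sews T \<mu> (\<lambda>s t. 0) (\<lambda>t. id_blinfun :: 'v \<Rightarrow>\<^sub>L 'v)" by (rule sewsI[where M = 0]) simp
  have KJ: "K t o\<^sub>L J t = id_blinfun" if t: "0 \<le> t" "t \<le> T" for t
  proof -
    have "sews T \<mu> (\<lambda>s t. ((- (K s o\<^sub>L M s t)) o\<^sub>L J s) + (K s o\<^sub>L (M s t o\<^sub>L J s))) (\<lambda>t. K t o\<^sub>L J t)"
      using sews_prod[OF bc K(2) J(2) K' J(3)] by simp
    then have "sews T \<mu> (\<lambda>s t. 0) (\<lambda>t. K t o\<^sub>L J t)" by (simp add: c.minus_left blinfun_compose_assoc)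
    from sews_unique[OF this sews_id _ t] show ?thesis by (simp add: K(1) J(1))
  qed
  have JK: "J t o\<^sub>L K t = id_blinfun" if t: "0 \<le> t" "t \<le> T" for t
  proof -
    define Z where "Z t = (J t o\<^sub>L K t) - id_blinfun" for t
    obtain a where a: "0 \<le> a" "\<And>J. dominated a 0 (\<lambda>s t. ?c (M s t) (J s)) J" by (rule dominated_prod[OF bc M m], rule that)
    obtain a' where a': "0 \<le> a'" "\<And>J. dominated a' 0 (\<lambda>s t. ?f (- M s t) (J s)) J" by (rule dominated_prod[OF bf M' m], rule that)
    have dom: "dominated (a + a') (0 + 0) (\<lambda>s t. ?c (M s t) (Z s) + ?f (- M s t) (Z s)) Z"
      by (intro dominated_add a(2) a'(2))
    have sew: "sews T \<mu> (\<lambda>s t. ((M s t o\<^sub>L J s) o\<^sub>L K s) + (J s o\<^sub>L (- (K s o\<^sub>L M s t)))) (\<lambda>t. J t o\<^sub>L K t)"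
      using sews_prod[OF bc J(2) K(2) J(3) K'] by simp
    have sewZ: "sews T \<mu> (\<lambda>s t. ?c (M s t) (Z s) + ?f (- M s t) (Z s)) Z"
      by (rule sews_cong[OF sews_diff[OF sew sews_id]])
        (simp_all add: Z_def c.minus_right c.minus_left c.diff_left c.diff_right blinfun_compose_assoc)
    obtain N'' where "hol N'' (\<lambda>t. J t o\<^sub>L K t)" using hol_prod[OF bc J(2) K(2)] by blast
    then have holZ: "hol (N'' + 0) Z" unfolding Z_def by (intro hol_diff hol_const)
    have Z0: "Z 0 = 0" using J(1) K(1) by (simp add: Z_def)
    have "Z t = 0"
      by (rule dominated_zero[OF dom[unfolded add_0_left] _ sewZ holZ Z0 t]) (use a(1) a'(1) in simp)
    then show ?thesis by (simp add: Z_def)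
  qed
  show ?thesis using K K' KJ JK by blast
qed

subsection \<open>Nonlinear equations\<close>

definition increments :: "real \<Rightarrow> (real \<Rightarrow> 'v::real_normed_vector \<Rightarrow> 'w::real_normed_vector) \<Rightarrow> bool" where
  "increments m F \<longleftrightarrow> (\<forall>s t. 0 \<le> s \<longrightarrow> s \<le> t \<longrightarrow> t \<le> T \<longrightarrow>
    (\<forall>x. norm (F t x - F s x) \<le> m * (t - s) powr \<alpha>) \<and>
    (\<forall>x y. norm ((F t x - F s x) - (F t y - F s y)) \<le> m * (t - s) powr \<alpha> * norm (x - y) powr b))"

lemma incrementsD:
  assumes "increments m F" "0 \<le> s" "s \<le> t" "t \<le> T"
  shows "norm (F t x - F s x) \<le> m * (t - s) powr \<alpha>"
    and "norm ((F t x - F s x) - (F t y - F s y)) \<le> m * (t - s) powr \<alpha> * norm (x - y) powr b"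
  using assms by (auto simp: increments_def)

lemma increments_add:
  assumes "increments m F" "increments m' G"
  shows "increments (m + m') (\<lambda>t x. F t x + G t x)"
  unfolding increments_def
proof (intro allI impI conjI)
  fix s t x y assume st: "0 \<le> s" "s \<le> t" "t \<le> T"
  have "F t x + G t x - (F s x + G s x) = (F t x - F s x) + (G t x - G s x)" by simp
  then show "norm (F t x + G t x - (F s x + G s x)) \<le> (m + m') * (t - s) powr \<alpha>"
    using norm_triangle_mono[OF incrementsD(1)[OF assms(1) st] incrementsD(1)[OF assms(2) st]]
    by (simp add: algebra_simps)
  have "F t x + G t x - (F s x + G s x) - (F t y + G t y - (F s y + G s y))
    = ((F t x - F s x) - (F t y - F s y)) + ((G t x - G s x) - (G t y - G s y))" by simp
  then show "norm (F t x + G t x - (F s x + G s x) - (F t y + G t y - (F s y + G s y)))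
    \<le> (m + m') * (t - s) powr \<alpha> * norm (x - y) powr b"
    using norm_triangle_mono[OF incrementsD(2)[OF assms(1) st] incrementsD(2)[OF assms(2) st]]
    by (simp add: algebra_simps)
qed

lemma split_powr:
  assumes "s \<le> u" "u \<le> t" shows "(t - u) powr \<alpha> * (u - s) powr (\<alpha> * b) \<le> (t - s) powr \<mu>"
proof -
  have "(t - u) powr \<alpha> * (u - s) powr (\<alpha> * b) \<le> (t - s) powr \<alpha> * (t - s) powr (\<alpha> * b)"
    using assms \<alpha> b by (intro mult_mono powr_mono2) auto
  then show ?thesis by (simp add: \<mu>_def powr_add)
qed

lemma hol_powr:
  assumes "hol \<rho> z" "0 \<le> s" "s \<le> u" "u \<le> T"
  shows "norm (z u - z s) powr b \<le> \<rho> powr b * (u - s) powr (\<alpha> * b)"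
proof -
  have "norm (z u - z s) powr b \<le> (\<rho> * (u - s) powr \<alpha>) powr b"
    using holD[OF assms] b by (intro powr_mono2) auto
  also have "\<dots> = \<rho> powr b * (u - s) powr (\<alpha> * b)"
    using hol_nonneg[OF assms(1)] by (simp add: powr_mult powr_powr)
  finally show ?thesis .
qed

text \<open>The defect is, up to sign, the increment of \<open>F\<close> over \<open>[u,t]\<close>
  compared at \<open>y u\<close> and \<open>y s\<close>. Time regularity \<alpha> and the b-Hoelder
  dependence on an \<alpha>-Hoelder path add up to \<mu>. The power \<open>\<rho> powr b\<close>
  with \<open>b < 1\<close> is what later makes the a priori bound possible.\<close>

lemma increments_germ_bound:
  assumes F: "increments m F" and m: "0 \<le> m" and y: "hol \<rho> y" and st: "0 \<le> s" "s \<le> u" "u \<le> t" "t \<le> T"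
  shows "norm ((F t (y s) - F s (y s)) - (F u (y s) - F s (y s)) - (F t (y u) - F u (y u)))
    \<le> m * \<rho> powr b * (t - s) powr \<mu>"
proof -
  have "norm ((F t (y u) - F u (y u)) - (F t (y s) - F u (y s))) \<le> m * (t - u) powr \<alpha> * norm (y u - y s) powr b"
    using st by (intro incrementsD(2)[OF F]) auto
  also have "\<dots> \<le> m * (t - u) powr \<alpha> * (\<rho> powr b * (u - s) powr (\<alpha> * b))"
    using m st by (intro mult_left_mono hol_powr[OF y]) auto
  also have "\<dots> = m * \<rho> powr b * ((t - u) powr \<alpha> * (u - s) powr (\<alpha> * b))" by simp
  also have "\<dots> \<le> m * \<rho> powr b * (t - s) powr \<mu>" using m st by (intro mult_left_mono split_powr) auto
  finally have "norm ((F t (y u) - F u (y u)) - (F t (y s) - F u (y s))) \<le> m * \<rho> powr b * (t - s) powr \<mu>" .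
  moreover have "(F t (y s) - F s (y s)) - (F u (y s) - F s (y s)) - (F t (y u) - F u (y u))
    = - ((F t (y u) - F u (y u)) - (F t (y s) - F u (y s)))" by simp
  ultimately show ?thesis by (simp only: norm_minus_cancel)
qed

lemma increments_germ:
  assumes F: "increments m F" and m: "0 \<le> m" and y: "hol \<rho> y"
  shows "dominated 0 (m * (1 + \<rho> powr b)) (\<lambda>s t. F t (y s) - F s (y s)) (\<lambda>_. 0::real)"
proof (rule dominatedI)
  have r: "m \<le> m * (1 + \<rho> powr b)" using m by (auto simp: algebra_simps)
  fix s t assume st: "0 \<le> s" "s \<le> t" "t \<le> T"
  show "norm (F t (y s) - F s (y s)) \<le> (0 * norm (0::real) + m * (1 + \<rho> powr b)) * (t - s) powr \<alpha>"
    using order_trans[OF incrementsD(1)[OF F st] mult_right_mono[OF r]] by simp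
next
  have r: "m * \<rho> powr b \<le> m * (1 + \<rho> powr b)" using m by (auto simp: algebra_simps)
  fix s u t assume st: "0 \<le> s" "s \<le> u" "u \<le> t" "t \<le> T"
  show "norm ((F t (y s) - F s (y s)) - (F u (y s) - F s (y s)) - (F t (y u) - F u (y u)))
    \<le> 0 * (t - s) powr \<alpha> * norm (0 - 0 :: real) + (0 * norm (0::real) + m * (1 + \<rho> powr b)) * (t - s) powr \<mu>"
    using order_trans[OF increments_germ_bound[OF F m y st] mult_right_mono[OF r]] by simp
qed

text \<open>The derivative is carried along as \<open>D\<close> instead of \<open>fderivx A\<close>,
  so that sums and multiples of fields get the evident derivatives without appeal to uniqueness of
  derivatives.\<close>

definition regular_field :: "real \<Rightarrow> (real \<Rightarrow> 'v::real_normed_vector \<Rightarrow> 'v) \<Rightarrow> (real \<Rightarrow> 'v \<Rightarrow> ('v \<Rightarrow>\<^sub>L 'v)) \<Rightarrow> bool" where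
  "regular_field m A D \<longleftrightarrow> 0 \<le> m \<and> increments m A \<and> increments m D \<and>
    (\<forall>t x. 0 \<le> t \<longrightarrow> t \<le> T \<longrightarrow> (A t has_derivative blinfun_apply (D t x)) (at x))"

lemma regular_fieldD:
  assumes "regular_field m A D"
  shows "0 \<le> m" "increments m A" "increments m D"
    and "0 \<le> t \<Longrightarrow> t \<le> T \<Longrightarrow> (A t has_derivative blinfun_apply (D t x)) (at x)"
  using assms by (auto simp: regular_field_def)

lemma regular_field_add:
  assumes "regular_field m A D" "regular_field k H D'"
  shows "regular_field (m + k) (\<lambda>t x. A t x + H t x) (\<lambda>t x. D t x + D' t x)"
  unfolding regular_field_def
proof (intro conjI allI impI)
  fix t x assume t: "0 \<le> t" "t \<le> T"
  show "((\<lambda>x. A t x + H t x) has_derivative blinfun_apply (D t x + D' t x)) (at x)"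
    using has_derivative_add[OF regular_fieldD(4)[OF assms(1) t] regular_fieldD(4)[OF assms(2) t]]
    by (simp add: blinfun.add_left[abs_def])
qed (use regular_fieldD[OF assms(1)] regular_fieldD[OF assms(2)] increments_add in auto)

lemma increment_has_derivative:
  assumes "regular_field m A D" "0 \<le> s" "s \<le> t" "t \<le> T"
  shows "((\<lambda>x. A t x - A s x) has_derivative blinfun_apply (D t x - D s x)) (at x)"
  using has_derivative_diff[OF regular_fieldD(4)[OF assms(1), of t x] regular_fieldD(4)[OF assms(1), of s x]] assms(2-4)
  by (simp add: blinfun.diff_left[abs_def])

lemma increment_lipschitz:
  assumes A: "regular_field m A D" and st: "0 \<le> s" "s \<le> t" "t \<le> T"
  shows "norm ((A t x - A s x) - (A t y - A s y)) \<le> m * (t - s) powr \<alpha> * norm (x - y)"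
proof (rule differentiable_bound[of UNIV "\<lambda>x. A t x - A s x" "\<lambda>x. blinfun_apply (D t x - D s x)"])
  fix x
  show "((\<lambda>x. A t x - A s x) has_derivative blinfun_apply (D t x - D s x)) (at x within UNIV)"
    using increment_has_derivative[OF A st] by simp
  show "onorm (blinfun_apply (D t x - D s x)) \<le> m * (t - s) powr \<alpha>"
    using incrementsD(1)[OF regular_fieldD(3)[OF A] st] by (simp add: norm_blinfun.rep_eq)
qed auto

text \<open>Differentiate \<open>w \<mapsto> f (z' + w) - f (z + w)\<close>.\<close>

lemma increment_four_point:
  assumes A: "regular_field m A D" and st: "0 \<le> s" "s \<le> t" "t \<le> T"
  defines "f \<equiv> \<lambda>x. A t x - A s x"
  shows "norm ((f y' - f z') - (f y - f z))
    \<le> m * (t - s) powr \<alpha> * norm ((y' - z') - (y - z)) + m * (t - s) powr \<alpha> * norm (z' - z) powr b * norm (y - z)"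
proof -
  \<comment> \<open>\<open>z\<close>, \<open>z + w\<close>, \<open>z'\<close>, \<open>z' + w\<close>
    form a parallelogram with \<open>z + w = y\<close>; \<open>y'\<close> differs from the fourth
    corner exactly by \<open>(y' - z') - (y - z)\<close>.\<close>
  define w where "w = y - z"
  define g where "g v = f (z' + v) - f (z + v)" for v
  have 1: "norm (f y' - f (z' + w)) \<le> m * (t - s) powr \<alpha> * norm ((y' - z') - (y - z))"
    using increment_lipschitz[OF A st, of y' "z' + w"] by (simp add: f_def w_def algebra_simps)
  have "norm (g w - g 0) \<le> (m * (t - s) powr \<alpha> * norm (z' - z) powr b) * norm (w - 0)"
  proof (rule differentiable_bound[of UNIV g "\<lambda>v. blinfun_apply ((D t (z' + v) - D s (z' + v)) - (D t (z + v) - D s (z + v)))"])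
    fix v
    have shift: "((\<lambda>v. f (a + v)) has_derivative blinfun_apply (D t (a + v) - D s (a + v))) (at v)" for a
    proof -
      have "((\<lambda>v. a + v) has_derivative (\<lambda>v. v)) (at v)" by (auto intro!: derivative_eq_intros)
      moreover have "(f has_derivative blinfun_apply (D t (a + v) - D s (a + v))) (at (a + v))"
        unfolding f_def by (rule increment_has_derivative[OF A st])
      ultimately show ?thesis by (rule has_derivative_compose)
    qed
    show "(g has_derivative blinfun_apply ((D t (z' + v) - D s (z' + v)) - (D t (z + v) - D s (z + v)))) (at v within UNIV)"
      unfolding g_def[abs_def] using has_derivative_diff[OF shift[of z'] shift[of z]] by (simp add: blinfun.diff_left[abs_def])
    show "onorm (blinfun_apply ((D t (z' + v) - D s (z' + v)) - (D t (z + v) - D s (z + v)))) \<le> m * (t - s) powr \<alpha> * norm (z' - z) powr b"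
      using incrementsD(2)[OF regular_fieldD(3)[OF A] st, of "z' + v" "z + v"] by (simp add: norm_blinfun.rep_eq)
  qed auto
  then have 2: "norm (g w - g 0) \<le> m * (t - s) powr \<alpha> * norm (z' - z) powr b * norm (y - z)" by (simp add: w_def)
  have e: "(f y' - f z') - (f y - f z) = (f y' - f (z' + w)) + (g w - g 0)"
    by (simp add: g_def w_def)
  show ?thesis unfolding e by (rule norm_triangle_mono[OF 1 2])
qed

text \<open>The four-point estimate at times \<open>s\<close> and \<open>u\<close>. It is
  asymmetric: only the Hoelder seminorm of \<open>z\<close> enters, and \<open>y\<close> is
  controlled through \<open>y - z\<close> alone.\<close>

lemma field_difference_dominated:
  assumes A: "regular_field m A D" and z: "hol \<rho> z"
  shows "dominated (m * (1 + \<rho> powr b)) 0 (\<lambda>s t. (A t (y s) - A s (y s)) - (A t (z s) - A s (z s))) (\<lambda>t. y t - z t)"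
proof (rule dominatedI)
  have m: "0 \<le> m" by (rule regular_fieldD(1)[OF A])
  have r: "m \<le> m * (1 + \<rho> powr b)" "m * \<rho> powr b \<le> m * (1 + \<rho> powr b)" using m by (auto simp: algebra_simps)
  fix s t assume st: "0 \<le> s" "s \<le> t" "t \<le> T"
  have "norm ((A t (y s) - A s (y s)) - (A t (z s) - A s (z s))) \<le> m * (t - s) powr \<alpha> * norm (y s - z s)"
    by (rule increment_lipschitz[OF A st])
  also have "\<dots> \<le> m * (1 + \<rho> powr b) * (t - s) powr \<alpha> * norm (y s - z s)" by (intro mult_right_mono r) auto
  also have "\<dots> = (m * (1 + \<rho> powr b) * norm (y s - z s) + 0) * (t - s) powr \<alpha>" by simp
  finally show "norm ((A t (y s) - A s (y s)) - (A t (z s) - A s (z s)))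
    \<le> (m * (1 + \<rho> powr b) * norm (y s - z s) + 0) * (t - s) powr \<alpha>" .
next
  have m: "0 \<le> m" by (rule regular_fieldD(1)[OF A])
  have r: "m \<le> m * (1 + \<rho> powr b)" "m * \<rho> powr b \<le> m * (1 + \<rho> powr b)" using m by (auto simp: algebra_simps)
  fix s u t assume st: "0 \<le> s" "s \<le> u" "u \<le> t" "t \<le> T"
  define f where "f x = A t x - A u x" for x
  have e: "((A t (y s) - A s (y s)) - (A t (z s) - A s (z s))) - ((A u (y s) - A s (y s)) - (A u (z s) - A s (z s)))
     - ((A t (y u) - A u (y u)) - (A t (z u) - A u (z u))) = - ((f (y u) - f (z u)) - (f (y s) - f (z s)))"
    by (simp add: f_def)
  have "norm ((f (y u) - f (z u)) - (f (y s) - f (z s))) \<le>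
    m * (t - u) powr \<alpha> * norm ((y u - z u) - (y s - z s)) + m * (t - u) powr \<alpha> * norm (z u - z s) powr b * norm (y s - z s)"
    unfolding f_def using st by (intro increment_four_point[OF A]) auto
  also have "\<dots> \<le> m * (1 + \<rho> powr b) * (t - s) powr \<alpha> * norm ((y u - z u) - (y s - z s))
      + m * (1 + \<rho> powr b) * norm (y s - z s) * (t - s) powr \<mu>"
  proof (rule add_mono)
    show "m * (t - u) powr \<alpha> * norm ((y u - z u) - (y s - z s)) \<le> m * (1 + \<rho> powr b) * (t - s) powr \<alpha> * norm ((y u - z u) - (y s - z s))"
      using st \<alpha> m r by (intro mult_right_mono mult_mono powr_mono2) auto
    have "m * (t - u) powr \<alpha> * norm (z u - z s) powr b \<le> m * (t - u) powr \<alpha> * (\<rho> powr b * (u - s) powr (\<alpha> * b))"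
      using m st by (intro mult_left_mono hol_powr[OF z]) auto
    also have "\<dots> = m * \<rho> powr b * ((t - u) powr \<alpha> * (u - s) powr (\<alpha> * b))" by simp
    also have "\<dots> \<le> m * (1 + \<rho> powr b) * (t - s) powr \<mu>" using m st r by (intro mult_mono split_powr) auto
    finally have "m * (t - u) powr \<alpha> * norm (z u - z s) powr b * norm (y s - z s) \<le> m * (1 + \<rho> powr b) * (t - s) powr \<mu> * norm (y s - z s)"
      by (intro mult_right_mono) auto
    then show "m * (t - u) powr \<alpha> * norm (z u - z s) powr b * norm (y s - z s) \<le> m * (1 + \<rho> powr b) * norm (y s - z s) * (t - s) powr \<mu>"
      by (simp add: mult_ac)
  qed
  finally show "norm (((A t (y s) - A s (y s)) - (A t (z s) - A s (z s))) - ((A u (y s) - A s (y s)) - (A u (z s) - A s (z s)))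
     - ((A t (y u) - A u (y u)) - (A t (z u) - A u (z u))))
    \<le> m * (1 + \<rho> powr b) * (t - s) powr \<alpha> * norm ((y u - z u) - (y s - z s)) + (m * (1 + \<rho> powr b) * norm (y s - z s) + 0) * (t - s) powr \<mu>"
    unfolding e norm_minus_cancel by simp
qed

text \<open>Since \<open>b < 1\<close>, the self-map bound \<open>N \<mapsto> c (1 + N\<^sup>b)\<close> of the Hoelder seminorm is sublinear, so it has an
  invariant interval and solutions have an a priori bound on all of \<open>[0,T]\<close> at once.\<close>

definition apriori_const :: "real \<Rightarrow> real" where
  "apriori_const m = m * (1 + sew_const \<mu> * T powr (\<mu> - \<alpha>))"

definition apriori :: "real \<Rightarrow> real" where
  "apriori m = 2 * apriori_const m + (2 * (apriori_const m + 1)) powr (1 / (1 - b))"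

lemma apriori_const_nonneg: "0 \<le> m \<Longrightarrow> 0 \<le> apriori_const m"
  using sew_const_pos[OF \<mu>] by (simp add: apriori_const_def)

lemma apriori_nonneg: "0 \<le> m \<Longrightarrow> 0 \<le> apriori m"
  using apriori_const_nonneg by (simp add: apriori_def)

text \<open>Young's inequality with exponents \<open>b\<close> and \<open>1 - b\<close>, where
  \<open>L\<close> is chosen to make \<open>L powr (1 - b)\<close> equal to
  \<open>2 * (c + 1)\<close> for \<open>c = apriori_const m\<close>. At \<open>N = apriori m\<close>
  the right-hand side is \<open>apriori m\<close> again, which is the invariance needed for Picard
  iteration.\<close>

lemma apriori_sublinear:
  assumes "0 \<le> m" "0 \<le> N"
  shows "apriori_const m * (1 + N powr b) \<le> apriori m / 2 + N / 2"
proof -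
  let ?c = "apriori_const m"
  have c: "0 \<le> ?c" using assms by (simp add: apriori_const_nonneg)
  define L where "L = (2 * (?c + 1)) powr (1 / (1 - b))"
  have L: "0 < L" "L powr (1 - b) = 2 * (?c + 1)" using c b by (auto simp: L_def powr_powr)
  have "2 * (?c * N powr b) \<le> N + L"
  proof (cases "N = 0")
    case False
    then have "N powr b * L powr (1 - b) \<le> b * N + (1 - b) * L"
      using assms b L by (intro Youngs_inequality_0) auto
    also have "\<dots> \<le> 1 * N + 1 * L" using assms b L by (intro add_mono mult_right_mono) auto
    finally have "N powr b * (2 * (?c + 1)) \<le> N + L" using L by simp
    moreover have "2 * (?c * N powr b) \<le> N powr b * (2 * (?c + 1))" by (simp add: distrib_left)
    ultimately show ?thesis by linarith
  qed (use L in auto)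
  moreover have "apriori m = 2 * ?c + L" by (simp add: apriori_def L_def)
  moreover have "?c * (1 + N powr b) = ?c + ?c * N powr b" by (simp add: distrib_left)
  ultimately show ?thesis by linarith
qed

lemma integral_hol:
  assumes F: "increments m F" and m: "0 \<le> m" and y: "hol N y" and sew: "sews T \<mu> (\<lambda>s t. F t (y s) - F s (y s)) y'"
  shows "hol (apriori_const m * (1 + N powr b)) y'"
proof (rule holI)
  let ?K = "sew_const \<mu>"
  have K: "0 < ?K" by (rule sew_const_pos[OF \<mu>])
  obtain M where M: "\<And>s t. 0 \<le> s \<Longrightarrow> s \<le> t \<Longrightarrow> t \<le> T \<Longrightarrow> norm (y' t - y' s - (F t (y s) - F s (y s))) \<le> M * (t - s) powr \<mu>"
    using sew by (rule sewsE) blast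
  fix s t assume st: "0 \<le> s" "s \<le> t" "t \<le> T"
  have "norm (y' t - y' s - (F t (y s) - F s (y s))) \<le> ?K * (m * N powr b) * (t - s) powr \<mu>"
    using st m by (intro sewing_bound[OF \<mu> _ _ _ increments_germ_bound[OF F m y] M]) auto
  also have "\<dots> \<le> ?K * (m * N powr b) * (T powr (\<mu> - \<alpha>) * (t - s) powr \<alpha>)"
    using K m st \<mu>_bounds by (intro mult_left_mono powr_le_T) auto
  finally have 1: "norm (y' t - y' s - (F t (y s) - F s (y s))) \<le> m * (?K * T powr (\<mu> - \<alpha>)) * N powr b * (t - s) powr \<alpha>"
    by (simp add: mult_ac)
  have "norm (y' t - y' s) \<le> (m + m * (?K * T powr (\<mu> - \<alpha>)) * N powr b) * (t - s) powr \<alpha>"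
    using 1 incrementsD(1)[OF F st, of "y s"] norm_triangle_sub[of "y' t - y' s" "F t (y s) - F s (y s)"]
    by (simp add: distrib_right)
  also have "\<dots> \<le> apriori_const m * (1 + N powr b) * (t - s) powr \<alpha>"
    using m K by (intro mult_right_mono) (auto simp: apriori_const_def algebra_simps)
  finally show "norm (y' t - y' s) \<le> apriori_const m * (1 + N powr b) * (t - s) powr \<alpha>" .
qed

text \<open>The contraction constant depends on the Hoelder seminorms of the iterates, so the class
  is the ball of radius \<open>apriori m\<close>; \<open>integral_hol\<close> and
  \<open>apriori_sublinear\<close> keep the iterates inside.\<close>

lemma solution_exists:
  fixes A :: "real \<Rightarrow> 'v::banach \<Rightarrow> 'v"
  assumes A: "regular_field m A D"
  shows "\<exists>y. y 0 = x \<and> hol (apriori m) y \<and> sews T \<mu> (\<lambda>s t. A t (y s) - A s (y s)) y"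
proof -
  note m = regular_fieldD(1)[OF A] and inc = regular_fieldD(2)[OF A]
  define a where "a = m * (1 + apriori m powr b) + 1"
  have a: "0 < a" using m by (simp add: a_def add_nonneg_pos)
  have R: "0 \<le> apriori m" by (rule apriori_nonneg[OF m])
  have "\<exists>y. (y 0 = x \<and> hol (apriori m) y) \<and> sews T \<mu> (\<lambda>s t. A t (y s) - A s (y s)) y"
  proof (rule picard[OF a, where Cl = "\<lambda>y. y 0 = x \<and> hol (apriori m) y" and G = "\<lambda>y s t. A t (y s) - A s (y s)" and x = x])
    show "x = x \<and> hol (apriori m) (\<lambda>_. x)" using hol_mono[OF hol_const R] by simp
  next
    fix y assume y: "y 0 = x \<and> hol (apriori m) y"
    obtain I where I: "I 0 = 0" "sews T \<mu> (\<lambda>s t. A t (y s) - A s (y s)) I"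
      using dominated_sewing[OF increments_germ[OF inc m, of "apriori m" y] hol_const order_refl] y m by auto
    have "hol (apriori_const m * (1 + apriori m powr b)) I"
      using integral_hol[OF inc m _ I(2)] y by blast
    then have "hol (apriori m) I" by (rule hol_mono) (use apriori_sublinear[OF m R] in simp)
    then have "hol (apriori m) (\<lambda>t. x + I t)" using hol_add[OF hol_const[of x]] by fastforce
    moreover have "sews T \<mu> (\<lambda>s t. A t (y s) - A s (y s)) (\<lambda>t. x + I t)" using I(2) by (simp add: sews_def)
    ultimately show "\<exists>y'. (y' 0 = x \<and> hol (apriori m) y') \<and> sews T \<mu> (\<lambda>s t. A t (y s) - A s (y s)) y'"
      using I(1) by (intro exI[of _ "\<lambda>t. x + I t"]) auto
  next
    fix Y y N
    assume Y: "\<And>n. Y n 0 = x \<and> hol (apriori m) (Y n)"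
      and lim: "\<And>t. 0 \<le> t \<Longrightarrow> t \<le> T \<Longrightarrow> (\<lambda>n. Y n t) \<longlonglongrightarrow> y t"
    have "y 0 = x" using LIMSEQ_unique[OF lim[of 0]] Y T by (simp add: LIMSEQ_const_iff)
    moreover have "hol (apriori m) y"
    proof (rule holI)
      fix s t assume st: "0 \<le> s" "s \<le> t" "t \<le> T"
      have "(\<lambda>n. norm (Y n t - Y n s)) \<longlonglongrightarrow> norm (y t - y s)" using st by (intro tendsto_intros lim) auto
      then show "norm (y t - y s) \<le> apriori m * (t - s) powr \<alpha>"
        by (rule LIMSEQ_le_const2) (use holD[OF conjunct2[OF Y] st] in auto)
    qed
    ultimately show "y 0 = x \<and> hol (apriori m) y" by blast
  next
    fix y z assume "y 0 = x \<and> hol (apriori m) y" "z 0 = x \<and> hol (apriori m) z"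
    then show "dominated a 0 (\<lambda>s t. (A t (y s) - A s (y s)) - (A t (z s) - A s (z s))) (\<lambda>t. y t - z t)"
      unfolding a_def by (intro dominated_mono[OF field_difference_dominated[OF A]]) auto
  qed auto
  then show ?thesis by blast
qed

lemma solution_unique:
  assumes A: "regular_field m A D"
    and y: "hol N y" "sews T \<mu> (\<lambda>s t. A t (y s) - A s (y s)) y"
    and z: "hol N' z" "sews T \<mu> (\<lambda>s t. A t (z s) - A s (z s)) z"
    and "y 0 = z 0" "0 \<le> t" "t \<le> T"
  shows "y t = z t"
  using dominated_zero[OF field_difference_dominated[OF A z(1)] _ sews_diff[OF y(2) z(2)] hol_diff[OF y(1) z(1)]]
    regular_fieldD(1)[OF A] assms(6-) by simp

subsection \<open>Hoelder norms and the solution map\<close>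

lemma holder_path_hol:
  assumes "hol N f" shows "holder_path T \<alpha> f"
proof -
  have "norm (f t - f s) / (t - s) powr \<alpha> \<le> N" if "(s, t) \<in> incr_pairs T" for s t
    using that holD[OF assms, of s t] by (auto simp: incr_pairs_def pos_divide_le_eq)
  then show ?thesis
    using hol_bounded[OF assms] unfolding holder_path_def
    by (intro conjI bdd_aboveI2[where M = "norm (f 0) + N * T powr \<alpha>"] bdd_aboveI2[where M = N]) auto
qed

lemma holder_path_iff: "holder_path T \<alpha> f \<longleftrightarrow> (\<exists>N. hol N f)"
proof
  assume "holder_path T \<alpha> f"
  then obtain N where N: "\<And>s t. (s, t) \<in> incr_pairs T \<Longrightarrow> norm (f t - f s) / (t - s) powr \<alpha> \<le> N"
    unfolding holder_path_def bdd_above_def by fast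
  have "hol N f"
  proof (rule holI)
    fix s t assume st: "0 \<le> s" "s \<le> t" "t \<le> T"
    show "norm (f t - f s) \<le> N * (t - s) powr \<alpha>"
    proof (cases "s = t")
      case False
      then show ?thesis using N[of s t] st by (auto simp: incr_pairs_def pos_divide_le_eq)
    qed simp
  qed
  then show "\<exists>N. hol N f" by blast
qed (use holder_path_hol in blast)

lemma path_norm_le:
  assumes "hol N f" "\<And>t. 0 \<le> t \<Longrightarrow> t \<le> T \<Longrightarrow> norm (f t) \<le> B"
  shows "path_norm T \<alpha> f \<le> B + N"
proof -
  have "0 \<le> B" using order_trans[OF norm_ge_zero assms(2)[of 0]] T by simp
  moreover have "norm (f t - f s) / (t - s) powr \<alpha> \<le> N" if "(s, t) \<in> incr_pairs T" for s t
    using that holD[OF assms(1), of s t] by (auto simp: incr_pairs_def pos_divide_le_eq)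
  ultimately show ?thesis
    unfolding path_norm_def using assms(2) hol_nonneg[OF assms(1)] by (intro add_mono hsup_le) auto
qed

lemma is_ito_sol_iff:
  fixes A :: "real \<Rightarrow> 'v::banach \<Rightarrow> 'v"
  assumes A: "regular_field m A D"
  shows "is_ito_sol T \<alpha> A x y \<longleftrightarrow> (\<exists>N. hol N y) \<and> y 0 = x \<and> sews T \<mu> (\<lambda>s t. A t (y s) - A s (y s)) y"
proof
  assume L: "is_ito_sol T \<alpha> A x y"
  then obtain N where N: "hol N y" by (auto simp: is_ito_sol_def holder_path_iff)
  have "sews T \<mu> (\<lambda>s t. A t (y s) - A s (y s)) y" "y 0 = x"
    using has_sewing_dominated[OF increments_germ[OF regular_fieldD(2,1)[OF A] N] hol_const, of y x]
      L regular_fieldD(1)[OF A] by (auto simp: is_ito_sol_def)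
  then show "(\<exists>N. hol N y) \<and> y 0 = x \<and> sews T \<mu> (\<lambda>s t. A t (y s) - A s (y s)) y" using N by blast
next
  assume "(\<exists>N. hol N y) \<and> y 0 = x \<and> sews T \<mu> (\<lambda>s t. A t (y s) - A s (y s)) y"
  then show "is_ito_sol T \<alpha> A x y"
    using sews_has_sewing[OF _ \<mu>] by (auto simp: is_ito_sol_def holder_path_iff)
qed

lemma ito_solution:
  fixes A :: "real \<Rightarrow> 'v::banach \<Rightarrow> 'v"
  assumes A: "regular_field m A D"
  shows "ito T \<alpha> A x 0 = x" "hol (apriori m) (ito T \<alpha> A x)"
    and "sews T \<mu> (\<lambda>s t. A t (ito T \<alpha> A x s) - A s (ito T \<alpha> A x s)) (ito T \<alpha> A x)"
    and "t \<notin> {0..T} \<Longrightarrow> ito T \<alpha> A x t = 0"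
proof -
  obtain y where y: "y 0 = x" "hol (apriori m) y" "sews T \<mu> (\<lambda>s t. A t (y s) - A s (y s)) y"
    using solution_exists[OF A] by blast
  \<comment> \<open>Extension by zero, as required in \<open>ito\<close> for the definite
    description to have a unique referent.\<close>
  define z where "z t = (if t \<in> {0..T} then y t else 0)" for t
  have z: "z 0 = x" "hol (apriori m) z" "sews T \<mu> (\<lambda>s t. A t (z s) - A s (z s)) z"
    using y T by (auto simp: z_def intro: hol_cong sews_cong)
  have "ito T \<alpha> A x = z"
    unfolding ito_def
  proof (rule the_equality)
    show "is_ito_sol T \<alpha> A x z \<and> (\<forall>t. t \<notin> {0..T} \<longrightarrow> z t = 0)"
      using z by (auto simp: is_ito_sol_iff[OF A] z_def)
    fix w assume w: "is_ito_sol T \<alpha> A x w \<and> (\<forall>t. t \<notin> {0..T} \<longrightarrow> w t = 0)"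
    then obtain N where w': "hol N w" "w 0 = x" "sews T \<mu> (\<lambda>s t. A t (w s) - A s (w s)) w"
      by (auto simp: is_ito_sol_iff[OF A])
    show "w = z"
    proof
      fix t
      show "w t = z t"
        using solution_unique[OF A w'(1,3) z(2,3), of t] w w' z(1) by (cases "t \<in> {0..T}") (auto simp: z_def)
    qed
  qed
  then show "ito T \<alpha> A x 0 = x" "hol (apriori m) (ito T \<alpha> A x)"
    "sews T \<mu> (\<lambda>s t. A t (ito T \<alpha> A x s) - A s (ito T \<alpha> A x s)) (ito T \<alpha> A x)"
    "t \<notin> {0..T} \<Longrightarrow> ito T \<alpha> A x t = 0"
    using z by (auto simp: z_def)
qed

end

section \<open>Differentiating the solution map\<close>

lemma hsup_upper:
  assumes "bdd_above S" shows "x \<in> S \<Longrightarrow> x \<le> hsup S" "0 \<le> hsup S"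
  using assms unfolding hsup_def by (auto intro!: cSup_upper)

lemma fn_norm_bounds:
  assumes "fn_bdd \<beta> g"
  shows "norm (g x) \<le> fn_norm \<beta> g" "norm (g x - g y) \<le> fn_norm \<beta> g * norm (x - y) powr \<beta>" "0 \<le> fn_norm \<beta> g"
proof -
  define q where "q = hsup ((\<lambda>(x,y). norm (g x - g y) / norm (x - y) powr \<beta>) ` {(x,y). x \<noteq> y})"
  define r where "r = hsup (range (\<lambda>x. norm (g x)))"
  have q: "0 \<le> q" and r: "0 \<le> r" and rx: "norm (g x) \<le> r" and n: "fn_norm \<beta> g = q + r"
    using assms unfolding q_def r_def fn_bdd_def fn_norm_def by (auto intro!: hsup_upper)
  show "norm (g x) \<le> fn_norm \<beta> g" "0 \<le> fn_norm \<beta> g" using q r rx n by auto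
  show "norm (g x - g y) \<le> fn_norm \<beta> g * norm (x - y) powr \<beta>"
  proof (cases "x = y")
    case False
    have "norm (g x - g y) / norm (x - y) powr \<beta> \<le> q"
      unfolding q_def using assms False unfolding fn_bdd_def by (intro hsup_upper(1)) auto
    then have "norm (g x - g y) \<le> q * norm (x - y) powr \<beta>" using False by (simp add: pos_divide_le_eq)
    also have "\<dots> \<le> fn_norm \<beta> g * norm (x - y) powr \<beta>" using n r by (intro mult_right_mono) auto
    finally show ?thesis .
  qed simp
qed

lemma field_norm_bounds:
  assumes F: "field_bdd T \<alpha> \<beta> F" and st: "0 \<le> s" "s \<le> t" "t \<le> T"
  shows "norm (F t x - F s x) \<le> field_norm T \<alpha> \<beta> F * (t - s) powr \<alpha>"
    and "norm ((F t x - F s x) - (F t y - F s y)) \<le> field_norm T \<alpha> \<beta> F * (t - s) powr \<alpha> * norm (x - y) powr \<beta>"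
proof -
  have "norm (F t x - F s x) \<le> field_norm T \<alpha> \<beta> F * (t - s) powr \<alpha> \<and>
    norm ((F t x - F s x) - (F t y - F s y)) \<le> field_norm T \<alpha> \<beta> F * (t - s) powr \<alpha> * norm (x - y) powr \<beta>"
  proof (cases "s = t")
    case False
    then have p: "(s, t) \<in> incr_pairs T" and ts: "0 < (t - s) powr \<alpha>" using st by (auto simp: incr_pairs_def)
    let ?g = "\<lambda>x. F t x - F s x"
    have g: "fn_bdd \<beta> ?g" using F p by (auto simp: field_bdd_def)
    have "fn_norm \<beta> ?g / (t - s) powr \<alpha> \<le> field_norm T \<alpha> \<beta> F"
      unfolding field_norm_def using F p unfolding field_bdd_def by (intro hsup_upper(1)) (auto intro!: image_eqI[where x = "(s, t)"])
    then have n: "fn_norm \<beta> ?g \<le> field_norm T \<alpha> \<beta> F * (t - s) powr \<alpha>" using ts by (simp add: pos_divide_le_eq)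
    have "norm (?g x - ?g y) \<le> fn_norm \<beta> ?g * norm (x - y) powr \<beta>" by (rule fn_norm_bounds(2)[OF g])
    also have "\<dots> \<le> field_norm T \<alpha> \<beta> F * (t - s) powr \<alpha> * norm (x - y) powr \<beta>" using n by (intro mult_right_mono) auto
    finally show ?thesis using order_trans[OF fn_norm_bounds(1)[OF g] n] by blast
  qed simp
  then show "norm (F t x - F s x) \<le> field_norm T \<alpha> \<beta> F * (t - s) powr \<alpha>"
    and "norm ((F t x - F s x) - (F t y - F s y)) \<le> field_norm T \<alpha> \<beta> F * (t - s) powr \<alpha> * norm (x - y) powr \<beta>"
    by auto
qed

lemma field_norm_nonneg: "field_bdd T \<alpha> \<beta> F \<Longrightarrow> 0 \<le> field_norm T \<alpha> \<beta> F"
  unfolding field_norm_def field_bdd_def by (intro hsup_upper(2)) auto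

lemma has_derivative_fderivx:
  assumes "A t differentiable (at x)"
  shows "(A t has_derivative blinfun_apply (fderivx A t x)) (at x)"
proof -
  obtain f where f: "(A t has_derivative f) (at x)" using assms by (auto simp: differentiable_def)
  then have "(A t has_derivative blinfun_apply (Blinfun f)) (at x)"
    by (simp add: bounded_linear_Blinfun_apply has_derivative_bounded_linear)
  then show ?thesis unfolding fderivx_def by (rule someI)
qed

text \<open>Lowering the exponent is harmless for \<open>r <= 1\<close>, where the larger power is
  the smaller number; for \<open>r > 1\<close> the uniform bound takes over.\<close>

lemma weaken_modulus:
  assumes "d \<le> m * r powr \<beta>" "d \<le> 2 * m" "0 \<le> m" "0 \<le> r" "0 < b" "b \<le> \<beta>"
  shows "d \<le> 2 * m * r powr (b::real)"
proof (cases "r \<le> 1")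
  case True
  then have "r powr \<beta> \<le> r powr b" using assms by (cases "r = 0") (auto intro: powr_mono')
  then have "m * r powr \<beta> \<le> m * r powr b" using assms by (intro mult_left_mono) auto
  moreover have "0 \<le> m * r powr b" using assms by simp
  ultimately show ?thesis using assms(1) by linarith
next
  case False
  then have "1 \<le> r powr b" using assms by (simp add: ge_one_powr_ge_zero)
  then have "2 * m * 1 \<le> 2 * m * r powr b" using assms by (intro mult_left_mono) auto
  then show ?thesis using assms(2) by simp
qed

context young
begin

lemma increments_field_bdd:
  assumes F: "field_bdd T \<alpha> \<beta> F" and "b \<le> \<beta>" and m: "field_norm T \<alpha> \<beta> F \<le> m"
  shows "increments (2 * m) F"
  unfolding increments_def
proof (intro allI impI conjI)
  fix s t x y assume st: "0 \<le> s" "s \<le> t" "t \<le> T"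
  have m0: "0 \<le> m" using field_norm_nonneg[OF F] m by simp
  have 1: "norm (F t x - F s x) \<le> m * (t - s) powr \<alpha>" for x
    by (rule order_trans[OF field_norm_bounds(1)[OF F st]]) (intro mult_right_mono m; simp)
  have "0 \<le> m * (t - s) powr \<alpha>" using m0 by simp
  then show "norm (F t x - F s x) \<le> 2 * m * (t - s) powr \<alpha>" using 1[of x] by linarith
  have "norm ((F t x - F s x) - (F t y - F s y)) \<le> 2 * (m * (t - s) powr \<alpha>) * norm (x - y) powr b"
  proof (rule weaken_modulus)
    show "norm ((F t x - F s x) - (F t y - F s y)) \<le> m * (t - s) powr \<alpha> * norm (x - y) powr \<beta>"
      by (rule order_trans[OF field_norm_bounds(2)[OF F st]]) (intro mult_right_mono m; simp)
    show "norm ((F t x - F s x) - (F t y - F s y)) \<le> 2 * (m * (t - s) powr \<alpha>)"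
      using norm_triangle_ineq4[of "F t x - F s x" "F t y - F s y"] 1[of x] 1[of y] by linarith
  qed (use m0 b assms(2) in auto)
  then show "norm ((F t x - F s x) - (F t y - F s y)) \<le> 2 * m * (t - s) powr \<alpha> * norm (x - y) powr b" by simp
qed

lemma field_space_regular:
  assumes A: "field_space T \<alpha> \<beta> A" and b: "b \<le> \<beta>"
  shows "regular_field (2 * field_space_norm T \<alpha> \<beta> A) A (fderivx A)"
proof -
  have n: "0 \<le> field_norm T \<alpha> \<beta> A" "0 \<le> field_norm T \<alpha> \<beta> (fderivx A)"
    using A by (auto simp: field_space_def field_norm_nonneg)
  have "increments (2 * field_space_norm T \<alpha> \<beta> A) A" "increments (2 * field_space_norm T \<alpha> \<beta> A) (fderivx A)"
    using A n by (auto simp: field_space_def field_space_norm_def intro!: increments_field_bdd[OF _ b] simp del: distrib_left_numeral)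
  then show ?thesis
    unfolding regular_field_def
    using A n by (auto simp: field_space_def field_space_norm_def intro: has_derivative_fderivx)
qed

lemma regular_field_mono:
  assumes "regular_field m A D" "m \<le> m'" shows "regular_field m' A D"
proof -
  have le: "m * x \<le> m' * x" "m * x * z \<le> m' * x * z" if "0 \<le> x" "0 \<le> z" for x z
    using that assms(2) by (auto intro!: mult_right_mono)
  show ?thesis
    using assms unfolding regular_field_def increments_def
    by (auto intro!: order_trans[OF _ le(1)] order_trans[OF _ le(2)])
qed

lemma increments_scaleR:
  assumes F: "increments m F" shows "increments (\<bar>c\<bar> * m) (\<lambda>t x. c *\<^sub>R F t x)"
  unfolding increments_def
proof (intro allI impI conjI)
  fix s t x y assume st: "0 \<le> s" "s \<le> t" "t \<le> T"
  show "norm (c *\<^sub>R F t x - c *\<^sub>R F s x) \<le> \<bar>c\<bar> * m * (t - s) powr \<alpha>"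
    using mult_left_mono[OF incrementsD(1)[OF F st, of x], of "\<bar>c\<bar>"] by (simp flip: scaleR_diff_right)
  show "norm (c *\<^sub>R F t x - c *\<^sub>R F s x - (c *\<^sub>R F t y - c *\<^sub>R F s y)) \<le> \<bar>c\<bar> * m * (t - s) powr \<alpha> * norm (x - y) powr b"
    using mult_left_mono[OF incrementsD(2)[OF F st, of x y], of "\<bar>c\<bar>"] by (simp flip: scaleR_diff_right)
qed

lemma regular_field_scaleR:
  assumes "regular_field m A D" shows "regular_field (\<bar>c\<bar> * m) (\<lambda>t x. c *\<^sub>R A t x) (\<lambda>t x. c *\<^sub>R D t x)"
  unfolding regular_field_def
  using regular_fieldD(1-3)[OF assms] has_derivative_scaleR_right[OF regular_fieldD(4)[OF assms]]
  by (auto simp: blinfun.scaleR_left[abs_def] intro: increments_scaleR)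

lemma dominated_any: "dominated 0 k g (\<lambda>_. 0::real) \<Longrightarrow> dominated 0 k g Z"
  by (simp add: dominated_def)

lemma path_norm_nonneg:
  assumes "hol N f" shows "0 \<le> path_norm T \<alpha> f"
  using holder_path_hol[OF assms] unfolding path_norm_def holder_path_def
  by (intro add_nonneg_nonneg hsup_upper(2)) auto

subsection \<open>Affine equations\<close>

text \<open>Vanishing outside \<open>[0,T]\<close> makes solutions unique as functions on the whole
  real line, as needed for the pointwise identities of linearity in
  \<open>frechet_at\<close>.\<close>

definition affine_sol :: "(real \<Rightarrow> real \<Rightarrow> ('v::real_normed_vector \<Rightarrow>\<^sub>L 'v)) \<Rightarrow> (real \<Rightarrow> real \<Rightarrow> 'v) \<Rightarrow> (real \<Rightarrow> 'v) \<Rightarrow> bool" where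
  "affine_sol M g Y \<longleftrightarrow> Y 0 = 0 \<and> (\<exists>N. hol N Y) \<and> sews T \<mu> (\<lambda>s t. blinfun_apply (M s t) (Y s) + g s t) Y \<and>
    (\<forall>t. t \<notin> {0..T} \<longrightarrow> Y t = 0)"

lemma affine_sol_unique:
  fixes M :: "real \<Rightarrow> real \<Rightarrow> ('v::banach \<Rightarrow>\<^sub>L 'v)"
  assumes M: "dominated 0 m M (\<lambda>_. 0::real)" "0 \<le> m" and "affine_sol M g Y" "affine_sol M g Y'"
  shows "Y = Y'"
proof
  fix t
  obtain a where a: "0 \<le> a" "\<And>J. dominated a 0 (\<lambda>s t. blinfun_apply (M s t) (J s)) J"
    by (rule dominated_prod[OF bounded_bilinear_blinfun_apply M], rule that)
  obtain N N' where Y: "hol N Y" "Y 0 = 0" "sews T \<mu> (\<lambda>s t. blinfun_apply (M s t) (Y s) + g s t) Y" "t \<notin> {0..T} \<Longrightarrow> Y t = 0"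
    and Y': "hol N' Y'" "Y' 0 = 0" "sews T \<mu> (\<lambda>s t. blinfun_apply (M s t) (Y' s) + g s t) Y'" "t \<notin> {0..T} \<Longrightarrow> Y' t = 0"
    using assms(3,4) by (auto simp: affine_sol_def)
  have sew: "sews T \<mu> (\<lambda>s t. blinfun_apply (M s t) (Y s - Y' s)) (\<lambda>t. Y t - Y' t)"
    by (rule sews_cong[OF sews_diff[OF Y(3) Y'(3)]]) (simp_all add: blinfun.diff_right)
  show "Y t = Y' t"
  proof (cases "t \<in> {0..T}")
    case True
    have "Y t - Y' t = 0"
      by (rule dominated_zero[OF a(2)[of "\<lambda>t. Y t - Y' t"] a(1) sew hol_diff[OF Y(1) Y'(1)]])
        (use True Y(2) Y'(2) in auto)
    then show ?thesis by simp
  qed (use Y(4) Y'(4) in simp)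
qed

lemma affine_sol_add:
  assumes "affine_sol M g Y" "affine_sol M g' Y'"
  shows "affine_sol M (\<lambda>s t. g s t + g' s t) (\<lambda>t. Y t + Y' t)"
proof -
  obtain N N' where N: "hol N Y" "hol N' Y'" using assms by (auto simp: affine_sol_def)
  have "sews T \<mu> (\<lambda>s t. (blinfun_apply (M s t) (Y s) + g s t) + (blinfun_apply (M s t) (Y' s) + g' s t)) (\<lambda>t. Y t + Y' t)"
    using assms by (intro sews_add) (auto simp: affine_sol_def)
  then have "sews T \<mu> (\<lambda>s t. blinfun_apply (M s t) (Y s + Y' s) + (g s t + g' s t)) (\<lambda>t. Y t + Y' t)"
    by (rule sews_cong) (simp_all add: blinfun.add_right)
  then show ?thesis using assms hol_add[OF N] by (auto simp: affine_sol_def)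
qed

lemma affine_sol_scaleR:
  assumes "affine_sol M g Y"
  shows "affine_sol M (\<lambda>s t. c *\<^sub>R g s t) (\<lambda>t. c *\<^sub>R Y t)"
proof -
  obtain N where N: "hol N Y" using assms by (auto simp: affine_sol_def)
  have "sews T \<mu> (\<lambda>s t. c *\<^sub>R (blinfun_apply (M s t) (Y s) + g s t)) (\<lambda>t. c *\<^sub>R Y t)"
    using assms by (intro sews_scaleR) (auto simp: affine_sol_def)
  then have "sews T \<mu> (\<lambda>s t. blinfun_apply (M s t) (c *\<^sub>R Y s) + c *\<^sub>R g s t) (\<lambda>t. c *\<^sub>R Y t)"
    by (rule sews_cong) (simp_all add: blinfun.scaleR_right scaleR_add_right)
  then show ?thesis using assms hol_scaleR[OF N] by (auto simp: affine_sol_def)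
qed

text \<open>With \<open>I\<close> sewn from \<open>K s\<close> applied to \<open>g s t\<close>, the
  Leibniz rule gives \<open>J I\<close> the germ \<open>M J I + J K g\<close>, which is
  \<open>M Y + g\<close> because \<open>K\<close> is a right inverse of \<open>J\<close>.\<close>

lemma variation_of_constants:
  fixes M :: "real \<Rightarrow> real \<Rightarrow> ('v::banach \<Rightarrow>\<^sub>L 'v)" and J K :: "real \<Rightarrow> ('v \<Rightarrow>\<^sub>L 'v)"
  assumes J: "hol N J" "sews T \<mu> (\<lambda>s t. M s t o\<^sub>L J s) J"
    and K: "hol N' K" "\<And>t. 0 \<le> t \<Longrightarrow> t \<le> T \<Longrightarrow> J t o\<^sub>L K t = id_blinfun"
    and g: "dominated 0 k g (\<lambda>_. 0::real)" "0 \<le> k"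
  obtains I where "I 0 = 0" "sews T \<mu> (\<lambda>s t. blinfun_apply (K s) (g s t)) I"
    "affine_sol M g (\<lambda>t. if t \<in> {0..T} then blinfun_apply (J t) (I t) else 0)"
proof -
  note bl = bounded_bilinear_blinfun_apply[where ?'a = 'v and ?'b = 'v]
  obtain a where a: "0 \<le> a" "\<And>J :: real \<Rightarrow> 'v \<Rightarrow>\<^sub>L 'v. dominated a 0 (\<lambda>s t. blinfun_apply (J s) (g s t)) J"
    by (rule dominated_prod[OF bounded_bilinear.flip[OF bl] g], rule that)
  obtain I where I: "I 0 = 0" "sews T \<mu> (\<lambda>s t. blinfun_apply (K s) (g s t)) I"
    using dominated_sewing[OF a(2) K(1) a(1) order_refl] by blast
  obtain c where c: "0 \<le> c" "dominated 0 c (\<lambda>s t. blinfun_apply (K s) (g s t)) (\<lambda>_. 0::real)"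
    by (rule dominated_germ[OF a(2) K(1) a(1) order_refl])
  obtain N'' where IN: "hol N'' I" using sews_hol[OF I(2), of c] dominatedD(1)[OF c(2)] by auto
  let ?Y = "\<lambda>t. if t \<in> {0..T} then blinfun_apply (J t) (I t) else 0"
  have KJ: "blinfun_apply (J t) (blinfun_apply (K t) v) = v" if "0 \<le> t" "t \<le> T" for t v
    using arg_cong[OF K(2)[OF that], of "\<lambda>L. blinfun_apply L v"] by simp
  have "sews T \<mu> (\<lambda>s t. blinfun_apply (M s t o\<^sub>L J s) (I s) + blinfun_apply (J s) (blinfun_apply (K s) (g s t))) (\<lambda>t. blinfun_apply (J t) (I t))"
    by (rule sews_prod[OF bl J(1) IN J(2) I(2)])
  then have "sews T \<mu> (\<lambda>s t. blinfun_apply (M s t) (?Y s) + g s t) ?Y"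
    by (rule sews_cong) (auto simp: KJ)
  moreover obtain B where "hol B (\<lambda>t. blinfun_apply (J t) (I t))" using hol_prod[OF bl J(1) IN] by blast
  then have "hol B ?Y" by (rule hol_cong) auto
  ultimately have "affine_sol M g ?Y" using I(1) by (auto simp: affine_sol_def)
  then show ?thesis using I that by blast
qed

lemma affine_sol_bound:
  fixes M :: "real \<Rightarrow> real \<Rightarrow> ('v::banach \<Rightarrow>\<^sub>L 'v)"
  assumes M: "dominated 0 m M (\<lambda>_. 0::real)" "0 \<le> m"
  obtains C where "0 \<le> C" "\<And>g k Y. dominated 0 k g (\<lambda>_. 0::real) \<Longrightarrow> 0 \<le> k \<Longrightarrow> affine_sol M g Y \<Longrightarrow>
    hol (C * k) Y \<and> (\<forall>t. 0 \<le> t \<longrightarrow> t \<le> T \<longrightarrow> norm (Y t) \<le> C * k)"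
proof -
  obtain a where a: "0 \<le> a" "\<And>J. dominated a 0 (\<lambda>s t. blinfun_apply (M s t) (J s)) J"
    by (rule dominated_prod[OF bounded_bilinear_blinfun_apply M], rule that)
  obtain C where C: "0 \<le> C"
    "\<And>(Z :: real \<Rightarrow> 'v) \<Gamma> \<eta> N. 0 \<le> \<eta> \<Longrightarrow> hol N Z \<Longrightarrow> dominated (a + 1) \<eta> \<Gamma> Z \<Longrightarrow> sews T \<mu> \<Gamma> Z \<Longrightarrow>
      hol (C * (norm (Z 0) + \<eta>)) Z \<and> (\<forall>t. 0 \<le> t \<longrightarrow> t \<le> T \<longrightarrow> norm (Z t) \<le> C * (norm (Z 0) + \<eta>))"
    by (rule stability[of "a + 1"]) (use a in auto)
  show ?thesis
  proof (rule that[OF C(1)])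
    fix g k Y assume g: "dominated 0 k g (\<lambda>_. 0::real)" "0 \<le> k" and Y: "affine_sol M g Y"
    have "dominated (a + 0) (0 + k) (\<lambda>s t. blinfun_apply (M s t) (Y s) + g s t) Y"
      by (rule dominated_add[OF a(2) dominated_any[OF g(1)]])
    then have d: "dominated (a + 1) k (\<lambda>s t. blinfun_apply (M s t) (Y s) + g s t) Y"
      by (rule dominated_mono) auto
    show "hol (C * k) Y \<and> (\<forall>t. 0 \<le> t \<longrightarrow> t \<le> T \<longrightarrow> norm (Y t) \<le> C * k)"
      using C(2)[OF g(2) _ d] Y by (auto simp: affine_sol_def)
  qed
qed

subsection \<open>The second order remainder\<close>

definition taylor_rem :: "('v::real_normed_vector \<Rightarrow> 'v) \<Rightarrow> ('v \<Rightarrow> 'v \<Rightarrow>\<^sub>L 'v) \<Rightarrow> 'v \<Rightarrow> 'v \<Rightarrow> 'v" where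
  "taylor_rem f Df x w = f (x + w) - f x - blinfun_apply (Df x) w"

text \<open>The smaller of \<open>p\<close> and \<open>q\<close>, raised to \<beta>, is at most the
  mixed power with exponents \<open>\<beta> - b\<close> and \<open>b\<close>.\<close>

lemma interpolate_min:
  assumes "0 \<le> d" "d \<le> m * p powr \<beta>" "d \<le> m * q powr \<beta>" "0 \<le> m" "0 \<le> p" "0 \<le> q" "b \<le> \<beta>"
  shows "d \<le> m * (p powr (\<beta> - b) * q powr b)"
proof (cases "p \<le> q")
  case True
  have "p powr \<beta> = p powr (\<beta> - b) * p powr b" by (simp add: powr_add[symmetric])
  also have "\<dots> \<le> p powr (\<beta> - b) * q powr b" using True assms b by (intro mult_left_mono powr_mono2) auto
  finally show ?thesis using assms(2,4) by (meson mult_left_mono order_trans)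
next
  case False
  have "q powr \<beta> = q powr (\<beta> - b) * q powr b" by (simp add: powr_add[symmetric])
  also have "\<dots> \<le> p powr (\<beta> - b) * q powr b" using False assms by (intro mult_right_mono powr_mono2) auto
  finally show ?thesis using assms(3,4) by (meson mult_left_mono order_trans)
qed

text \<open>In \<open>w\<close> the remainder at \<open>x\<close> has derivative
  \<open>Df (x + w) - Df x\<close>, which is of order \<open>norm w powr \<beta>\<close>; the mean
  value inequality gives the first bound. For two base points the derivative is small both in
  \<open>w\<close> and in \<open>x - y\<close>, and interpolating keeps \<open>b\<close> of the
  exponent for \<open>x - y\<close> and the rest for \<open>w\<close>.\<close>

lemma taylor_rem_bounds:
  fixes f :: "'v::real_normed_vector \<Rightarrow> 'v"
  assumes f: "\<And>x. (f has_derivative blinfun_apply (Df x)) (at x)"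
    and Df: "\<And>x y. norm (Df x - Df y) \<le> k * norm (x - y) powr \<beta>" and k: "0 \<le> k" and \<beta>: "b \<le> \<beta>"
    and w: "norm w \<le> B" "norm w' \<le> B"
  shows "norm (taylor_rem f Df x w - taylor_rem f Df x w') \<le> k * B powr \<beta> * norm (w - w')"
    and "norm (taylor_rem f Df x w - taylor_rem f Df y w) \<le> 2 * k * (norm w powr (\<beta> - b) * norm (x - y) powr b) * norm w"
proof -
  have \<beta>0: "0 < \<beta>" using \<beta> b by simp
  have shift: "((\<lambda>v. f (a + v)) has_derivative blinfun_apply (Df (a + v))) (at v within S)" for a v S
  proof -
    have "((\<lambda>v. a + v) has_derivative (\<lambda>v. v)) (at v within S)" by (auto intro!: derivative_eq_intros)
    from has_derivative_compose[OF this f] show ?thesis .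
  qed
  have der: "((\<lambda>v. taylor_rem f Df a v) has_derivative blinfun_apply (Df (a + v) - Df a)) (at v within S)" for a v S
    unfolding taylor_rem_def
    using has_derivative_diff[OF has_derivative_diff[OF shift[of a v S] has_derivative_const[of "f a"]]
        bounded_linear_imp_has_derivative[OF blinfun.bounded_linear_right[of "Df a"]]]
    by (simp add: blinfun.diff_left[abs_def])
  show "norm (taylor_rem f Df x w - taylor_rem f Df x w') \<le> k * B powr \<beta> * norm (w - w')"
  proof (rule differentiable_bound[of "cball 0 B" "\<lambda>v. taylor_rem f Df x v"])
    fix v :: 'v assume "v \<in> cball 0 B"
    then have "norm (Df (x + v) - Df x) \<le> k * norm v powr \<beta>" "norm v powr \<beta> \<le> B powr \<beta>"
      using Df[of "x + v" x] \<beta>0 by (auto intro!: powr_mono2)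
    then show "onorm (blinfun_apply (Df (x + v) - Df x)) \<le> k * B powr \<beta>"
      using k by (simp add: norm_blinfun.rep_eq[symmetric]) (meson mult_left_mono order_trans)
  qed (use der w in auto)
  have "norm ((taylor_rem f Df x w - taylor_rem f Df y w) - (taylor_rem f Df x 0 - taylor_rem f Df y 0))
     \<le> 2 * k * (norm w powr (\<beta> - b) * norm (x - y) powr b) * norm (w - 0)"
  proof (rule differentiable_bound[of "cball 0 (norm w)" "\<lambda>v. taylor_rem f Df x v - taylor_rem f Df y v"])
    fix v :: 'v assume v: "v \<in> cball 0 (norm w)"
    show "((\<lambda>v. taylor_rem f Df x v - taylor_rem f Df y v) has_derivative
        blinfun_apply ((Df (x + v) - Df x) - (Df (y + v) - Df y))) (at v within cball 0 (norm w))"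
      using has_derivative_diff[OF der[of x v] der[of y v]] by (simp add: blinfun.diff_left[abs_def])
    have vw: "norm v powr \<beta> \<le> norm w powr \<beta>" using v \<beta>0 by (auto intro!: powr_mono2)
    have "norm ((Df (x + v) - Df x) - (Df (y + v) - Df y)) \<le> k * norm v powr \<beta> + k * norm v powr \<beta>"
      using Df[of "x + v" x] Df[of "y + v" y] norm_triangle_ineq4[of "Df (x + v) - Df x" "Df (y + v) - Df y"] by simp
    also have "\<dots> \<le> 2 * k * norm w powr \<beta>" using mult_left_mono[OF vw k] by simp
    finally have 1: "norm ((Df (x + v) - Df x) - (Df (y + v) - Df y)) \<le> 2 * k * norm w powr \<beta>" .
    \<comment> \<open>The same four terms grouped the other way: pairing equal shifts gives
      smallness in \<open>x - y\<close>, pairing equal base points gave it in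
      \<open>v\<close>.\<close>
    have e: "(Df (x + v) - Df x) - (Df (y + v) - Df y) = (Df (x + v) - Df (y + v)) - (Df x - Df y)" by simp
    have 2: "norm ((Df (x + v) - Df x) - (Df (y + v) - Df y)) \<le> 2 * k * norm (x - y) powr \<beta>"
      unfolding e using Df[of "x + v" "y + v"] Df[of x y] norm_triangle_ineq4[of "Df (x + v) - Df (y + v)" "Df x - Df y"] by simp
    show "onorm (blinfun_apply ((Df (x + v) - Df x) - (Df (y + v) - Df y))) \<le> 2 * k * (norm w powr (\<beta> - b) * norm (x - y) powr b)"
      unfolding norm_blinfun.rep_eq[symmetric] using k \<beta> by (intro interpolate_min 1 2) auto
  qed auto
  then show "norm (taylor_rem f Df x w - taylor_rem f Df y w) \<le> 2 * k * (norm w powr (\<beta> - b) * norm (x - y) powr b) * norm w"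
    by (simp add: taylor_rem_def)
qed

text \<open>\<open>B\<close> bounds both the supremum and the Hoelder seminorm of \<open>Z\<close>.
  The defect splits into a change of \<open>Z\<close> at a fixed base point, of order
  \<open>B powr (1 + \<beta>)\<close> and time exponent 2\<alpha>, and a change of base point along
  \<open>X\<close>, of order \<open>B powr (1 + (\<beta> - b))\<close> and time exponent \<mu>. Both
  are superlinear in \<open>B\<close>.\<close>

lemma taylor_rem_dominated:
  assumes A: "regular_field m A D" and \<beta>: "b < \<beta>"
    and D: "\<And>s t x y. 0 \<le> s \<Longrightarrow> s \<le> t \<Longrightarrow> t \<le> T \<Longrightarrow>
      norm ((D t x - D s x) - (D t y - D s y)) \<le> m * (t - s) powr \<alpha> * norm (x - y) powr \<beta>"
    and X: "hol \<rho> X" and Z: "hol B Z" "\<And>t. 0 \<le> t \<Longrightarrow> t \<le> T \<Longrightarrow> norm (Z t) \<le> B"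
  shows "dominated 0 (m * (B powr (1 + \<beta>) * (1 + T powr (2 * \<alpha> - \<mu>)) + 2 * \<rho> powr b * B powr (1 + (\<beta> - b))))
    (\<lambda>s t. taylor_rem (\<lambda>x. A t x - A s x) (\<lambda>x. D t x - D s x) (X s) (Z s)) (\<lambda>_. 0::real)"
    (is "dominated 0 ?\<eta> ?R _")
proof (rule dominatedI)
  have m: "0 \<le> m" by (rule regular_fieldD(1)[OF A])
  have B: "0 \<le> B" by (rule hol_nonneg[OF Z(1)])
  have B\<beta>: "B powr \<beta> * B = B powr (1 + \<beta>)" "B powr (\<beta> - b) * B = B powr (1 + (\<beta> - b))"
    using B by (cases "B = 0"; simp add: powr_add mult.commute)+
  have \<eta>1: "m * B powr (1 + \<beta>) \<le> ?\<eta>" using m by (intro mult_left_mono) (auto simp: algebra_simps)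
  have \<eta>2: "m * (B powr (1 + \<beta>) * T powr (2 * \<alpha> - \<mu>)) + 2 * m * (B powr (1 + (\<beta> - b)) * \<rho> powr b) \<le> ?\<eta>"
    using m by (simp add: algebra_simps)
  note bounds = taylor_rem_bounds[OF increment_has_derivative[OF A] D]
  {
    fix s t assume st: "0 \<le> s" "s \<le> t" "t \<le> T"
    have "norm (?R s t - taylor_rem (\<lambda>x. A t x - A s x) (\<lambda>x. D t x - D s x) (X s) 0)
      \<le> m * (t - s) powr \<alpha> * B powr \<beta> * norm (Z s - 0)"
      using st m \<beta> B by (intro bounds(1)) (auto intro: Z(2))
    also have "\<dots> \<le> m * (t - s) powr \<alpha> * B powr \<beta> * B"
      using Z(2)[of s] st m by (intro mult_left_mono) auto
    also have "\<dots> = m * B powr (1 + \<beta>) * (t - s) powr \<alpha>" by (simp add: B\<beta>(1)[symmetric] mult_ac)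
    also have "\<dots> \<le> ?\<eta> * (t - s) powr \<alpha>" by (intro mult_right_mono \<eta>1) auto
    finally show "norm (?R s t) \<le> (0 * norm (0::real) + ?\<eta>) * (t - s) powr \<alpha>" by (simp add: taylor_rem_def)
  }
  fix s u t assume st: "0 \<le> s" "s \<le> u" "u \<le> t" "t \<le> T"
  define R where "R = taylor_rem (\<lambda>x. A t x - A u x) (\<lambda>x. D t x - D u x)"
  have e: "?R s t - ?R s u - ?R u t = - ((R (X u) (Z u) - R (X u) (Z s)) + (R (X u) (Z s) - R (X s) (Z s)))"
    by (simp add: R_def taylor_rem_def blinfun.diff_left)
  have "norm (R (X u) (Z u) - R (X u) (Z s)) \<le> m * (t - u) powr \<alpha> * B powr \<beta> * norm (Z u - Z s)"
    unfolding R_def using st m \<beta> by (intro bounds(1)) (auto intro: Z(2))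
  also have "\<dots> \<le> m * (t - s) powr \<alpha> * B powr \<beta> * (B * (t - s) powr \<alpha>)"
  proof (intro mult_mono mult_left_mono powr_mono2)
    have "norm (Z u - Z s) \<le> B * (u - s) powr \<alpha>" using st by (intro holD[OF Z(1)]) auto
    also have "\<dots> \<le> B * (t - s) powr \<alpha>" using st B \<alpha> by (intro mult_left_mono powr_mono2) auto
    finally show "norm (Z u - Z s) \<le> B * (t - s) powr \<alpha>" .
  qed (use m \<alpha> st B \<beta> b in auto)
  also have "\<dots> = m * B powr (1 + \<beta>) * (t - s) powr (2 * \<alpha>)"
    using powr_add[of "t - s" \<alpha> \<alpha>] by (simp add: B\<beta>(1)[symmetric] mult_ac)
  also have "\<dots> \<le> m * B powr (1 + \<beta>) * (T powr (2 * \<alpha> - \<mu>) * (t - s) powr \<mu>)"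
    using m st \<mu>_bounds by (intro mult_left_mono powr_le_T) auto
  finally have 1: "norm (R (X u) (Z u) - R (X u) (Z s)) \<le> m * (B powr (1 + \<beta>) * T powr (2 * \<alpha> - \<mu>)) * (t - s) powr \<mu>"
    by simp
  have "norm (R (X u) (Z s) - R (X s) (Z s))
    \<le> 2 * (m * (t - u) powr \<alpha>) * (norm (Z s) powr (\<beta> - b) * norm (X u - X s) powr b) * norm (Z s)"
    unfolding R_def using st m \<beta> by (intro bounds(2)[where w' = "Z s" and B = B]) (auto intro: Z(2))
  also have "\<dots> \<le> 2 * (m * (t - u) powr \<alpha>) * (B powr (\<beta> - b) * (\<rho> powr b * (u - s) powr (\<alpha> * b))) * B"
    using st m \<beta> b B Z(2)[of s] by (intro mult_mono mult_left_mono powr_mono2 hol_powr[OF X]) auto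
  also have "\<dots> = 2 * m * (B powr (1 + (\<beta> - b)) * \<rho> powr b) * ((t - u) powr \<alpha> * (u - s) powr (\<alpha> * b))"
    by (simp add: B\<beta>(2)[symmetric] mult_ac)
  also have "\<dots> \<le> 2 * m * (B powr (1 + (\<beta> - b)) * \<rho> powr b) * (t - s) powr \<mu>"
    using m st by (intro mult_left_mono split_powr) auto
  finally have 2: "norm (R (X u) (Z s) - R (X s) (Z s)) \<le> 2 * m * (B powr (1 + (\<beta> - b)) * \<rho> powr b) * (t - s) powr \<mu>" .
  have "norm (?R s t - ?R s u - ?R u t) \<le> (m * (B powr (1 + \<beta>) * T powr (2 * \<alpha> - \<mu>)) + 2 * m * (B powr (1 + (\<beta> - b)) * \<rho> powr b)) * (t - s) powr \<mu>"
    unfolding e norm_minus_cancel distrib_right by (rule norm_triangle_mono[OF 1 2])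
  also have "\<dots> \<le> ?\<eta> * (t - s) powr \<mu>" by (intro mult_right_mono \<eta>2) auto
  finally show "norm (?R s t - ?R s u - ?R u t)
    \<le> 0 * (t - s) powr \<alpha> * norm (0 - 0 :: real) + (0 * norm (0::real) + ?\<eta>) * (t - s) powr \<mu>" by simp
qed

text \<open>The gain \<open>\<beta> - b\<close> in the exponent of \<open>k\<close>, bought by integrating with the smaller Hoelder exponent
  \<open>b\<close>, is what makes the remainder superlinear.\<close>

lemma solution_remainder:
  fixes A :: "real \<Rightarrow> 'v::banach \<Rightarrow> 'v" and x :: 'v
  assumes A: "regular_field m A D" and \<beta>: "b < \<beta>" "\<beta> < 1"
    and D: "\<And>s t x y. 0 \<le> s \<Longrightarrow> s \<le> t \<Longrightarrow> t \<le> T \<Longrightarrow>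
      norm ((D t x - D s x) - (D t y - D s y)) \<le> m * (t - s) powr \<alpha> * norm (x - y) powr \<beta>"
  defines "X \<equiv> ito T \<alpha> A x"
  obtains C where "0 \<le> C" "\<And>H D' k Y. regular_field k H D' \<Longrightarrow> k \<le> 1 \<Longrightarrow>
      affine_sol (\<lambda>s t. D t (X s) - D s (X s)) (\<lambda>s t. H t (X s) - H s (X s)) Y \<Longrightarrow>
      hol (C * k powr (1 + (\<beta> - b))) (\<lambda>t. ito T \<alpha> (\<lambda>s v. A s v + H s v) x t - X t - Y t) \<and>
      (\<forall>t. 0 \<le> t \<longrightarrow> t \<le> T \<longrightarrow> norm (ito T \<alpha> (\<lambda>s v. A s v + H s v) x t - X t - Y t) \<le> C * k powr (1 + (\<beta> - b)))"
proof -
  define \<rho> where "\<rho> = apriori m"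
  \<comment> \<open>All perturbed solutions share this a priori bound, because \<open>k <= 1\<close>
    makes \<open>A + H\<close> a regular field with constant \<open>m + 1\<close>.\<close>
  define R where "R = apriori (m + 1)"
  define \<kappa> where "\<kappa> = \<beta> - b"
  have m: "0 \<le> m" by (rule regular_fieldD(1)[OF A])
  have X: "X 0 = x" "hol \<rho> X" "sews T \<mu> (\<lambda>s t. A t (X s) - A s (X s)) X"
    unfolding X_def \<rho>_def using ito_solution[OF A] by auto
  define M where "M s t = D t (X s) - D s (X s)" for s t
  have M: "dominated 0 (m * (1 + \<rho> powr b)) M (\<lambda>_. 0::real)"
    unfolding M_def using increments_germ[OF regular_fieldD(3,1)[OF A] X(2)] .
  obtain a where a: "0 \<le> a" "\<And>J. dominated a 0 (\<lambda>s t. blinfun_apply (M s t) (J s)) J"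
    by (rule dominated_prod[OF bounded_bilinear_blinfun_apply M], use m in simp, rule that)
  define a1 where "a1 = m * (1 + \<rho> powr b)"
  have a1: "0 \<le> a1" using m by (simp add: a1_def)
  obtain C1 where C1: "0 \<le> C1"
    "\<And>(Z :: real \<Rightarrow> 'v) \<Gamma> \<eta> N. 0 \<le> \<eta> \<Longrightarrow> hol N Z \<Longrightarrow> dominated (a1 + 1) \<eta> \<Gamma> Z \<Longrightarrow> sews T \<mu> \<Gamma> Z \<Longrightarrow>
      hol (C1 * (norm (Z 0) + \<eta>)) Z \<and> (\<forall>t. 0 \<le> t \<longrightarrow> t \<le> T \<longrightarrow> norm (Z t) \<le> C1 * (norm (Z 0) + \<eta>))"
    by (rule stability[of "a1 + 1"]) (use a1 in auto)
  obtain C2 where C2: "0 \<le> C2"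
    "\<And>(Z :: real \<Rightarrow> 'v) \<Gamma> \<eta> N. 0 \<le> \<eta> \<Longrightarrow> hol N Z \<Longrightarrow> dominated (a + 1) \<eta> \<Gamma> Z \<Longrightarrow> sews T \<mu> \<Gamma> Z \<Longrightarrow>
      hol (C2 * (norm (Z 0) + \<eta>)) Z \<and> (\<forall>t. 0 \<le> t \<longrightarrow> t \<le> T \<longrightarrow> norm (Z t) \<le> C2 * (norm (Z 0) + \<eta>))"
    by (rule stability[of "a + 1"]) (use a in auto)
  define c where "c = C1 * (1 + R powr b)"
  have c: "0 \<le> c" using C1 by (simp add: c_def)
  define E1 where "E1 = m * (c powr (1 + \<beta>) * (1 + T powr (2 * \<alpha> - \<mu>)) + 2 * \<rho> powr b * c powr (1 + \<kappa>))"
  define E2 where "E2 = (1 + \<rho> powr b) * c * T powr (2 * \<alpha> - \<mu>) + (1 + \<rho> powr b) * (c * T powr \<alpha>)"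
  have E: "0 \<le> E1" "0 \<le> E2" using m c by (auto simp: E1_def E2_def)
  show ?thesis
  proof (rule that[of "C2 * (E1 + E2)"])
    show "0 \<le> C2 * (E1 + E2)" using C2 E by simp
    fix H D' k Y
    assume H: "regular_field k H D'" and k1: "k \<le> 1"
      and Y: "affine_sol (\<lambda>s t. D t (X s) - D s (X s)) (\<lambda>s t. H t (X s) - H s (X s)) Y"
    have k: "0 \<le> k" by (rule regular_fieldD(1)[OF H])
    define y where "y = ito T \<alpha> (\<lambda>s v. A s v + H s v) x"
    have AH: "regular_field (m + 1) (\<lambda>s v. A s v + H s v) (\<lambda>s v. D s v + D' s v)"
      by (rule regular_field_mono[OF regular_field_add[OF A H]]) (use k1 in auto)
    have y: "y 0 = x" "hol R y" "sews T \<mu> (\<lambda>s t. A t (y s) + H t (y s) - (A s (y s) + H s (y s))) y"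
      unfolding y_def R_def using ito_solution[OF AH] by auto
    define Z where "Z t = y t - X t" for t
    have Z0: "Z 0 = 0" using y X by (simp add: Z_def)
    define G1 where "G1 s t = ((A t (y s) - A s (y s)) - (A t (X s) - A s (X s))) + (H t (y s) - H s (y s))" for s t
    have sZ: "sews T \<mu> G1 Z" unfolding Z_def
      by (rule sews_cong[OF sews_diff[OF y(3) X(3)]]) (simp_all add: G1_def)
    have "dominated (a1 + 0) (0 + k * (1 + R powr b)) G1 Z"
      unfolding G1_def a1_def Z_def
      by (rule dominated_add[OF field_difference_dominated[OF A X(2)] dominated_any[OF increments_germ[OF regular_fieldD(2,1)[OF H] y(2)]]])
    then have dZ: "dominated (a1 + 1) (k * (1 + R powr b)) G1 Z" by (rule dominated_mono) auto
    \<comment> \<open>First use of stability: the solutions themselves differ by order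
      \<open>k\<close>, with \<open>H\<close> along the perturbed solution as the
      perturbation.\<close>
    have Zb: "hol (c * k) Z" "\<And>t. 0 \<le> t \<Longrightarrow> t \<le> T \<Longrightarrow> norm (Z t) \<le> c * k"
    proof -
      have hZ: "hol (R + \<rho>) Z" unfolding Z_def by (rule hol_diff[OF y(2) X(2)])
      have e: "C1 * (norm (Z 0) + k * (1 + R powr b)) = c * k" by (simp add: Z0 c_def)
      have "hol (c * k) Z \<and> (\<forall>t. 0 \<le> t \<longrightarrow> t \<le> T \<longrightarrow> norm (Z t) \<le> c * k)"
        using C1(2)[OF _ hZ dZ sZ] k unfolding e by simp
      then show "hol (c * k) Z" "\<And>t. 0 \<le> t \<Longrightarrow> t \<le> T \<Longrightarrow> norm (Z t) \<le> c * k" by auto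
    qed
    define W where "W t = Z t - Y t" for t
    obtain NY where NY: "hol NY Y" using Y by (auto simp: affine_sol_def)
    have W0: "W 0 = 0" using Y Z0 by (simp add: W_def affine_sol_def)
    have hW: "hol (c * k + NY) W" unfolding W_def by (rule hol_diff[OF Zb(1) NY])
    \<comment> \<open>The germ of \<open>W\<close>, namely the linearised equation plus two
      perturbations: the Taylor remainder of \<open>A\<close>, of order \<open>1 + \<kappa>\<close>
      in \<open>k\<close>, and the change of \<open>H\<close> between the two solutions, which is
      quadratic in \<open>k\<close>. A second use of stability then bounds \<open>W\<close>.\<close>
    define G2 where "G2 s t = blinfun_apply (M s t) (W s)
       + (taylor_rem (\<lambda>x. A t x - A s x) (\<lambda>x. D t x - D s x) (X s) (Z s)
       + ((H t (y s) - H s (y s)) - (H t (X s) - H s (X s))))" for s t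
    have sY: "sews T \<mu> (\<lambda>s t. blinfun_apply (M s t) (Y s) + (H t (X s) - H s (X s))) Y"
      using Y by (simp add: affine_sol_def M_def)
    have sW: "sews T \<mu> G2 W" unfolding W_def
      by (rule sews_cong[OF sews_diff[OF sZ sY]])
        (simp_all add: G1_def G2_def taylor_rem_def W_def Z_def M_def blinfun.diff_right)
    have d1: "dominated 0 (m * ((c * k) powr (1 + \<beta>) * (1 + T powr (2 * \<alpha> - \<mu>)) + 2 * \<rho> powr b * (c * k) powr (1 + (\<beta> - b))))
      (\<lambda>s t. taylor_rem (\<lambda>x. A t x - A s x) (\<lambda>x. D t x - D s x) (X s) (Z s)) (\<lambda>_. 0::real)"
      by (rule taylor_rem_dominated[OF A \<beta>(1) D X(2) Zb])
    have d2: "dominated 0 (k * (1 + \<rho> powr b) * (c * k) * T powr (2 * \<alpha> - \<mu>) + (k * (1 + \<rho> powr b) * (norm (Z 0) + c * k * T powr \<alpha>) + 0))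
      (\<lambda>s t. (H t (y s) - H s (y s)) - (H t (X s) - H s (X s))) (\<lambda>_. 0::real)"
      using k by (intro dominated_germ_const[OF field_difference_dominated[OF H X(2), of y, folded Z_def] Zb(1)]) auto
    define \<eta> where "\<eta> = (E1 + E2) * k powr (1 + \<kappa>)"
    \<comment> \<open>For \<open>k <= 1\<close> the exponents 2 and \<open>1 + \<beta>\<close> may
      be lowered to the smallest one, \<open>1 + \<kappa>\<close>.\<close>
    have k2: "k * k \<le> k powr (1 + \<kappa>)" "k powr (1 + \<beta>) \<le> k powr (1 + \<kappa>)"
    proof -
      have "k * k = k powr 2" using k by (simp add: power2_eq_square)
      also have "\<dots> \<le> k powr (1 + \<kappa>)" using k k1 \<beta> b by (intro powr_mono') (auto simp: \<kappa>_def)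
      finally show "k * k \<le> k powr (1 + \<kappa>)" .
      show "k powr (1 + \<beta>) \<le> k powr (1 + \<kappa>)" using k k1 b by (intro powr_mono') (auto simp: \<kappa>_def)
    qed
    have e1: "m * ((c * k) powr (1 + \<beta>) * (1 + T powr (2 * \<alpha> - \<mu>)) + 2 * \<rho> powr b * (c * k) powr (1 + (\<beta> - b)))
      \<le> E1 * k powr (1 + \<kappa>)"
    proof -
      have "m * ((c * k) powr (1 + \<beta>) * (1 + T powr (2 * \<alpha> - \<mu>)) + 2 * \<rho> powr b * (c * k) powr (1 + (\<beta> - b)))
        = m * (c powr (1 + \<beta>) * (1 + T powr (2 * \<alpha> - \<mu>)) * k powr (1 + \<beta>) + 2 * \<rho> powr b * c powr (1 + \<kappa>) * k powr (1 + \<kappa>))"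
        using c k by (simp add: powr_mult \<kappa>_def mult_ac)
      also have "\<dots> \<le> m * (c powr (1 + \<beta>) * (1 + T powr (2 * \<alpha> - \<mu>)) * k powr (1 + \<kappa>) + 2 * \<rho> powr b * c powr (1 + \<kappa>) * k powr (1 + \<kappa>))"
        using m k2 by (intro mult_left_mono add_right_mono) auto
      also have "\<dots> = E1 * k powr (1 + \<kappa>)" by (simp add: E1_def algebra_simps)
      finally show ?thesis .
    qed
    have e2: "k * (1 + \<rho> powr b) * (c * k) * T powr (2 * \<alpha> - \<mu>) + (k * (1 + \<rho> powr b) * (norm (Z 0) + c * k * T powr \<alpha>) + 0)
      \<le> E2 * k powr (1 + \<kappa>)"
    proof -
      have "k * (1 + \<rho> powr b) * (c * k) * T powr (2 * \<alpha> - \<mu>) + (k * (1 + \<rho> powr b) * (norm (Z 0) + c * k * T powr \<alpha>) + 0) = E2 * (k * k)"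
        by (simp add: E2_def Z0 algebra_simps)
      also have "\<dots> \<le> E2 * k powr (1 + \<kappa>)" by (intro mult_left_mono k2 E)
      finally show ?thesis .
    qed
    have "dominated (a + (0 + 0)) (0 + (E1 * k powr (1 + \<kappa>) + E2 * k powr (1 + \<kappa>))) G2 W"
      unfolding G2_def
      by (rule dominated_add[OF a(2) dominated_add[OF dominated_any[OF dominated_mono[OF d1 order_refl e1]]
          dominated_any[OF dominated_mono[OF d2 order_refl e2]]]])
    then have dW: "dominated (a + 1) \<eta> G2 W" by (rule dominated_mono) (auto simp: \<eta>_def algebra_simps)
    have "hol (C2 * (norm (W 0) + \<eta>)) W \<and> (\<forall>t. 0 \<le> t \<longrightarrow> t \<le> T \<longrightarrow> norm (W t) \<le> C2 * (norm (W 0) + \<eta>))"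
      using E by (intro C2(2)[OF _ hW dW sW]) (auto simp: \<eta>_def)
    then have "hol (C2 * \<eta>) W \<and> (\<forall>t. 0 \<le> t \<longrightarrow> t \<le> T \<longrightarrow> norm (W t) \<le> C2 * \<eta>)"
      unfolding W0 norm_zero add_0_left .
    then show "hol (C2 * (E1 + E2) * k powr (1 + (\<beta> - b))) (\<lambda>t. ito T \<alpha> (\<lambda>s v. A s v + H s v) x t - X t - Y t) \<and>
      (\<forall>t. 0 \<le> t \<longrightarrow> t \<le> T \<longrightarrow> norm (ito T \<alpha> (\<lambda>s v. A s v + H s v) x t - X t - Y t) \<le> C2 * (E1 + E2) * k powr (1 + (\<beta> - b)))"
      by (simp add: W_def[abs_def] Z_def[abs_def] y_def \<eta>_def \<kappa>_def mult_ac)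
  qed
qed


section \<open>The derivative of the solution map, its equation and its explicit formula\<close>

lemma jac_sol_iff:
  fixes A :: "real \<Rightarrow> 'v::banach \<Rightarrow> 'v"
  assumes M: "dominated 0 m (\<lambda>s t. fderivx A t (X s) - fderivx A s (X s)) (\<lambda>_. 0::real)" "0 \<le> m"
  shows "is_jac_sol T \<alpha> A X J \<longleftrightarrow> (\<exists>N. hol N J) \<and> J 0 = id_blinfun \<and>
    sews T \<mu> (\<lambda>s t. (fderivx A t (X s) - fderivx A s (X s)) o\<^sub>L J s) J"
proof
  obtain a where a: "0 \<le> a" "\<And>J :: real \<Rightarrow> 'v \<Rightarrow>\<^sub>L 'v. dominated a 0 (\<lambda>s t. (fderivx A t (X s) - fderivx A s (X s)) o\<^sub>L J s) J"
    by (rule dominated_prod[OF bounded_bilinear_blinfun_compose M], rule that)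
  assume J: "is_jac_sol T \<alpha> A X J"
  then obtain N where N: "hol N J" by (auto simp: is_jac_sol_def holder_path_iff)
  have "sews T \<mu> (\<lambda>s t. (fderivx A t (X s) - fderivx A s (X s)) o\<^sub>L J s) J" "J 0 = id_blinfun"
    using J by (auto simp: is_jac_sol_def intro!: has_sewing_dominated[OF a(2) N a(1) order_refl, of J id_blinfun])
  then show "(\<exists>N. hol N J) \<and> J 0 = id_blinfun \<and>
    sews T \<mu> (\<lambda>s t. (fderivx A t (X s) - fderivx A s (X s)) o\<^sub>L J s) J" using N by blast
next
  assume J: "(\<exists>N. hol N J) \<and> J 0 = id_blinfun \<and>
    sews T \<mu> (\<lambda>s t. (fderivx A t (X s) - fderivx A s (X s)) o\<^sub>L J s) J"
  then have "has_sewing (\<lambda>s t. (fderivx A t (X s) - fderivx A s (X s)) o\<^sub>L J s) 0 t (J t - id_blinfun)" if "t \<in> {0..T}" for t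
    using sews_has_sewing[OF _ \<mu>, of T _ J t] that by auto
  then show "is_jac_sol T \<alpha> A X J" using J by (simp add: is_jac_sol_def holder_path_iff)
qed

text \<open>One Jacobian \<open>J0\<close> serves to prove that the affine equation is solvable.
  After that, \<open>L\<close> is pinned down by uniqueness alone, so the explicit formula for an
  arbitrary Jacobian \<open>J\<close> follows by recognising its right-hand side as a
  solution.\<close>

lemma ito_derivative:
  fixes A :: "real \<Rightarrow> 'v::banach \<Rightarrow> 'v" and x :: 'v
  assumes A: "field_space T \<alpha> \<beta> A" and \<beta>: "b < \<beta>" "\<beta> < 1"
  defines "X \<equiv> ito T \<alpha> A x"
  defines "M \<equiv> \<lambda>s t. fderivx A t (X s) - fderivx A s (X s)"
  defines "g \<equiv> \<lambda>B s t. B t (X s) - B s (X s)"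
  shows "\<exists>L. frechet_at (field_space T \<alpha> \<beta>) (field_space_norm T \<alpha> \<beta>) (holder_path T \<alpha>) (path_norm T \<alpha>)
            (\<lambda>A'. ito T \<alpha> A' x) A L
       \<and> (\<forall>B. field_space T \<alpha> \<beta> B \<longrightarrow>
              ((\<lambda>\<epsilon>. path_norm T \<alpha>
                   (\<lambda>t. (1 / \<epsilon>) *\<^sub>R (ito T \<alpha> (\<lambda>s v. A s v + \<epsilon> *\<^sub>R B s v) x t - X t) - L B t))
                 \<longlongrightarrow> 0) (at 0)
            \<and> holder_path T \<alpha> (L B)
            \<and> (\<forall>t\<in>{0..T}. \<exists>I1 I2.
                 has_sewing (\<lambda>s u. blinfun_apply (M s u) (L B s)) 0 t I1
               \<and> has_sewing (g B) 0 t I2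
               \<and> L B t = I1 + I2)
            \<and> (\<exists>J. is_jac_sol T \<alpha> A X J)
            \<and> (\<forall>J1 J2. is_jac_sol T \<alpha> A X J1 \<longrightarrow> is_jac_sol T \<alpha> A X J2 \<longrightarrow> (\<forall>t\<in>{0..T}. J1 t = J2 t))
            \<and> (\<forall>J. is_jac_sol T \<alpha> A X J \<longrightarrow>
                 (\<forall>t\<in>{0..T}.
                    (\<exists>K. K o\<^sub>L J t = id_blinfun \<and> J t o\<^sub>L K = id_blinfun)
                  \<and> (\<exists>I. has_sewing (\<lambda>s u. blinfun_apply (blinv (J s)) (g B s u)) 0 t I
                       \<and> L B t = blinfun_apply (J t) I))))"
proof -
  let ?S = "field_space T \<alpha> \<beta> :: (real \<Rightarrow> 'v \<Rightarrow> 'v) \<Rightarrow> bool"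
  let ?N = "field_space_norm T \<alpha> \<beta> :: (real \<Rightarrow> 'v \<Rightarrow> 'v) \<Rightarrow> real"
  define \<kappa> where "\<kappa> = \<beta> - b"
  have \<kappa>: "0 < \<kappa>" using \<beta> by (simp add: \<kappa>_def)
  define m where "m = 2 * ?N A"
  have regular: "regular_field (2 * ?N H) H (fderivx H)" if "?S H" for H
    using field_space_regular[OF that] \<beta> by simp
  note AR = regular[OF A, folded m_def]
  have m: "0 \<le> m" by (rule regular_fieldD(1)[OF AR])
  define \<rho> where "\<rho> = apriori m"
  have X: "hol \<rho> X" "sews T \<mu> (\<lambda>s t. A t (X s) - A s (X s)) X"
    unfolding X_def \<rho>_def using ito_solution[OF AR] by auto
  define l where "l = m * (1 + \<rho> powr b)"
  have l: "0 \<le> l" using m by (simp add: l_def)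
  have M: "dominated 0 l M (\<lambda>_. 0::real)"
    unfolding M_def l_def by (rule increments_germ[OF regular_fieldD(3,1)[OF AR] X(1)])
  have g: "dominated 0 (k * (1 + \<rho> powr b)) (g H) (\<lambda>_. 0::real)" "0 \<le> k * (1 + \<rho> powr b)" if "regular_field k H D" for k H D
    using increments_germ[OF regular_fieldD(2,1)[OF that] X(1)] regular_fieldD(1)[OF that] by (auto simp: g_def)
  have jac_iff: "is_jac_sol T \<alpha> A X J \<longleftrightarrow> (\<exists>N. hol N J) \<and> J 0 = id_blinfun \<and> sews T \<mu> (\<lambda>s t. M s t o\<^sub>L J s) J" for J
    unfolding M_def by (rule jac_sol_iff[OF M[unfolded M_def] l])
  obtain J0 where J0: "is_jac_sol T \<alpha> A X J0"
    using linear_exists[OF bounded_bilinear_blinfun_compose M l] unfolding jac_iff by blast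
  have jac_unique: "J1 t = J2 t" if J: "is_jac_sol T \<alpha> A X J1" "is_jac_sol T \<alpha> A X J2" and t: "t \<in> {0..T}" for J1 J2 t
  proof -
    obtain N1 N2 where J1: "hol N1 J1" "J1 0 = id_blinfun" "sews T \<mu> (\<lambda>s t. M s t o\<^sub>L J1 s) J1"
      and J2: "hol N2 J2" "J2 0 = id_blinfun" "sews T \<mu> (\<lambda>s t. M s t o\<^sub>L J2 s) J2"
      using J unfolding jac_iff by blast
    obtain a where a: "0 \<le> a" "\<And>J :: real \<Rightarrow> 'v \<Rightarrow>\<^sub>L 'v. dominated a 0 (\<lambda>s t. M s t o\<^sub>L J s) J"
      by (rule dominated_prod[OF bounded_bilinear_blinfun_compose M l], rule that)
    have sew: "sews T \<mu> (\<lambda>s t. M s t o\<^sub>L (J1 s - J2 s)) (\<lambda>t. J1 t - J2 t)"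
      by (rule sews_cong[OF sews_diff[OF J1(3) J2(3)]])
        (simp_all add: bounded_bilinear.diff_right[OF bounded_bilinear_blinfun_compose])
    have "J1 t - J2 t = 0"
      by (rule dominated_zero[OF a(2)[of "\<lambda>t. J1 t - J2 t"] a(1) sew hol_diff[OF J1(1) J2(1)]])
        (use t J1(2) J2(2) in auto)
    then show ?thesis by simp
  qed
  have explicit: "\<exists>K. (\<forall>t\<in>{0..T}. K t o\<^sub>L J t = id_blinfun \<and> J t o\<^sub>L K t = id_blinfun) \<and>
      (\<forall>H k D. regular_field k H D \<longrightarrow> (\<exists>I. I 0 = 0 \<and> sews T \<mu> (\<lambda>s t. blinfun_apply (K s) (g H s t)) I \<and>
        affine_sol M (g H) (\<lambda>t. if t \<in> {0..T} then blinfun_apply (J t) (I t) else 0)))"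
    if J: "is_jac_sol T \<alpha> A X J" for J
  proof -
    obtain N where JN: "J 0 = id_blinfun" "hol N J" "sews T \<mu> (\<lambda>s t. M s t o\<^sub>L J s) J" using J unfolding jac_iff by blast
    obtain K N' where K: "hol N' K" "\<And>t. 0 \<le> t \<Longrightarrow> t \<le> T \<Longrightarrow> K t o\<^sub>L J t = id_blinfun \<and> J t o\<^sub>L K t = id_blinfun"
      using flow_inverse[OF M l JN] by blast
    have "\<exists>I. I 0 = 0 \<and> sews T \<mu> (\<lambda>s t. blinfun_apply (K s) (g H s t)) I \<and>
        affine_sol M (g H) (\<lambda>t. if t \<in> {0..T} then blinfun_apply (J t) (I t) else 0)" if H: "regular_field k H D" for H k D
      using variation_of_constants[OF JN(2,3) K(1) conjunct2[OF K(2)] g[OF H]] by blast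
    then show ?thesis using K(2) by (intro exI[of _ K]) auto
  qed
  define L where "L H = (THE Y. affine_sol M (g H) Y)" for H
  have L_eq: "L H = Y" if "affine_sol M (g H) Y" for H Y
    unfolding L_def using that affine_sol_unique[OF M l] by blast
  have L: "affine_sol M (g H) (L H)" if "regular_field k H D" for H k D
    using explicit[OF J0] that L_eq by metis
  have L_add: "L (\<lambda>t v. H1 t v + H2 t v) = (\<lambda>t. L H1 t + L H2 t)" if "?S H1" "?S H2" for H1 H2
  proof -
    have "g (\<lambda>t v. H1 t v + H2 t v) = (\<lambda>s t. g H1 s t + g H2 s t)" by (simp add: g_def fun_eq_iff)
    then show ?thesis using affine_sol_add[OF L[OF regular[OF that(1)]] L[OF regular[OF that(2)]]] by (intro L_eq) simp
  qed
  have L_scale: "L (\<lambda>t v. c *\<^sub>R H t v) = (\<lambda>t. c *\<^sub>R L H t)" if "?S H" for c H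
  proof -
    have "g (\<lambda>t v. c *\<^sub>R H t v) = (\<lambda>s t. c *\<^sub>R g H s t)" by (simp add: g_def fun_eq_iff scaleR_diff_right)
    then show ?thesis using affine_sol_scaleR[OF L[OF regular[OF that]], of c] by (intro L_eq) simp
  qed
  obtain C1 where C1: "0 \<le> C1" "\<And>g k Y. dominated 0 k g (\<lambda>_. 0::real) \<Longrightarrow> 0 \<le> k \<Longrightarrow> affine_sol M g Y \<Longrightarrow>
    hol (C1 * k) Y \<and> (\<forall>t. 0 \<le> t \<longrightarrow> t \<le> T \<longrightarrow> norm (Y t) \<le> C1 * k)"
    by (rule affine_sol_bound[OF M l], rule that)
  have L_bound: "path_norm T \<alpha> (L H) \<le> (4 * C1 * (1 + \<rho> powr b)) * ?N H" if H: "?S H" for H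
  proof -
    have "path_norm T \<alpha> (L H) \<le> C1 * (2 * ?N H * (1 + \<rho> powr b)) + C1 * (2 * ?N H * (1 + \<rho> powr b))"
      using C1(2)[OF g[OF regular[OF H]] L[OF regular[OF H]]] by (intro path_norm_le) auto
    then show ?thesis by (simp add: algebra_simps)
  qed
  have DA: "norm ((fderivx A t x - fderivx A s x) - (fderivx A t y - fderivx A s y)) \<le> m * (t - s) powr \<alpha> * norm (x - y) powr \<beta>"
    if st: "0 \<le> s" "s \<le> t" "t \<le> T" for s t x y
  proof -
    have F: "field_bdd T \<alpha> \<beta> A" "field_bdd T \<alpha> \<beta> (fderivx A)" using A by (auto simp: field_space_def)
    have "field_norm T \<alpha> \<beta> (fderivx A) \<le> m"
      using field_norm_nonneg[OF F(1)] field_norm_nonneg[OF F(2)] by (simp add: m_def field_space_norm_def)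
    then show ?thesis by (intro order_trans[OF field_norm_bounds(2)[OF F(2) st]] mult_right_mono) auto
  qed
  obtain C2 where C2_nonneg: "0 \<le> C2" and C2': "\<And>H D' k Y. regular_field k H D' \<Longrightarrow> k \<le> 1 \<Longrightarrow>
      affine_sol (\<lambda>s t. fderivx A t (X s) - fderivx A s (X s)) (\<lambda>s t. H t (X s) - H s (X s)) Y \<Longrightarrow>
      hol (C2 * k powr (1 + (\<beta> - b))) (\<lambda>t. ito T \<alpha> (\<lambda>s v. A s v + H s v) x t - X t - Y t) \<and>
      (\<forall>t. 0 \<le> t \<longrightarrow> t \<le> T \<longrightarrow> norm (ito T \<alpha> (\<lambda>s v. A s v + H s v) x t - X t - Y t) \<le> C2 * k powr (1 + (\<beta> - b)))"
    by (rule solution_remainder[OF AR \<beta> DA, where x = x, folded X_def], assumption, assumption, assumption, rule that)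
  have C2_bound: "hol (C2 * k powr (1 + \<kappa>)) (\<lambda>t. ito T \<alpha> (\<lambda>s v. A s v + H s v) x t - X t - Y t)"
      "\<And>t. 0 \<le> t \<Longrightarrow> t \<le> T \<Longrightarrow> norm (ito T \<alpha> (\<lambda>s v. A s v + H s v) x t - X t - Y t) \<le> C2 * k powr (1 + \<kappa>)"
    if "regular_field k H D'" "k \<le> 1" "affine_sol M (g H) Y" for H D' k Y
    using C2'[OF that(1,2), of Y] that(3) unfolding M_def g_def \<kappa>_def by auto
  note C2 = C2_nonneg C2_bound
  have frechet: "frechet_at ?S ?N (holder_path T \<alpha>) (path_norm T \<alpha>) (\<lambda>A'. ito T \<alpha> A' x) A L"
    unfolding frechet_at_def
  proof (intro conjI allI impI)
    fix H assume H: "?S H"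
    show "holder_path T \<alpha> (L H)" using L[OF regular[OF H]] by (auto simp: holder_path_iff affine_sol_def)
  next
    show "\<exists>K. \<forall>H. ?S H \<longrightarrow> path_norm T \<alpha> (L H) \<le> K * ?N H" using L_bound by blast
  next
    fix e :: real assume e: "0 < e"
    \<comment> \<open>\<open>path_norm\<close> adds two copies of the remainder bound and
      \<open>k\<close> is twice the norm of \<open>H\<close>, whence \<open>4 * C2\<close>; the 1
      makes \<open>q\<close> positive. The threshold \<open>d\<close> ensures both
      \<open>k <= 1\<close> and \<open>k <= r\<close>, where
      \<open>r powr \<kappa> = e / q\<close>.\<close>
    define q where "q = 4 * C2 + 1"
    have q: "0 < q" using C2(1) by (simp add: q_def)
    define r where "r = (e / q) powr (1 / \<kappa>)"
    have r: "0 < r" "r powr \<kappa> = e / q" using e q \<kappa> by (auto simp: r_def powr_powr)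
    define d where "d = min (1/2) (r / 2)"
    show "\<exists>d>0. \<forall>H. ?S H \<longrightarrow> ?N H < d \<longrightarrow>
      path_norm T \<alpha> (\<lambda>t. ito T \<alpha> (\<lambda>s v. A s v + H s v) x t - ito T \<alpha> A x t - L H t) \<le> e * ?N H"
    proof (intro exI[of _ d] conjI allI impI)
      fix H assume H: "?S H" and n: "?N H < d"
      define k where "k = 2 * ?N H"
      note HR = regular[OF H, folded k_def]
      have k: "0 \<le> k" "k \<le> 1" "k \<le> r" using regular_fieldD(1)[OF HR] n by (auto simp: k_def d_def)
      have "path_norm T \<alpha> (\<lambda>t. ito T \<alpha> (\<lambda>s v. A s v + H s v) x t - X t - L H t) \<le> C2 * k powr (1 + \<kappa>) + C2 * k powr (1 + \<kappa>)"
        by (rule path_norm_le[OF C2(2,3)[OF HR k(2) L[OF HR]]])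
      also have "\<dots> = 2 * C2 * (k powr \<kappa> * k)" using k(1) by (cases "k = 0") (auto simp: powr_add)
      also have "\<dots> \<le> 2 * C2 * (e / q * k)"
        using C2(1) k \<kappa> powr_mono2[of \<kappa> k r] r by (intro mult_left_mono mult_right_mono) auto
      also have "\<dots> = (4 * C2 / q) * (e * ?N H)" by (simp add: k_def)
      also have "\<dots> \<le> 1 * (e * ?N H)" using q e k by (intro mult_right_mono) (auto simp: q_def k_def)
      finally show "path_norm T \<alpha> (\<lambda>t. ito T \<alpha> (\<lambda>s v. A s v + H s v) x t - ito T \<alpha> A x t - L H t) \<le> e * ?N H"
        by (simp add: X_def)
    qed (use r in \<open>auto simp: d_def\<close>)
  qed (use L_add L_scale in auto)
  have gateaux: "((\<lambda>\<epsilon>. path_norm T \<alpha> (\<lambda>t. (1 / \<epsilon>) *\<^sub>R (ito T \<alpha> (\<lambda>s v. A s v + \<epsilon> *\<^sub>R B s v) x t - X t) - L B t)) \<longlongrightarrow> 0) (at 0)"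
    if B: "?S B" for B
  proof -
    define k where "k = 2 * ?N B"
    note BR = regular[OF B, folded k_def]
    have k: "0 \<le> k" by (rule regular_fieldD(1)[OF BR])
    have bound: "0 \<le> path_norm T \<alpha> (\<lambda>t. (1 / \<epsilon>) *\<^sub>R (ito T \<alpha> (\<lambda>s v. A s v + \<epsilon> *\<^sub>R B s v) x t - X t) - L B t) \<and>
      path_norm T \<alpha> (\<lambda>t. (1 / \<epsilon>) *\<^sub>R (ito T \<alpha> (\<lambda>s v. A s v + \<epsilon> *\<^sub>R B s v) x t - X t) - L B t) \<le> 2 * C2 * k powr (1 + \<kappa>) * \<bar>\<epsilon>\<bar> powr \<kappa>"
      if \<epsilon>: "\<epsilon> \<noteq> 0" "\<bar>\<epsilon>\<bar> * k \<le> 1" for \<epsilon>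
    proof -
      \<comment> \<open>The remainder bound is applied directly to the scaled field as a
        \<open>regular_field\<close>, without first showing that it lies in
        \<open>field_space\<close>. Dividing by the scale leaves its power \<kappa>.\<close>
      define W where "W t = ito T \<alpha> (\<lambda>s v. A s v + \<epsilon> *\<^sub>R B s v) x t - X t - L (\<lambda>s v. \<epsilon> *\<^sub>R B s v) t" for t
      define c where "c = C2 * (\<bar>\<epsilon>\<bar> * k) powr (1 + \<kappa>)"
      have W: "hol c W" "\<And>t. 0 \<le> t \<Longrightarrow> t \<le> T \<Longrightarrow> norm (W t) \<le> c"
        using C2(2,3)[OF regular_field_scaleR[OF BR, of \<epsilon>] \<epsilon>(2) L[OF regular_field_scaleR[OF BR]]]
        by (simp_all add: W_def[abs_def] c_def)
      have e: "(\<lambda>t. (1 / \<epsilon>) *\<^sub>R (ito T \<alpha> (\<lambda>s v. A s v + \<epsilon> *\<^sub>R B s v) x t - X t) - L B t) = (\<lambda>t. (1 / \<epsilon>) *\<^sub>R W t)"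
        using \<epsilon>(1) by (simp add: W_def L_scale[OF B] scaleR_diff_right)
      have h: "hol (\<bar>1 / \<epsilon>\<bar> * c) (\<lambda>t. (1 / \<epsilon>) *\<^sub>R W t)" by (rule hol_scaleR[OF W(1)])
      have "path_norm T \<alpha> (\<lambda>t. (1 / \<epsilon>) *\<^sub>R W t) \<le> \<bar>1 / \<epsilon>\<bar> * c + \<bar>1 / \<epsilon>\<bar> * c"
        using W(2) by (intro path_norm_le h) (auto simp: divide_right_mono)
      also have "\<dots> = 2 * C2 * k powr (1 + \<kappa>) * \<bar>\<epsilon>\<bar> powr \<kappa>"
        using \<epsilon>(1) k by (simp add: c_def powr_mult powr_add)
      finally show ?thesis unfolding e using path_norm_nonneg[OF h] by blast
    qed
    have "eventually (\<lambda>\<epsilon>. \<epsilon> \<noteq> 0 \<and> \<bar>\<epsilon>\<bar> * k \<le> 1) (at 0)"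
    proof (rule eventually_at_topological[THEN iffD2])
      have k1: "0 < 1 / (k + 1)" using k by (simp add: add_nonneg_pos)
      have "\<bar>y\<bar> * k \<le> 1" if "y \<in> ball 0 (1 / (k + 1))" for y :: real
      proof -
        have "\<bar>y\<bar> * (k + 1) < 1" using that k by (simp add: dist_real_def field_simps)
        then show ?thesis by (simp add: distrib_left)
      qed
      then show "\<exists>S. open S \<and> 0 \<in> S \<and> (\<forall>y\<in>S. y \<noteq> 0 \<longrightarrow> y \<in> UNIV \<longrightarrow> y \<noteq> 0 \<and> \<bar>y\<bar> * k \<le> 1)"
        using k1 by (intro exI[of _ "ball 0 (1 / (k + 1))"]) auto
    qed
    then have ev: "eventually (\<lambda>\<epsilon>. norm (path_norm T \<alpha> (\<lambda>t. (1 / \<epsilon>) *\<^sub>R (ito T \<alpha> (\<lambda>s v. A s v + \<epsilon> *\<^sub>R B s v) x t - X t) - L B t))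
      \<le> 2 * C2 * k powr (1 + \<kappa>) * \<bar>\<epsilon>\<bar> powr \<kappa>) (at 0)"
      by (rule eventually_mono) (use bound in auto)
    have "((\<lambda>\<epsilon>. 2 * C2 * k powr (1 + \<kappa>) * \<bar>\<epsilon>\<bar> powr \<kappa>) \<longlongrightarrow> 2 * C2 * k powr (1 + \<kappa>) * \<bar>0\<bar> powr \<kappa>) (at 0)"
      using \<kappa> by (intro tendsto_intros tendsto_powr') auto
    then have "((\<lambda>\<epsilon>. 2 * C2 * k powr (1 + \<kappa>) * \<bar>\<epsilon>\<bar> powr \<kappa>) \<longlongrightarrow> 0) (at 0)" by simp
    then show ?thesis by (rule Lim_null_comparison[OF ev])
  qed
  \<comment> \<open>The two integrals are sewn separately; their sum sews the full germ and hence
    equals \<open>L B\<close>.\<close>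
  have affine: "\<exists>I1 I2. has_sewing (\<lambda>s u. blinfun_apply (M s u) (L B s)) 0 t I1 \<and> has_sewing (g B) 0 t I2 \<and> L B t = I1 + I2"
    if B: "?S B" and t: "t \<in> {0..T}" for B t
  proof -
    note BR = regular[OF B]
    obtain N where Y: "L B 0 = 0" "hol N (L B)" "sews T \<mu> (\<lambda>s t. blinfun_apply (M s t) (L B s) + g B s t) (L B)"
      using L[OF BR] by (auto simp: affine_sol_def)
    obtain a where a: "0 \<le> a" "\<And>J. dominated a 0 (\<lambda>s t. blinfun_apply (M s t) (J s)) J"
      by (rule dominated_prod[OF bounded_bilinear_blinfun_apply M l], rule that)
    obtain I1 where I1: "I1 0 = 0" "sews T \<mu> (\<lambda>s t. blinfun_apply (M s t) (L B s)) I1"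
      using dominated_sewing[OF a(2) Y(2) a(1) order_refl] by blast
    obtain I2 where I2: "I2 0 = 0" "sews T \<mu> (g B) I2"
      using dominated_sewing[OF g(1)[OF BR] hol_const order_refl g(2)[OF BR]] by blast
    have "L B t = I1 t + I2 t"
      using sews_unique[OF Y(3) sews_add[OF I1(2) I2(2)], of t] Y(1) I1(1) I2(1) t by simp
    then show ?thesis
      using sews_has_sewing[OF I1(2) \<mu>, of t] sews_has_sewing[OF I2(2) \<mu>, of t] I1(1) I2(1) t by auto
  qed
  have formula: "(\<exists>K. K o\<^sub>L J t = id_blinfun \<and> J t o\<^sub>L K = id_blinfun) \<and>
      (\<exists>I. has_sewing (\<lambda>s u. blinfun_apply (blinv (J s)) (g B s u)) 0 t I \<and> L B t = blinfun_apply (J t) I)"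
    if B: "?S B" and J: "is_jac_sol T \<alpha> A X J" and t: "t \<in> {0..T}" for B J t
  proof -
    obtain K where K: "\<And>t. t \<in> {0..T} \<Longrightarrow> K t o\<^sub>L J t = id_blinfun \<and> J t o\<^sub>L K t = id_blinfun"
      and KI: "\<And>H k D. regular_field k H D \<Longrightarrow> \<exists>I. I 0 = 0 \<and> sews T \<mu> (\<lambda>s t. blinfun_apply (K s) (g H s t)) I \<and>
        affine_sol M (g H) (\<lambda>t. if t \<in> {0..T} then blinfun_apply (J t) (I t) else 0)"
      using explicit[OF J] by blast
    obtain I where I: "I 0 = 0" "sews T \<mu> (\<lambda>s t. blinfun_apply (K s) (g B s t)) I"
      "affine_sol M (g B) (\<lambda>t. if t \<in> {0..T} then blinfun_apply (J t) (I t) else 0)"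
      using KI[OF regular[OF B]] by blast
    have inv: "blinv (J s) = K s" if "s \<in> {0..T}" for s using blinv_eq K[OF that] by blast
    have "sews T \<mu> (\<lambda>s t. blinfun_apply (blinv (J s)) (g B s t)) I"
      by (rule sews_cong[OF I(2)]) (auto simp: inv)
    then have "has_sewing (\<lambda>s t. blinfun_apply (blinv (J s)) (g B s t)) 0 t (I t)"
      using sews_has_sewing[OF _ \<mu>, of T _ I t] t I(1) by auto
    then show ?thesis using K[OF t] L_eq[OF I(3)] t by auto
  qed
  show ?thesis
  proof (intro exI[of _ L] conjI allI impI ballI frechet gateaux affine)
    fix B assume "?S B"
    then show "holder_path T \<alpha> (L B)" using L[OF regular] by (auto simp: holder_path_iff affine_sol_def)
  qed (use J0 jac_unique formula in blast)+
qed

end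

theorem mainTheorem8:
  fixes T \<alpha> \<beta> :: real and x :: "'v::banach"
  assumes "T > 0"
    and "\<exists>D::'v set. countable D \<and> closure D = UNIV"
    and "0 < \<alpha>" "\<alpha> < 1" "0 < \<beta>" "\<beta> < 1" "\<alpha> * (1 + \<beta>) > 1"
  shows "\<forall>A. field_space T \<alpha> \<beta> A \<longrightarrow>
    (\<exists>L. frechet_at (field_space T \<alpha> \<beta>) (field_space_norm T \<alpha> \<beta>) (holder_path T \<alpha>) (path_norm T \<alpha>)
            (\<lambda>A'. ito T \<alpha> A' x) A L
       \<and> (\<forall>B. field_space T \<alpha> \<beta> B \<longrightarrow>
           (let X = ito T \<alpha> A x; Y = L B in
              ((\<lambda>\<epsilon>. path_norm T \<alpha>
                   (\<lambda>t. (1 / \<epsilon>) *\<^sub>R (ito T \<alpha> (\<lambda>s v. A s v + \<epsilon> *\<^sub>R B s v) x t - X t) - Y t))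
                 \<longlongrightarrow> 0) (at 0)
            \<and> holder_path T \<alpha> Y
            \<and> (\<forall>t\<in>{0..T}. \<exists>I1 I2.
                 has_sewing (\<lambda>s u. blinfun_apply (fderivx A u (X s) - fderivx A s (X s)) (Y s)) 0 t I1
               \<and> has_sewing (\<lambda>s u. B u (X s) - B s (X s)) 0 t I2
               \<and> Y t = I1 + I2)
            \<and> (\<exists>J. is_jac_sol T \<alpha> A X J)
            \<and> (\<forall>J1 J2. is_jac_sol T \<alpha> A X J1 \<longrightarrow> is_jac_sol T \<alpha> A X J2 \<longrightarrow> (\<forall>t\<in>{0..T}. J1 t = J2 t))
            \<and> (\<forall>J. is_jac_sol T \<alpha> A X J \<longrightarrow>
                 (\<forall>t\<in>{0..T}.
                    (\<exists>K. K o\<^sub>L J t = id_blinfun \<and> J t o\<^sub>L K = id_blinfun)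
                  \<and> (\<exists>I. has_sewing (\<lambda>s u. blinfun_apply (blinv (J s)) (B u (X s) - B s (X s))) 0 t I
                       \<and> Y t = blinfun_apply (J t) I))))))"
proof (intro allI impI)
  fix A :: "real \<Rightarrow> 'v \<Rightarrow> 'v" assume A: "field_space T \<alpha> \<beta> A"
  \<comment> \<open>The midpoint between 1/\<alpha> - 1 and \<beta>: exceeding the former gives
    \<alpha>(1 + b) > 1, staying below the latter leaves the positive gain \<beta> - b.\<close>
  define b where "b = (1 / \<alpha> - 1 + \<beta>) / 2"
  have "1 / \<alpha> - 1 < \<beta>" "0 < 1 / \<alpha> - 1" using assms by (simp_all add: field_simps)
  then have hb: "1 / \<alpha> - 1 < b" "b < \<beta>" "0 < b" by (auto simp: b_def)
  have "1 < \<alpha> + \<alpha> * b" using hb(1) assms(3) by (simp add: field_simps)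
  then interpret young T \<alpha> b "\<alpha> + \<alpha> * b"
    by unfold_locales (use assms hb in auto)
  show "\<exists>L. frechet_at (field_space T \<alpha> \<beta>) (field_space_norm T \<alpha> \<beta>) (holder_path T \<alpha>) (path_norm T \<alpha>)
            (\<lambda>A'. ito T \<alpha> A' x) A L
       \<and> (\<forall>B. field_space T \<alpha> \<beta> B \<longrightarrow>
           (let X = ito T \<alpha> A x; Y = L B in
              ((\<lambda>\<epsilon>. path_norm T \<alpha>
                   (\<lambda>t. (1 / \<epsilon>) *\<^sub>R (ito T \<alpha> (\<lambda>s v. A s v + \<epsilon> *\<^sub>R B s v) x t - X t) - Y t))
                 \<longlongrightarrow> 0) (at 0)
            \<and> holder_path T \<alpha> Y
            \<and> (\<forall>t\<in>{0..T}. \<exists>I1 I2.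
                 has_sewing (\<lambda>s u. blinfun_apply (fderivx A u (X s) - fderivx A s (X s)) (Y s)) 0 t I1
               \<and> has_sewing (\<lambda>s u. B u (X s) - B s (X s)) 0 t I2
               \<and> Y t = I1 + I2)
            \<and> (\<exists>J. is_jac_sol T \<alpha> A X J)
            \<and> (\<forall>J1 J2. is_jac_sol T \<alpha> A X J1 \<longrightarrow> is_jac_sol T \<alpha> A X J2 \<longrightarrow> (\<forall>t\<in>{0..T}. J1 t = J2 t))
            \<and> (\<forall>J. is_jac_sol T \<alpha> A X J \<longrightarrow>
                 (\<forall>t\<in>{0..T}.
                    (\<exists>K. K o\<^sub>L J t = id_blinfun \<and> J t o\<^sub>L K = id_blinfun)
                  \<and> (\<exists>I. has_sewing (\<lambda>s u. blinfun_apply (blinv (J s)) (B u (X s) - B s (X s))) 0 t I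
                       \<and> Y t = blinfun_apply (J t) I)))))"
    unfolding Let_def by (rule ito_derivative[OF A hb(2) assms(6)])
qed

end
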